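(* For all initial data $y^0\in H^2\cap H^1_0(0,\pi)$, $\theta^0,p_1^0,p_2^0\in H^1_0(0,\pi)$, $y^1,\theta^1,p_1^1,p_2^1\in L^2(0,\pi)$ there exists a unique global-in-time weak solution $(p_1,p_2,y,\theta)$ (i.e. one belonging to $X_T$ and satisfying the weak formulation on $(0,T)$ for every $T>0$, uniquely so in $X_T$ for each $T$) of the nonlinear nonlocal system $$\begin{aligned} m\xi\ddot p_1&=\Big[\tfrac{H_0}{\xi^2}p_1'\Big]'+a\Big[\int_0^\pi\tfrac{s'(x)p_1'(x,t)}{\xi(x)}dx\Big]\tfrac{s''}{\xi^3}+\Phi(x,y+\ell\theta-p_1),\\ m\xi\ddot p_2&=\Big[\tfrac{H_0}{\xi^2}p_2'\Big]'+a\Big[\int_0^\pi\tfrac{s'(x)p_2'(x,t)}{\xi(x)}dx\Big]\tfrac{s''}{\xi^3}+\Phi(x,y-\ell\theta-p_2),\\ M\ddot y&=-EI\,y''''-\Phi(x,y+\ell\theta-p_1)-\Phi(x,y-\ell\theta-p_2),\\ \tfrac M3\ell^2\ddot\theta&=GK\,\theta''+\ell\Phi(x,y-\ell\theta-p_2)-\ell\Phi(x,y+\ell\theta-p_1), \end{aligned}$$ with boundary conditions $y=y''=p_1=p_2=\theta=0$ at $x=0,\pi$, satisfying $y(\cdot,0)=y^0$, $p_i(\cdot,0)=p_i^0$, $\theta(\cdot,0)=\theta^0$, $\dot y(\cdot,0)=y^1$, $\dot p_i(\cdot,0)=p_i^1$, $\dot\theta(\cdot,0)=\theta^1$. Here weak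 solution means that for all $t>0$, $v_i\in H^1_0(0,\pi)$, $w\in H^2\cap H^1_0(0,\pi)$: $m\langle\ddot p_1,v_1\rangle_\xi+(p_1,v_1)_{H^1_\xi}=a\big[\int_0^\pi\frac{s'p_1'}{\xi}\big]\big(\frac{s''}{\xi^3},v_1\big)_2+(\Phi(\cdot,y+\ell\theta-p_1),v_1)_2$; the analogous identity for $p_2$ with $\Phi(\cdot,y-\ell\theta-p_2)$; $M\langle\ddot y,w\rangle_*+EI(y,w)_{H^2}=-(\Phi(\cdot,y+\ell\theta-p_1)+\Phi(\cdot,y-\ell\theta-p_2),w)_2$; and $\frac M3\ell^2\langle\ddot\theta,v_3\rangle_1+GK(\theta,v_3)_{H^1}=(\ell\Phi(\cdot,y-\ell\theta-p_2)-\ell\Phi(\cdot,y+\ell\theta-p_1),v_3)_2$.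
   Context: Notation: $u'=\partial_x u$, $\dot u=\partial_t u$. Fixed positive constants $m,M,g,H_0,EI,GK,\ell$ and $a=AE/L_c$ with $A,E>0$; $s_0\in\mathbb{R}$. Let $s\in C^2([0,\pi])$ be the unique solution of $H_0 s''=(\tfrac M2+m\sqrt{1+s'^2})g$ on $(0,\pi)$, $s(0)=s(\pi)=s_0$; set $\xi(x)=\sqrt{1+s'(x)^2}$, $L_c=\int_0^\pi\xi$. Let $\kappa:[0,\pi]\to(0,\infty)$ be continuous (hanger stiffness) and $\Phi(x,r)=\big(\kappa(x)r+\tfrac{Mg}{2}\big)^+-\tfrac{Mg}{2}$. Scalar products on $(0,\pi)$: $(u,v)_2=\int uv$, $(u,v)_{H^1}=\int u'v'$, $(u,v)_{H^2}=\int u''v''$. $H^{-1}$ is the dual of $H^1_0$ with pairing $\langle\cdot,\cdot\rangle_1$, $H^*$ the dual of $H^2\cap H^1_0$ with pairing $\langle\cdot,\cdot\rangle_*$ (both extending $(\cdot,\cdot)_2$); $L^2_\xi$ is $L^2$ with $(u,v)_\xi=\int\xi uv$, $H^1_\xi$ is $H^1_0$ with $(u,v)_{H^1_\xi}=\int\frac{H_0}{\xi^2}u'v'$, and $\langle\cdot,\cdot\rangle_\xi$ is the duality pairing between the dual of $H^1_\xi$ and $H^1_\xi$ extending $(\cdot,\cdot)_\xi$. $X_T$ is the set of $(p_1,p_2,y,\theta)$ with $\theta,p_i\in C^0([0,T];H^1_0)\cap C^1([0,T];L^2)\cap C^2([0,T];H^{-1})$ and $y\in C^0([0,T];H^2\cap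 H^1_0)\cap C^1([0,T];L^2)\cap C^2([0,T];H^* )$. *)

theory Defs
  imports "HOL-Analysis.Analysis"
begin

text \<open>Elements of L2(0,pi) are represented by real functions (only values on [0,pi] matter,
  and only up to null sets).  Elements of H1_0 and of H2 cap H1_0 are represented by their
  continuous (absolutely continuous) representatives on [0,pi].\<close>

definition L2 :: "(real \<Rightarrow> real) \<Rightarrow> bool" where
  "L2 u \<longleftrightarrow> u measurable_on {0..pi} \<and> (\<lambda>x. (u x)\<^sup>2) integrable_on {0..pi}"

definition ip2 :: "(real \<Rightarrow> real) \<Rightarrow> (real \<Rightarrow> real) \<Rightarrow> real" where
  "ip2 u v = integral {0..pi} (\<lambda>x. u x * v x)"

definition norm2 :: "(real \<Rightarrow> real) \<Rightarrow> real" where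
  "norm2 u = sqrt (ip2 u u)"

definition H10 :: "(real \<Rightarrow> real) \<Rightarrow> bool" where
  "H10 u \<longleftrightarrow> (\<exists>g. L2 g \<and> (\<forall>x\<in>{0..pi}. u x = integral {0..x} g)) \<and> u pi = 0"

definition H2 :: "(real \<Rightarrow> real) \<Rightarrow> bool" where
  "H2 u \<longleftrightarrow> H10 u \<and> (\<exists>g h. L2 h \<and> (\<forall>x\<in>{0..pi}. u x = u 0 + integral {0..x} g)
                          \<and> (\<forall>x\<in>{0..pi}. g x = g 0 + integral {0..x} h))"

text \<open>Weak first and second derivatives (determined up to null sets).\<close>
definition d1 :: "(real \<Rightarrow> real) \<Rightarrow> real \<Rightarrow> real" where
  "d1 u = (SOME g. L2 g \<and> (\<forall>x\<in>{0..pi}. u x = u 0 + integral {0..x} g))"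

definition d2 :: "(real \<Rightarrow> real) \<Rightarrow> real \<Rightarrow> real" where
  "d2 u = (SOME h. L2 h \<and> (\<exists>g. (\<forall>x\<in>{0..pi}. u x = u 0 + integral {0..x} g)
                               \<and> (\<forall>x\<in>{0..pi}. g x = g 0 + integral {0..x} h)))"

definition h1norm :: "(real \<Rightarrow> real) \<Rightarrow> real" where
  "h1norm u = sqrt (ip2 (d1 u) (d1 u))"

definition h2norm :: "(real \<Rightarrow> real) \<Rightarrow> real" where
  "h2norm u = sqrt (ip2 (d2 u) (d2 u))"

text \<open>H^{-1}: bounded linear functionals on H1_0; H^*: bounded linear functionals on H2 cap H1_0.
  The pairings extend (.,.)_2 via the embedding f \<mapsto> (v \<mapsto> ip2 f v).\<close>
definition dualH1 :: "((real \<Rightarrow> real) \<Rightarrow> real) \<Rightarrow> bool" where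
  "dualH1 \<phi> \<longleftrightarrow>
     (\<forall>u v a b. H10 u \<longrightarrow> H10 v \<longrightarrow> \<phi> (\<lambda>x. a * u x + b * v x) = a * \<phi> u + b * \<phi> v) \<and>
     (\<exists>C. \<forall>v. H10 v \<longrightarrow> \<bar>\<phi> v\<bar> \<le> C * h1norm v)"

definition dnorm1 :: "((real \<Rightarrow> real) \<Rightarrow> real) \<Rightarrow> real" where
  "dnorm1 \<phi> = Sup {\<bar>\<phi> v\<bar> | v. H10 v \<and> h1norm v \<le> 1}"

definition dualH2 :: "((real \<Rightarrow> real) \<Rightarrow> real) \<Rightarrow> bool" where
  "dualH2 \<phi> \<longleftrightarrow>
     (\<forall>u v a b. H2 u \<longrightarrow> H2 v \<longrightarrow> \<phi> (\<lambda>x. a * u x + b * v x) = a * \<phi> u + b * \<phi> v) \<and>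
     (\<exists>C. \<forall>v. H2 v \<longrightarrow> \<bar>\<phi> v\<bar> \<le> C * h2norm v)"

definition dnorm2 :: "((real \<Rightarrow> real) \<Rightarrow> real) \<Rightarrow> real" where
  "dnorm2 \<phi> = Sup {\<bar>\<phi> v\<bar> | v. H2 v \<and> h2norm v \<le> 1}"

text \<open>U in C0([0,T];H1_0) cap C1([0,T];L2) cap C2([0,T];H^{-1}), with V the L2-valued time
  derivative and W the H^{-1}-valued second time derivative.\<close>
definition reg1 :: "real \<Rightarrow> (real \<Rightarrow> real \<Rightarrow> real) \<Rightarrow> (real \<Rightarrow> real \<Rightarrow> real)
                    \<Rightarrow> (real \<Rightarrow> (real \<Rightarrow> real) \<Rightarrow> real) \<Rightarrow> bool" where
  "reg1 T U V W \<longleftrightarrow>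
    (\<forall>t\<in>{0..T}. H10 (U t)) \<and>
    (\<forall>t\<in>{0..T}. ((\<lambda>s. h1norm (\<lambda>x. U s x - U t x)) \<longlongrightarrow> 0) (at t within {0..T})) \<and>
    (\<forall>t\<in>{0..T}. L2 (V t)) \<and>
    (\<forall>t\<in>{0..T}. ((\<lambda>s. norm2 (\<lambda>x. (U s x - U t x) / (s - t) - V t x)) \<longlongrightarrow> 0) (at t within {0..T})) \<and>
    (\<forall>t\<in>{0..T}. ((\<lambda>s. norm2 (\<lambda>x. V s x - V t x)) \<longlongrightarrow> 0) (at t within {0..T})) \<and>
    (\<forall>t\<in>{0..T}. dualH1 (W t)) \<and>
    (\<forall>t\<in>{0..T}. ((\<lambda>s. dnorm1 (\<lambda>v. ip2 (\<lambda>x. (V s x - V t x) / (s - t)) v - W t v)) \<longlongrightarrow> 0)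
                     (at t within {0..T})) \<and>
    (\<forall>t\<in>{0..T}. ((\<lambda>s. dnorm1 (\<lambda>v. W s v - W t v)) \<longlongrightarrow> 0) (at t within {0..T}))"

definition reg2 :: "real \<Rightarrow> (real \<Rightarrow> real \<Rightarrow> real) \<Rightarrow> (real \<Rightarrow> real \<Rightarrow> real)
                    \<Rightarrow> (real \<Rightarrow> (real \<Rightarrow> real) \<Rightarrow> real) \<Rightarrow> bool" where
  "reg2 T U V W \<longleftrightarrow>
    (\<forall>t\<in>{0..T}. H2 (U t)) \<and>
    (\<forall>t\<in>{0..T}. ((\<lambda>s. h2norm (\<lambda>x. U s x - U t x)) \<longlongrightarrow> 0) (at t within {0..T})) \<and>
    (\<forall>t\<in>{0..T}. L2 (V t)) \<and>
    (\<forall>t\<in>{0..T}. ((\<lambda>s. norm2 (\<lambda>x. (U s x - U t x) / (s - t) - V t x)) \<longlongrightarrow> 0) (at t within {0..T})) \<and>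
    (\<forall>t\<in>{0..T}. ((\<lambda>s. norm2 (\<lambda>x. V s x - V t x)) \<longlongrightarrow> 0) (at t within {0..T})) \<and>
    (\<forall>t\<in>{0..T}. dualH2 (W t)) \<and>
    (\<forall>t\<in>{0..T}. ((\<lambda>s. dnorm2 (\<lambda>v. ip2 (\<lambda>x. (V s x - V t x) / (s - t)) v - W t v)) \<longlongrightarrow> 0)
                     (at t within {0..T})) \<and>
    (\<forall>t\<in>{0..T}. ((\<lambda>s. dnorm2 (\<lambda>v. W s v - W t v)) \<longlongrightarrow> 0) (at t within {0..T}))"

definition xi :: "(real \<Rightarrow> real) \<Rightarrow> real \<Rightarrow> real" where
  "xi s1 x = sqrt (1 + (s1 x)\<^sup>2)"

definition Phi :: "(real \<Rightarrow> real) \<Rightarrow> real \<Rightarrow> real \<Rightarrow> real \<Rightarrow> real \<Rightarrow> real" where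
  "Phi \<kappa> M g x r = max (\<kappa> x * r + M * g / 2) 0 - M * g / 2"

text \<open>Weak solution on (0,T) in X_T with the given initial data.  s1, s2 are s', s'';
  a = A E / L_c with L_c = int_0^pi xi.  For f in H^{-1} the pairing with the dual of H1_xi
  (pivot L2_xi) is <f,v>_xi = <f, xi v>_1, the continuous extension of (f,v)_xi = (f, xi v)_2.\<close>
definition weak_sol ::
  "real \<Rightarrow> real \<Rightarrow> real \<Rightarrow> real \<Rightarrow> real \<Rightarrow> real \<Rightarrow> real \<Rightarrow> real \<Rightarrow> real
   \<Rightarrow> (real \<Rightarrow> real) \<Rightarrow> (real \<Rightarrow> real) \<Rightarrow> (real \<Rightarrow> real)
   \<Rightarrow> (real \<Rightarrow> real) \<Rightarrow> (real \<Rightarrow> real) \<Rightarrow> (real \<Rightarrow> real) \<Rightarrow> (real \<Rightarrow> real)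
   \<Rightarrow> (real \<Rightarrow> real) \<Rightarrow> (real \<Rightarrow> real) \<Rightarrow> (real \<Rightarrow> real) \<Rightarrow> (real \<Rightarrow> real)
   \<Rightarrow> real
   \<Rightarrow> (real \<Rightarrow> real \<Rightarrow> real) \<Rightarrow> (real \<Rightarrow> real \<Rightarrow> real) \<Rightarrow> (real \<Rightarrow> real \<Rightarrow> real) \<Rightarrow> (real \<Rightarrow> real \<Rightarrow> real)
   \<Rightarrow> bool" where
  "weak_sol m M g H0 EI GK l A E s1 s2 \<kappa> y0 th0 p10 p20 y1 th1 p11 p21 T p1 p2 y th \<longleftrightarrow>
    (let \<xi> = xi s1; a = A * E / integral {0..pi} \<xi>;
         \<Phi>1 = (\<lambda>t x. Phi \<kappa> M g x (y t x + l * th t x - p1 t x));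
         \<Phi>2 = (\<lambda>t x. Phi \<kappa> M g x (y t x - l * th t x - p2 t x))
     in \<exists>V1 W1 V2 W2 Vy Wy Vth Wth.
       reg1 T p1 V1 W1 \<and> reg1 T p2 V2 W2 \<and> reg2 T y Vy Wy \<and> reg1 T th Vth Wth \<and>
       (\<forall>t\<in>{0<..<T}. \<forall>v. H10 v \<longrightarrow>
          m * W1 t (\<lambda>x. \<xi> x * v x)
            + integral {0..pi} (\<lambda>x. H0 / (\<xi> x)\<^sup>2 * d1 (p1 t) x * d1 v x)
          = a * integral {0..pi} (\<lambda>x. s1 x * d1 (p1 t) x / \<xi> x) * ip2 (\<lambda>x. s2 x / (\<xi> x) ^ 3) v
            + ip2 (\<Phi>1 t) v) \<and>
       (\<forall>t\<in>{0<..<T}. \<forall>v. H10 v \<longrightarrow>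
          m * W2 t (\<lambda>x. \<xi> x * v x)
            + integral {0..pi} (\<lambda>x. H0 / (\<xi> x)\<^sup>2 * d1 (p2 t) x * d1 v x)
          = a * integral {0..pi} (\<lambda>x. s1 x * d1 (p2 t) x / \<xi> x) * ip2 (\<lambda>x. s2 x / (\<xi> x) ^ 3) v
            + ip2 (\<Phi>2 t) v) \<and>
       (\<forall>t\<in>{0<..<T}. \<forall>w. H2 w \<longrightarrow>
          M * Wy t w + EI * ip2 (d2 (y t)) (d2 w)
          = - ip2 (\<lambda>x. \<Phi>1 t x + \<Phi>2 t x) w) \<and>
       (\<forall>t\<in>{0<..<T}. \<forall>v. H10 v \<longrightarrow>
          M / 3 * l\<^sup>2 * Wth t v + GK * ip2 (d1 (th t)) (d1 v)
          = ip2 (\<lambda>x. l * \<Phi>2 t x - l * \<Phi>1 t x) v) \<and>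
       (\<forall>x\<in>{0..pi}. y 0 x = y0 x \<and> th 0 x = th0 x \<and> p1 0 x = p10 x \<and> p2 0 x = p20 x) \<and>
       norm2 (\<lambda>x. Vy 0 x - y1 x) = 0 \<and> norm2 (\<lambda>x. Vth 0 x - th1 x) = 0 \<and>
       norm2 (\<lambda>x. V1 0 x - p11 x) = 0 \<and> norm2 (\<lambda>x. V2 0 x - p21 x) = 0)"

end

theory Submission
  imports Defs
begin

text \<open>Write each wave or beam equation of the system as \<open>\<rho> u\<^sub>t\<^sub>t + D\<^sup>*(\<sigma> D u) = \<rho> f\<close>, where \<open>D\<close> is the
  first derivative on \<open>H\<^sup>1\<^sub>0\<close> or the second derivative on \<open>H\<^sup>2 \<inter> H\<^sup>1\<^sub>0\<close>. In the unknowns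
  \<open>q = \<surd>\<sigma> D u\<close> and \<open>v = \<surd>\<rho> u\<^sub>t\<close>, and with the bounded operator \<open>S\<close> sending \<open>\<surd>\<sigma> D u\<close> to \<open>\<surd>\<rho> u\<close>,
  the weak formulation says exactly \<open>(S q)\<^sub>t = v\<close> and \<open>(S\<^sup>* v)\<^sub>t = S\<^sup>* F - q\<close>, that is
  \<open>(B x)\<^sub>t = x + B (G x)\<close> for \<open>x = (q, v)\<close>, the bounded skew-adjoint operator
  \<open>B (q, v) = (- S\<^sup>* v, S q)\<close> and \<open>G x = (0, F)\<close>. Since the hanger force is Lipschitz and the nonlocal
  term is bounded of rank one from \<open>H\<^sup>1\<^sub>0\<close> to \<open>L\<^sup>2\<close>, \<open>G\<close> is Lipschitz on the Hilbert space
  of all states.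

  Solutions of this abstract equation are limits of the solutions of the ordinary differential
  equations \<open>y\<^sub>t = (B - \<epsilon>)\<^sup>-\<^sup>1 y + G y\<close>, whose linear part is bounded and dissipative.
  For uniqueness, the difference \<open>d\<close> of two solutions is regularised to \<open>z = (B - \<epsilon>)\<^sup>-\<^sup>1 B d\<close>: the
  energy of \<open>z\<close> is differentiable, skewness removes the unbounded part from its derivative, and
  \<open>z \<rightarrow> d\<close> because \<open>d\<close> lies in the closure of the range of \<open>B\<close>.\<close>

section \<open>Hilbert spaces\<close>

text \<open>The obstacle is regularity: a weak solution has u_t only in L2 and u_tt only in a dual
  space, so u_t is not an admissible test function and no energy identity is directly available.
  Applying the adjoint of S trades the dual norm for a Hilbert space norm. This is why the equation
  is kept in the form (B x)_t = x + B (G x) instead of being solved for x_t: B stands for the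
  inverse of the unbounded generator A, and every operator that occurs is bounded and everywhere
  defined. Formally (B - e)^-1 = A (1 - e A)^-1 and (B - e)^-1 B = (1 - e A)^-1, so the two
  operators of the overview are the Yosida approximation of A and the usual resolvent
  regularisation. The price is that B may have a kernel, made of strains orthogonal to all strains
  of admissible displacements. The equation itself forces solutions to be orthogonal to this kernel,
  hence to lie in the closure of the range of B, and there the regularisations converge.\<close>

lemma hilbert_projection_exists:
  fixes C :: "'e::{real_inner,banach} set"
  assumes sub: "subspace C" and cl: "closed C"
  shows "\<exists>p\<in>C. \<forall>c\<in>C. (x - p) \<bullet> c = 0"
proof -
  define N where "N = (\<lambda>c. (norm (x - c))\<^sup>2) ` C"
  define d where "d = Inf N"
  have bdd: "bdd_below N" unfolding N_def by (rule bdd_belowI[of _ 0]) auto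
  have ne: "N \<noteq> {}" using subspace_0[OF sub] by (auto simp: N_def)
  have dle: "d \<le> (norm (x - c))\<^sup>2" if "c \<in> C" for c
    unfolding d_def by (rule cInf_lower[OF _ bdd]) (use that in \<open>auto simp: N_def\<close>)
  have "\<exists>c\<in>C. (norm (x - c))\<^sup>2 < d + inverse (real (Suc n))" for n
    using cInf_lessD[OF ne, of "d + inverse (real (Suc n))"] by (auto simp: d_def N_def)
  then obtain c where c: "\<And>n. c n \<in> C" "\<And>n. (norm (x - c n))\<^sup>2 < d + inverse (real (Suc n))"
    by metis
  \<comment> \<open>Parallelogram law: the midpoint of \<open>c m\<close> and \<open>c n\<close>
    stays in \<open>C\<close>, so its squared distance from \<open>x\<close> is at least
    \<open>d\<close>, and two near-minimisers must be close to each other.\<close>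
  have par: "(norm (c m - c n))\<^sup>2 \<le> 2 * inverse (real (Suc m)) + 2 * inverse (real (Suc n))" for m n
  proof -
    have "(1/2) *\<^sub>R (c m + c n) \<in> C"
      using sub c(1) by (simp add: subspace_add subspace_scale)
    then have "d \<le> (norm (x - (1/2) *\<^sub>R (c m + c n)))\<^sup>2" by (rule dle)
    moreover have "(norm (c m - c n))\<^sup>2 = 2 * (norm (x - c m))\<^sup>2 + 2 * (norm (x - c n))\<^sup>2
        - 4 * (norm (x - (1/2) *\<^sub>R (c m + c n)))\<^sup>2"
      by (simp add: power2_norm_eq_inner inner_simps inner_commute algebra_simps)
    ultimately show ?thesis using c(2)[of m] c(2)[of n] by linarith
  qed
  have "Cauchy c"
  proof (rule CauchyI)
    fix e :: real assume "e > 0"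
    then have "e\<^sup>2 / 4 > 0" by simp
    then obtain K where K: "inverse (real (Suc K)) < e\<^sup>2 / 4" using reals_Archimedean by blast
    show "\<exists>K. \<forall>m\<ge>K. \<forall>n\<ge>K. norm (c m - c n) < e"
    proof (intro exI allI impI)
      fix m n assume mn: "K \<le> m" "K \<le> n"
      have "inverse (real (Suc m)) \<le> inverse (real (Suc K))" "inverse (real (Suc n)) \<le> inverse (real (Suc K))"
        using mn by (auto intro!: le_imp_inverse_le)
      with par[of m n] K have "(norm (c m - c n))\<^sup>2 < e\<^sup>2" by linarith
      then show "norm (c m - c n) < e" using \<open>e > 0\<close> by (simp add: power2_less_imp_less)
    qed
  qed
  then obtain p where p: "c \<longlonglongrightarrow> p" using Cauchy_convergent_iff convergent_def by blast
  have pC: "p \<in> C" using closed_sequentially[OF cl] c(1) p by blast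
  have "(\<lambda>n. (norm (x - c n))\<^sup>2) \<longlonglongrightarrow> (norm (x - p))\<^sup>2" by (intro tendsto_intros p)
  moreover have "(\<lambda>n. d + inverse (real (Suc n))) \<longlonglongrightarrow> d + 0"
    by (intro tendsto_intros LIMSEQ_inverse_real_of_nat)
  ultimately have dp: "(norm (x - p))\<^sup>2 \<le> d"
    using c(2) by (intro LIMSEQ_le[where X="\<lambda>n. (norm (x - c n))\<^sup>2" and Y="\<lambda>n. d + inverse (real (Suc n))"])
      (auto intro!: exI[of _ 0] less_imp_le)
  have "(x - p) \<bullet> w = 0" if "w \<in> C" for w
  proof (cases "w = 0")
    case False
    \<comment> \<open>\<open>t\<close> minimises the distance from \<open>x\<close> along the line
      through \<open>p\<close> in direction \<open>w\<close>; minimality of \<open>p\<close> then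
      leaves no room for a nonzero \<open>(x - p) \<bullet> w\<close>.\<close>
    define t where "t = ((x - p) \<bullet> w) / (w \<bullet> w)"
    have "p + t *\<^sub>R w \<in> C" using sub pC that by (simp add: subspace_add subspace_scale)
    from dle[OF this] dp have "(norm (x - p))\<^sup>2 \<le> (norm (x - (p + t *\<^sub>R w)))\<^sup>2" by linarith
    also have "\<dots> = (norm (x - p))\<^sup>2 - 2 * t * ((x - p) \<bullet> w) + t\<^sup>2 * (w \<bullet> w)"
      unfolding power2_norm_eq_inner by (simp add: inner_simps inner_commute algebra_simps power2_eq_square)
    also have "\<dots> = (norm (x - p))\<^sup>2 - ((x - p) \<bullet> w)\<^sup>2 / (w \<bullet> w)"
      using False by (simp add: t_def power2_eq_square field_simps)
    finally have "((x - p) \<bullet> w)\<^sup>2 / (w \<bullet> w) \<le> 0" by linarith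
    moreover have "w \<bullet> w > 0" using False by simp
    ultimately have "((x - p) \<bullet> w)\<^sup>2 \<le> 0" by (simp add: divide_le_0_iff)
    then show ?thesis by simp
  qed simp
  with pC show ?thesis by blast
qed

lemma subspace_closure:
  fixes S :: "'e::real_normed_vector set"
  assumes S: "subspace S"
  shows "subspace (closure S)"
proof (rule subspaceI)
  show "0 \<in> closure S" using subspace_0[OF S] closure_subset by blast
  fix x y assume "x \<in> closure S" "y \<in> closure S"
  then obtain u v where "\<And>n. u n \<in> S" "u \<longlonglongrightarrow> x" "\<And>n. v n \<in> S" "v \<longlonglongrightarrow> y"
    unfolding closure_sequential by blast
  then show "x + y \<in> closure S"
    unfolding closure_sequential
    by (intro exI[of _ "\<lambda>n. u n + v n"]) (auto intro: subspace_add[OF S] tendsto_add)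
next
  fix c x assume "x \<in> closure S"
  then obtain u where "\<And>n. u n \<in> S" "u \<longlonglongrightarrow> x"
    unfolding closure_sequential by blast
  then show "c *\<^sub>R x \<in> closure S"
    unfolding closure_sequential
    by (intro exI[of _ "\<lambda>n. c *\<^sub>R u n"]) (auto intro: subspace_scale[OF S] tendsto_scaleR)
qed

text \<open>Orthogonality of \<open>x - Q x\<close> to \<open>C\<close> determines
  \<open>Q x\<close>, so additivity, homogeneity and self-adjointness all follow by checking this
  one condition.\<close>

lemma orthogonal_projection_exists:
  fixes C :: "'e::{real_inner,banach} set"
  assumes sub: "subspace C" and cl: "closed C"
  obtains Q where "bounded_linear Q" "\<And>x. Q x \<in> C" "\<And>x. x \<in> C \<Longrightarrow> Q x = x"
    "\<And>x y. Q x \<bullet> y = x \<bullet> Q y"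
proof -
  from hilbert_projection_exists[OF assms] obtain Q
    where Q: "\<And>x. Q x \<in> C" "\<And>x c. c \<in> C \<Longrightarrow> (x - Q x) \<bullet> c = 0" by metis
  have uniq: "Q x = p" if "p \<in> C" "\<And>c. c \<in> C \<Longrightarrow> (x - p) \<bullet> c = 0" for x p
  proof -
    have m: "Q x - p \<in> C" using sub Q(1) that(1) by (simp add: subspace_diff)
    have "(Q x - p) \<bullet> (Q x - p) = (x - p) \<bullet> (Q x - p) - (x - Q x) \<bullet> (Q x - p)"
      by (simp add: inner_simps)
    also have "\<dots> = 0" using Q(2)[OF m] that(2)[OF m] by simp
    finally show ?thesis by simp
  qed
  have lin: "Q (x + y) = Q x + Q y" "Q (r *\<^sub>R x) = r *\<^sub>R Q x" for x y r
  proof -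
    show "Q (x + y) = Q x + Q y"
    proof (rule uniq)
      fix c assume "c \<in> C"
      then show "(x + y - (Q x + Q y)) \<bullet> c = 0"
        using Q(2)[of c x] Q(2)[of c y] by (simp add: inner_simps)
    qed (use sub Q(1) in \<open>simp add: subspace_add\<close>)
    show "Q (r *\<^sub>R x) = r *\<^sub>R Q x"
    proof (rule uniq)
      fix c assume "c \<in> C"
      then show "(r *\<^sub>R x - r *\<^sub>R Q x) \<bullet> c = 0"
        using Q(2)[of c x] by (simp add: inner_simps)
    qed (use sub Q(1) in \<open>simp add: subspace_scale\<close>)
  qed
  have bd: "norm (Q x) \<le> norm x * 1" for x
  proof -
    have "(norm (Q x))\<^sup>2 = x \<bullet> Q x"
      using Q(2)[OF Q(1), of x x] by (simp add: power2_norm_eq_inner inner_simps)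
    also have "\<dots> \<le> norm x * norm (Q x)" by (rule norm_cauchy_schwarz)
    finally show ?thesis
      by (metis linorder_not_le mult.right_neutral mult_right_le_imp_le norm_ge_zero order_le_less_trans power2_eq_square)
  qed
  show thesis
  proof (rule that)
    show "bounded_linear Q" by (rule bounded_linear_intro[OF lin bd])
    show "Q x \<in> C" for x by (rule Q(1))
    show "Q x = x" if "x \<in> C" for x by (rule uniq) (use that in auto)
    show "Q x \<bullet> y = x \<bullet> Q y" for x y
      using Q(2)[OF Q(1), of x y] Q(2)[OF Q(1), of y x] by (simp add: inner_simps inner_commute)
  qed
qed

text \<open>The complement of the kernel of \<open>f\<close> is a line. It is spanned by
  \<open>r\<close>, the part of a vector with \<open>f x = 1\<close> that is orthogonal to the
  kernel; every \<open>y\<close> differs from \<open>f y *\<^sub>R r\<close> by a kernel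
  element.\<close>

lemma riesz_representation:
  fixes f :: "'e::{real_inner,banach} \<Rightarrow> real"
  assumes f: "bounded_linear f"
  shows "\<exists>r. \<forall>y. f y = r \<bullet> y"
proof (cases "\<forall>y. f y = 0")
  case True
  then show ?thesis by (intro exI[of _ 0]) simp
next
  case False
  then obtain x0 where "f x0 \<noteq> 0" by blast
  interpret f: bounded_linear f by (rule f)
  define x where "x = (1 / f x0) *\<^sub>R x0"
  have fx: "f x = 1" using \<open>f x0 \<noteq> 0\<close> by (simp add: x_def f.scaleR)
  define C where "C = {y. f y = 0}"
  have "subspace C" by (auto simp: C_def subspace_def f.add f.scaleR f.zero)
  moreover have "closed C" unfolding C_def
    by (rule closed_Collect_eq) (auto intro: linear_continuous_on f continuous_intros)
  ultimately obtain p where p: "p \<in> C" "\<And>c. c \<in> C \<Longrightarrow> (x - p) \<bullet> c = 0"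
    using hilbert_projection_exists by metis
  define r where "r = x - p"
  have fr: "f r = 1" using fx p(1) by (simp add: r_def C_def f.diff)
  then have r0: "r \<bullet> r \<noteq> 0" using f.zero by auto
  have "f y = (r /\<^sub>R (r \<bullet> r)) \<bullet> y" for y
  proof -
    have "y - f y *\<^sub>R r \<in> C" by (simp add: C_def f.diff f.scaleR fr)
    from p(2)[OF this] have "r \<bullet> y = f y * (r \<bullet> r)" by (simp add: r_def inner_simps)
    then show ?thesis using r0 by (simp add: field_simps)
  qed
  then show ?thesis by blast
qed

lemma hilbert_adjoint_exists:
  fixes S :: "'e::{real_inner,banach} \<Rightarrow> 'f::{real_inner,banach}"
  assumes S: "bounded_linear S"
  obtains S' where "bounded_linear S'" "\<And>x y. S x \<bullet> y = x \<bullet> S' y"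
proof -
  interpret S: bounded_linear S by (rule S)
  have "\<exists>r. \<forall>x. S x \<bullet> y = r \<bullet> x" for y
    by (rule riesz_representation) (rule bounded_linear_inner_left_comp[OF S])
  then obtain S' where S': "\<And>x y. S x \<bullet> y = S' y \<bullet> x" by metis
  have eqI: "u = v" if "\<And>x. u \<bullet> x = v \<bullet> x" for u v :: 'e
    using that[of "u - v"] by (metis diff_self eq_iff_diff_eq_0 inner_diff_left inner_eq_zero_iff)
  obtain K where K: "\<And>x. norm (S x) \<le> norm x * K" "K \<ge> 0" using S.nonneg_bounded by blast
  have "bounded_linear S'"
  proof (rule bounded_linear_intro)
    show "S' (x + y) = S' x + S' y" for x y
      by (rule eqI) (simp add: inner_add_left S'[symmetric] inner_add_right)
    show "S' (r *\<^sub>R x) = r *\<^sub>R S' x" for r x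
      by (rule eqI) (simp add: S'[symmetric])
    show "norm (S' x) \<le> norm x * K" for x
    proof -
      have "(norm (S' x))\<^sup>2 = S (S' x) \<bullet> x" by (simp add: S' power2_norm_eq_inner)
      also have "\<dots> \<le> norm (S (S' x)) * norm x" by (rule norm_cauchy_schwarz)
      also have "\<dots> \<le> (norm (S' x) * K) * norm x" by (intro mult_right_mono K(1)) simp
      finally have "norm (S' x) * norm (S' x) \<le> norm (S' x) * (norm x * K)"
        by (simp add: power2_eq_square mult_ac)
      then show ?thesis
        by (metis K(2) linorder_not_le mult_left_le_imp_le mult_nonneg_nonneg norm_ge_zero order_le_less_trans)
    qed
  qed
  then show thesis using that S' by (simp add: inner_commute)
qed

section \<open>Semilinear evolution equations with a skew-adjoint generator\<close>

lemma at_within_atLeast: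
  fixes t T :: real
  assumes "t < T" "0 \<le> t"
  shows "at t within {0..T} = at t within {0..}"
  by (rule at_within_nhd[of _ "{..<T}"]) (use assms in auto)

lemma integral_uniform_limit:
  fixes F :: "nat \<Rightarrow> real \<Rightarrow> 'e::banach"
  assumes "uniform_limit {a..b} F f sequentially" "\<And>n. continuous_on {a..b} (F n)"
  shows "(\<lambda>n. integral {a..b} (F n)) \<longlonglongrightarrow> integral {a..b} f"
  using uniform_limit_integral[OF assms]
  by (metis (no_types, lifting) ext integral_unique sequentially_bot)

lemma uniform_limit_lipschitz_comp:
  fixes f :: "'a::metric_space \<Rightarrow> 'b::metric_space"
  assumes u: "uniform_limit X F h A" and f: "K-lipschitz_on UNIV f"
  shows "uniform_limit X (\<lambda>n s. f (F n s)) (\<lambda>s. f (h s)) A"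
proof (rule uniform_limitI)
  fix e :: real assume "e > 0"
  have K: "K \<ge> 0" using f by (rule lipschitz_on_nonneg)
  from uniform_limitD[OF u, of "e / (K + 1)"] \<open>e > 0\<close> K
  have "\<forall>\<^sub>F n in A. \<forall>x\<in>X. dist (F n x) (h x) < e / (K + 1)" by auto
  then show "\<forall>\<^sub>F n in A. \<forall>x\<in>X. dist (f (F n x)) (f (h x)) < e"
  proof eventually_elim
    case (elim n)
    show ?case
    proof
      fix x assume "x \<in> X"
      have "dist (f (F n x)) (f (h x)) \<le> K * dist (F n x) (h x)"
        using lipschitz_onD[OF f] by simp
      also have "\<dots> \<le> (K + 1) * dist (F n x) (h x)" by (simp add: mult_right_mono)
      also have "\<dots> < e" using elim \<open>x \<in> X\<close> K by (auto simp: field_simps)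
      finally show "dist (f (F n x)) (f (h x)) < e" .
    qed
  qed
qed

text \<open>Picard iteration measured against the weight \<open>exp (2 * L * t)\<close>: integrating
  the weight divides by \<open>2 * L\<close>, the Lipschitz bound multiplies by \<open>L\<close>, so
  each iteration gains a factor one half on every bounded interval at once. The solution is thus
  global without any continuation argument.\<close>

lemma global_lipschitz_ode:
  fixes f :: "'e::banach \<Rightarrow> 'e"
  assumes f: "K-lipschitz_on UNIV f"
  obtains x where "x 0 = x0" "\<And>t. t \<ge> 0 \<Longrightarrow> (x has_vector_derivative f (x t)) (at t within {0..})"
proof -
  \<comment> \<open>Raising the constant to at least 1 makes \<open>exp (2 * L * t)\<close> dominate
    \<open>t\<close>, which the base case of \<open>step\<close> needs.\<close>
  define L where "L = K + 1"
  have L: "L \<ge> 1" using lipschitz_on_nonneg[OF f] by (simp add: L_def)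
  have fL: "norm (f u - f v) \<le> L * norm (u - v)" for u v
    using lipschitz_onD[OF f, of u v] norm_ge_zero[of "u - v"]
    by (simp add: L_def dist_norm algebra_simps del: norm_ge_zero)
  have fc: "continuous_on S f" for S
    using lipschitz_on_continuous_on[OF f] continuous_on_subset by blast
  define X where "X = rec_nat (\<lambda>t. x0) (\<lambda>n (Y :: real \<Rightarrow> 'e) t. x0 + integral {0..t} (\<lambda>s. f (Y s)))"
  have X0: "X 0 = (\<lambda>t. x0)" and XS: "X (Suc n) = (\<lambda>t. x0 + integral {0..t} (\<lambda>s. f (X n s)))" for n
    by (simp_all add: X_def)
  have Xc: "continuous_on {0..T} (X n)" for n T
  proof (induction n)
    case (Suc n)
    have "continuous_on {0..T} (\<lambda>s. f (X n s))"
      by (rule continuous_on_compose2[OF fc[of UNIV] Suc]) auto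
    then show ?case unfolding XS
      by (intro continuous_intros indefinite_integral_continuous_1 integrable_continuous_interval)
  qed (simp add: X0)
  have fXi: "(\<lambda>s. f (X n s)) integrable_on {0..t}" for n t
    by (intro integrable_continuous_interval continuous_on_compose2[OF fc[of UNIV] Xc]) auto
  define A where "A = norm (f x0)"
  have step: "norm (X (Suc n) t - X n t) \<le> A * (1/2)^n * exp (2 * L * t)" if "t \<ge> 0" for n t
    using that
  proof (induction n arbitrary: t)
    case 0
    have "norm (X (Suc 0) t - X 0 t) = t * A" using 0 by (simp add: XS X0 A_def)
    also have "t \<le> exp (2 * L * t)"
    proof -
      have "t \<le> 2 * L * t" using mult_right_mono[OF L 0] 0 by linarith
      also have "\<dots> \<le> exp (2 * L * t)" using exp_ge_add_one_self[of "2 * L * t"] by linarith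
      finally show ?thesis .
    qed
    then have "t * A \<le> exp (2 * L * t) * A" by (rule mult_right_mono) (simp add: A_def)
    finally show ?case by (simp add: mult_ac)
  next
    case (Suc n)
    let ?g = "\<lambda>s. L * (A * (1/2)^n * exp (2 * L * s))"
    let ?G = "\<lambda>s. A * (1/2)^(Suc n) * exp (2 * L * s)"
    have gi: "(?g has_integral (?G t - ?G 0)) {0..t}"
      using \<open>t \<ge> 0\<close>
      by (intro fundamental_theorem_of_calculus)
         (auto intro!: derivative_eq_intros simp: has_real_derivative_iff_has_vector_derivative[symmetric])
    have "X (Suc (Suc n)) t - X (Suc n) t = integral {0..t} (\<lambda>s. f (X (Suc n) s) - f (X n s))"
      by (subst integral_diff[OF fXi fXi]) (simp add: XS)
    also have "norm \<dots> \<le> integral {0..t} ?g"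
    proof (rule integral_norm_bound_integral)
      show "(\<lambda>s. f (X (Suc n) s) - f (X n s)) integrable_on {0..t}" by (rule integrable_diff[OF fXi fXi])
      show "?g integrable_on {0..t}" using gi by blast
      fix s assume s: "s \<in> {0..t}"
      have "norm (f (X (Suc n) s) - f (X n s)) \<le> L * norm (X (Suc n) s - X n s)" by (rule fL)
      also have "\<dots> \<le> ?g s" using L s by (intro mult_left_mono Suc.IH) auto
      finally show "norm (f (X (Suc n) s) - f (X n s)) \<le> ?g s" .
    qed
    also have "\<dots> = ?G t - ?G 0" using gi by (rule integral_unique)
    also have "\<dots> \<le> ?G t" by (simp add: A_def)
    finally show ?case .
  qed
  define x where "x = (\<lambda>t. x0 + suminf (\<lambda>i. X (Suc i) t - X i t))"
  have lim: "uniform_limit {0..T} X x sequentially" for T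
  proof -
    have "uniform_limit {0..T} (\<lambda>n t. \<Sum>i<n. X (Suc i) t - X i t) (\<lambda>t. suminf (\<lambda>i. X (Suc i) t - X i t)) sequentially"
    proof (rule Weierstrass_m_test[OF _ summable_mult[OF summable_geometric]])
      fix n t assume t: "t \<in> {0..T}"
      have "norm (X (Suc n) t - X n t) \<le> A * (1/2)^n * exp (2 * L * t)" using step t by simp
      also have "\<dots> \<le> A * (1/2)^n * exp (2 * L * T)"
        using t L by (intro mult_left_mono) (auto simp: A_def)
      finally show "norm (X (Suc n) t - X n t) \<le> A * exp (2 * L * T) * (1/2)^n" by (simp add: mult_ac)
    qed simp
    then have "uniform_limit {0..T} (\<lambda>n t. x0 + (\<Sum>i<n. X (Suc i) t - X i t)) x sequentially"
      unfolding x_def by (intro uniform_limit_add uniform_limit_const)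
    moreover have "(\<lambda>n t. x0 + (\<Sum>i<n. X (Suc i) t - X i t)) = X"
      using sum_lessThan_telescope[where f="\<lambda>i. X i _"] by (intro ext) (simp add: X0)
    ultimately show ?thesis by simp
  qed
  have xc: "continuous_on {0..T} x" for T
    by (rule uniform_limit_theorem[OF _ lim]) (auto simp: Xc)
  have xi: "x t = x0 + integral {0..t} (\<lambda>s. f (x s))" if "t \<ge> 0" for t
  proof (rule LIMSEQ_unique)
    show "(\<lambda>n. X (Suc n) t) \<longlonglongrightarrow> x t"
      using LIMSEQ_Suc[OF tendsto_uniform_limitI[OF lim[of t], of t]] that by simp
    show "(\<lambda>n. X (Suc n) t) \<longlonglongrightarrow> x0 + integral {0..t} (\<lambda>s. f (x s))"
      unfolding XS
      by (intro tendsto_intros integral_uniform_limit uniform_limit_lipschitz_comp[OF lim f]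
            continuous_on_compose2[OF fc[of UNIV] Xc]) auto
  qed
  show thesis
  proof (rule that)
    show "x 0 = x0" using xi[of 0] by simp
    fix t :: real assume t: "t \<ge> 0"
    have "((\<lambda>u. x0 + integral {0..u} (\<lambda>s. f (x s))) has_vector_derivative f (x t)) (at t within {0..t+1})"
      using t by (auto intro!: derivative_eq_intros integral_has_vector_derivative
            continuous_on_compose2[OF fc[of UNIV] xc])
    then have "(x has_vector_derivative f (x t)) (at t within {0..t+1})"
      by (rule has_vector_derivative_transform[rotated 2]) (use t xi in auto)
    then show "(x has_vector_derivative f (x t)) (at t within {0..})"
      using at_within_atLeast[of t "t+1"] t by simp
  qed
qed

text \<open>The function \<open>exp (- (K * t)) * \<phi> t - c * t\<close> does not increase.
  Derivatives are asked for only in the open interval, since the energies of weak solutions are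
  differentiable only there and merely continuous at the ends.\<close>

lemma gronwall_differential:
  fixes \<phi> :: "real \<Rightarrow> real"
  assumes T: "0 \<le> T" and K: "0 \<le> K" and c: "0 \<le> c"
    and cont: "continuous_on {0..T} \<phi>"
    and der: "\<And>t. 0 < t \<Longrightarrow> t < T \<Longrightarrow> \<exists>D. (\<phi> has_real_derivative D) (at t) \<and> D \<le> K * \<phi> t + c"
  shows "\<phi> T \<le> (\<phi> 0 + c * T) * exp (K * T)"
proof -
  define \<psi> where "\<psi> t = exp (- (K * t)) * \<phi> t - c * t" for t
  have "\<psi> T \<le> \<psi> 0"
  proof (rule DERIV_nonpos_imp_decreasing_open[OF T])
    show "continuous_on {0..T} \<psi>" unfolding \<psi>_def by (intro continuous_intros cont)
    fix t assume t: "0 < t" "t < T"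
    then obtain D where D: "(\<phi> has_real_derivative D) (at t)" "D \<le> K * \<phi> t + c" using der by blast
    have "(\<psi> has_real_derivative (exp (- (K * t)) * (D - K * \<phi> t) - c)) (at t)"
      unfolding \<psi>_def by (auto intro!: derivative_eq_intros D(1) simp: algebra_simps)
    moreover have "exp (- (K * t)) * (D - K * \<phi> t) \<le> exp (- (K * t)) * c"
      using D(2) by (intro mult_left_mono) auto
    moreover have "exp (- (K * t)) * c \<le> 1 * c"
      using K t c by (intro mult_right_mono) auto
    ultimately show "\<exists>y. (\<psi> has_real_derivative y) (at t) \<and> y \<le> 0"
      by (intro exI[of _ "exp (- (K * t)) * (D - K * \<phi> t) - c"] conjI) linarith+
  qed
  then have "exp (- (K * T)) * \<phi> T \<le> \<phi> 0 + c * T" by (simp add: \<psi>_def)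
  then have "exp (K * T) * (exp (- (K * T)) * \<phi> T) \<le> exp (K * T) * (\<phi> 0 + c * T)"
    by (rule mult_left_mono) simp
  moreover have "exp (K * T) * (exp (- (K * T)) * \<phi> T) = \<phi> T"
    by (simp add: exp_minus)
  ultimately show ?thesis by (metis mult.commute)
qed

text \<open>The right-hand side is the shape in which \<open>reg1\<close> and \<open>reg2\<close>
  express time derivatives, so this translates between the regularity classes and derivatives in the
  Hilbert space.\<close>

lemma has_vector_derivative_iff_tendsto_norm:
  fixes f :: "real \<Rightarrow> 'e::real_normed_vector"
  shows "(f has_vector_derivative D) (at t within S) \<longleftrightarrow>
    ((\<lambda>s. norm ((1 / (s - t)) *\<^sub>R (f s - f t) - D)) \<longlongrightarrow> 0) (at t within S)"
proof -
  have "norm (f y - f t - (y - t) *\<^sub>R D) / norm (y - t) = norm ((1 / (y - t)) *\<^sub>R (f y - f t) - D)"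
    if "y \<noteq> t" for y
  proof -
    have "(1 / (y - t)) *\<^sub>R (f y - f t) - D = (1 / (y - t)) *\<^sub>R (f y - f t - (y - t) *\<^sub>R D)"
      using that by (simp add: scaleR_right_diff_distrib)
    then show ?thesis by (simp add: divide_inverse mult.commute)
  qed
  then have "((\<lambda>y. norm (f y - f t - (y - t) *\<^sub>R D) / norm (y - t)) \<longlongrightarrow> 0) (at t within S) \<longleftrightarrow>
    ((\<lambda>s. norm ((1 / (s - t)) *\<^sub>R (f s - f t) - D)) \<longlongrightarrow> 0) (at t within S)"
    by (intro filterlim_cong refl) (auto simp: eventually_at_filter)
  then show ?thesis
    by (simp add: has_vector_derivative_def has_derivative_iff_norm bounded_linear_scaleR_left)
qed

lemma has_real_derivative_inner_self:
  fixes d :: "real \<Rightarrow> 'e::real_inner"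
  assumes "(d has_vector_derivative d') (at t within S)"
  shows "((\<lambda>t. d t \<bullet> d t) has_real_derivative 2 * (d t \<bullet> d')) (at t within S)"
  using bounded_bilinear.has_vector_derivative[OF bounded_bilinear_inner assms assms]
  by (simp add: has_real_derivative_iff_has_vector_derivative inner_commute)

lemma interior_derivative:
  "(y has_vector_derivative D) (at t within {0..}) \<Longrightarrow> 0 < t \<Longrightarrow> (y has_vector_derivative D) (at t)" for t :: real
  using at_within_interior[of t "{0..}"] by simp

section \<open>Resolvent of a bounded skew-adjoint operator\<close>

locale skew_evolution =
  fixes B G :: "'e::{real_inner,banach} \<Rightarrow> 'e" and L :: real
  assumes B: "bounded_linear B" and skew: "\<And>x y. B x \<bullet> y = - (x \<bullet> B y)"
    and G: "L-lipschitz_on UNIV G"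
begin

sublocale B: bounded_linear B by (rule B)

lemma L_nonneg: "0 \<le> L" using G by (rule lipschitz_on_nonneg)

lemma G_lip: "norm (G x - G y) \<le> L * norm (x - y)"
  using lipschitz_onD[OF G] by (simp add: dist_norm)

lemma B_self: "B x \<bullet> x = 0" "x \<bullet> B x = 0"
  using skew[of x x] by (simp_all add: inner_commute)

text \<open>The damped iteration \<open>x + \<tau> (B x - e x - z)\<close> is a contraction: by
  skewness \<open>B u\<close> is orthogonal to \<open>u\<close>, so the squared norm of the linear
  part splits without a mixed term.\<close>

lemma resolvent_ex1:
  assumes e: "0 < (e::real)"
  shows "\<exists>!x. B x - e *\<^sub>R x = z"
proof -
  obtain K where K: "\<And>x. norm (B x) \<le> norm x * K" "K \<ge> 0" using B.nonneg_bounded by blast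
  \<comment> \<open>This \<open>\<tau>\<close> minimises
    \<open>(1 - \<tau> * e)\<^sup>2 + \<tau>\<^sup>2 * K\<^sup>2\<close>, and the minimum is the
    \<open>c\<close> below.\<close>
  define \<tau> where "\<tau> = e / (e\<^sup>2 + K\<^sup>2)"
  have p: "e\<^sup>2 + K\<^sup>2 > 0" using e by (simp add: add_pos_nonneg)
  have \<tau>: "\<tau> > 0" using e p by (simp add: \<tau>_def)
  define c where "c = 1 - e\<^sup>2 / (e\<^sup>2 + K\<^sup>2)"
  have c: "0 \<le> c" "c < 1" using e p by (auto simp: c_def)
  have est: "(norm (u + \<tau> *\<^sub>R (B u - e *\<^sub>R u)))\<^sup>2 \<le> c * (norm u)\<^sup>2" for u
  proof -
    have "(norm (B u))\<^sup>2 \<le> (norm u * K)\<^sup>2" by (intro power_mono K(1)) simp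
    then have "\<tau>\<^sup>2 * (norm (B u))\<^sup>2 \<le> \<tau>\<^sup>2 * (norm u * K)\<^sup>2" by (rule mult_left_mono) simp
    moreover have "(norm (u + \<tau> *\<^sub>R (B u - e *\<^sub>R u)))\<^sup>2 = (1 - \<tau> * e)\<^sup>2 * (norm u)\<^sup>2 + \<tau>\<^sup>2 * (norm (B u))\<^sup>2"
      unfolding power2_norm_eq_inner
      by (simp add: inner_simps B_self algebra_simps power2_eq_square)
    moreover have "(1 - \<tau> * e)\<^sup>2 * (norm u)\<^sup>2 + \<tau>\<^sup>2 * (norm u * K)\<^sup>2 = c * (norm u)\<^sup>2"
    proof -
      have "\<tau>\<^sup>2 * (e\<^sup>2 + K\<^sup>2) = \<tau> * e" using p by (simp add: \<tau>_def power2_eq_square)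
      moreover have "c = 1 - \<tau> * e" by (simp add: c_def \<tau>_def power2_eq_square)
      ultimately have "(1 - \<tau> * e)\<^sup>2 + \<tau>\<^sup>2 * K\<^sup>2 = c" by (simp add: algebra_simps power2_eq_square)
      then show ?thesis by (simp add: power_mult_distrib) (metis distrib_right mult.assoc mult.commute)
    qed
    ultimately show ?thesis by linarith
  qed
  have "\<exists>!x. x + \<tau> *\<^sub>R (B x - e *\<^sub>R x - z) = x"
  proof (rule banach_fix_type[of "sqrt c"])
    show "0 \<le> sqrt c" "sqrt c < 1" using c by auto
    show "\<forall>x y. dist (x + \<tau> *\<^sub>R (B x - e *\<^sub>R x - z)) (y + \<tau> *\<^sub>R (B y - e *\<^sub>R y - z)) \<le> sqrt c * dist x y"
    proof (intro allI)
      fix x y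
      have "dist (x + \<tau> *\<^sub>R (B x - e *\<^sub>R x - z)) (y + \<tau> *\<^sub>R (B y - e *\<^sub>R y - z))
          = norm ((x - y) + \<tau> *\<^sub>R (B (x - y) - e *\<^sub>R (x - y)))"
        by (simp add: dist_norm B.diff algebra_simps)
      also have "\<dots> \<le> sqrt (c * (norm (x - y))\<^sup>2)" by (rule real_le_rsqrt[OF est])
      finally show "dist (x + \<tau> *\<^sub>R (B x - e *\<^sub>R x - z)) (y + \<tau> *\<^sub>R (B y - e *\<^sub>R y - z)) \<le> sqrt c * dist x y"
        by (simp add: real_sqrt_mult dist_norm)
    qed
  qed
  then show ?thesis using \<tau> by simp
qed

definition R :: "real \<Rightarrow> 'e \<Rightarrow> 'e" where
  "R e z = (THE x. B x - e *\<^sub>R x = z)"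

lemma R_eq: "0 < e \<Longrightarrow> B (R e z) - e *\<^sub>R R e z = z"
  unfolding R_def by (rule theI'[OF resolvent_ex1])

lemma R_unique: "0 < e \<Longrightarrow> B x - e *\<^sub>R x = z \<Longrightarrow> R e z = x"
  using resolvent_ex1[of e z] R_eq[of e z] by blast

lemma R_add: "0 < e \<Longrightarrow> R e (x + y) = R e x + R e y"
  using R_eq[of e x] R_eq[of e y] by (intro R_unique) (auto simp: B.add algebra_simps)

lemma R_scaleR: "0 < e \<Longrightarrow> R e (r *\<^sub>R x) = r *\<^sub>R R e x"
  using R_eq[of e x]
  by (intro R_unique) (auto simp: B.scaleR algebra_simps simp flip: scaleR_diff_right)

text \<open>Pairing \<open>B x - e *\<^sub>R x = z\<close> with \<open>x\<close> removes
  \<open>B\<close>. The same computation yields the bound \<open>R_norm\<close>.\<close>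

lemma R_dissipative: "0 < e \<Longrightarrow> R e z \<bullet> z \<le> 0"
proof -
  assume e: "0 < e"
  have "R e z \<bullet> z = R e z \<bullet> (B (R e z) - e *\<^sub>R R e z)" using R_eq[OF e] by simp
  also have "\<dots> = - e * (R e z \<bullet> R e z)" by (simp add: inner_diff_right B_self)
  finally show ?thesis using e by simp
qed

lemma R_norm: "0 < e \<Longrightarrow> e * norm (R e z) \<le> norm z"
proof -
  assume e: "0 < e"
  have "R e z \<bullet> z = R e z \<bullet> (B (R e z) - e *\<^sub>R R e z)" using R_eq[OF e] by simp
  also have "\<dots> = - e * (R e z \<bullet> R e z)" by (simp add: inner_diff_right B_self)
  finally have "e * (norm (R e z))\<^sup>2 = - (R e z \<bullet> z)" by (simp add: power2_norm_eq_inner)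
  also have "\<dots> \<le> norm (R e z) * norm z" using Cauchy_Schwarz_ineq2[of "R e z" z] by linarith
  finally have "norm (R e z) * (e * norm (R e z)) \<le> norm (R e z) * norm z"
    by (simp add: power2_eq_square mult_ac)
  then show ?thesis by (cases "R e z = 0") auto
qed

lemma R_bounded_linear: "0 < e \<Longrightarrow> bounded_linear (R e)"
  by (rule bounded_linear_intro[where K="1/e"])
     (use R_norm in \<open>auto simp: R_add R_scaleR field_simps\<close>)

lemma B_R: "0 < e \<Longrightarrow> B (R e z) = z + e *\<^sub>R R e z"
  using R_eq[of e z] by (simp add: algebra_simps)

lemma R_B: "0 < e \<Longrightarrow> R e (B z) = z + e *\<^sub>R R e z"
  using R_eq[of e z] by (intro R_unique) (auto simp: B.add B.scaleR algebra_simps simp flip: scaleR_add_right)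

text \<open>Uniform in \<open>e\<close>, whereas \<open>R e\<close> alone is controlled only by
  \<open>1 / e\<close>. Every estimate that survives the limit \<open>e\<close> to 0 goes through
  this composition.\<close>

lemma R_B_norm: "0 < e \<Longrightarrow> norm (R e (B z)) \<le> 2 * norm z"
  using norm_triangle_ineq[of z "e *\<^sub>R R e z"] R_norm[of e z] by (simp add: R_B)

abbreviation eps :: "nat \<Rightarrow> real" where "eps n \<equiv> inverse (real (Suc n))"

text \<open>On a vector \<open>B z\<close> the expression is of order \<open>eps n\<close> by
  \<open>R_B_norm\<close>, and the operators \<open>e *\<^sub>R R e\<close> have norm at most 1, so
  convergence extends to the closure of the range. Together with \<open>R_B\<close> it says that
  \<open>R (eps n) (B x)\<close> tends to \<open>x\<close>.\<close>

lemma eps_R_tendsto: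
  assumes x: "x \<in> closure (range B)"
  shows "(\<lambda>n. eps n *\<^sub>R R (eps n) x) \<longlonglongrightarrow> 0"
proof (rule LIMSEQ_I)
  fix r :: real assume r: "r > 0"
  then have "\<exists>y\<in>range B. dist y x < r / 2"
    using x unfolding closure_approachable by (metis half_gt_zero)
  then obtain z where z: "dist (B z) x < r / 2" by blast
  have "2 * norm z + 1 > 0" by (simp add: add_nonneg_pos)
  then obtain N where N: "eps N < (r / 2) / (2 * norm z + 1)"
    using reals_Archimedean[of "(r / 2) / (2 * norm z + 1)"] r by auto
  show "\<exists>no. \<forall>n\<ge>no. norm (eps n *\<^sub>R R (eps n) x - 0) < r"
  proof (intro exI allI impI)
    fix n assume n: "n \<ge> N"
    have e: "eps n > 0" by simp
    have "eps n \<le> eps N" using n by (intro le_imp_inverse_le) auto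
    have x: "R (eps n) x = R (eps n) (B z) + R (eps n) (x - B z)"
      using R_add[OF e, of "B z" "x - B z"] by (simp del: of_nat_Suc)
    have "norm (eps n *\<^sub>R R (eps n) x) \<le> eps n * norm (R (eps n) (B z)) + eps n * norm (R (eps n) (x - B z))"
      unfolding x using norm_triangle_ineq[of "eps n *\<^sub>R R (eps n) (B z)" "eps n *\<^sub>R R (eps n) (x - B z)"]
      by (simp add: scaleR_add_right)
    also have "eps n * norm (R (eps n) (B z)) \<le> eps N * (2 * norm z + 1)"
      using R_B_norm[OF e, of z] \<open>eps n \<le> eps N\<close> by (intro mult_mono) (auto simp del: of_nat_Suc)
    also have "\<dots> < r / 2" using N \<open>2 * norm z + 1 > 0\<close> by (simp add: pos_less_divide_eq algebra_simps del: of_nat_Suc)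
    also have "eps n * norm (R (eps n) (x - B z)) \<le> norm (x - B z)" by (rule R_norm[OF e])
    also have "\<dots> < r / 2" using z by (simp add: dist_norm norm_minus_commute)
    finally show "norm (eps n *\<^sub>R R (eps n) x - 0) < r" by simp
  qed
qed

section \<open>Yosida approximations\<close>

definition yosida :: "real \<Rightarrow> (real \<Rightarrow> 'e) \<Rightarrow> bool" where
  "yosida e y \<longleftrightarrow> (\<forall>t\<ge>0. (y has_vector_derivative R e (y t) + G (y t)) (at t within {0..}))"

lemma yosida_ex: "0 < e \<Longrightarrow> \<exists>y. y 0 = x0 \<and> yosida e y"
proof -
  assume e: "0 < e"
  have "(1/e + L)-lipschitz_on UNIV (\<lambda>x. R e x + G x)"
  proof (rule lipschitz_onI)
    fix x y
    interpret R: bounded_linear "R e" by (rule R_bounded_linear[OF e])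
    have "norm (R e x + G x - (R e y + G y)) \<le> norm (R e (x - y)) + norm (G x - G y)"
      using norm_triangle_ineq[of "R e (x - y)" "G x - G y"] by (simp add: R.diff algebra_simps)
    also have "norm (R e (x - y)) \<le> 1 / e * norm (x - y)" using R_norm[OF e, of "x - y"] e by (simp add: field_simps)
    also have "norm (G x - G y) \<le> L * norm (x - y)" by (rule G_lip)
    finally show "dist (R e x + G x) (R e y + G y) \<le> (1/e + L) * dist x y"
      by (simp add: dist_norm algebra_simps)
  qed (use e L_nonneg in simp)
  from global_lipschitz_ode[OF this, of x0] show ?thesis unfolding yosida_def by metis
qed

lemma yosida_continuous: "yosida e y \<Longrightarrow> continuous_on {0..} y"
  unfolding yosida_def continuous_on_eq_continuous_within
  by (meson atLeast_iff has_vector_derivative_continuous)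

text \<open>Dissipativity of \<open>R e\<close> discards the only term that depends on
  \<open>e\<close>, so the growth rate is the Lipschitz constant of \<open>G\<close> alone.\<close>

lemma yosida_stability:
  assumes e: "0 < e" and y: "yosida e y" and z: "yosida e z" and t: "0 \<le> t"
  shows "norm (y t - z t) \<le> norm (y 0 - z 0) * exp (L * t)"
proof -
  let ?d = "\<lambda>t. y t - z t"
  interpret R: bounded_linear "R e" by (rule R_bounded_linear[OF e])
  have "?d t \<bullet> ?d t \<le> (?d 0 \<bullet> ?d 0 + 0 * t) * exp (2 * L * t)"
  proof (rule gronwall_differential[OF t])
    show "continuous_on {0..t} (\<lambda>t. ?d t \<bullet> ?d t)"
      by (intro continuous_intros continuous_on_subset[OF yosida_continuous[OF y]]
          continuous_on_subset[OF yosida_continuous[OF z]]) auto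
    fix s :: real assume s: "0 < s" "s < t"
    let ?D = "R e (?d s) + (G (y s) - G (z s))"
    have "(y has_vector_derivative R e (y s) + G (y s)) (at s)"
         "(z has_vector_derivative R e (z s) + G (z s)) (at s)"
      using y z s by (auto simp: yosida_def intro!: interior_derivative)
    then have "(?d has_vector_derivative ?D) (at s)"
      by (auto intro!: derivative_eq_intros simp: R.diff algebra_simps)
    then have "((\<lambda>t. ?d t \<bullet> ?d t) has_real_derivative 2 * (?d s \<bullet> ?D)) (at s)"
      by (rule has_real_derivative_inner_self)
    moreover have "?d s \<bullet> ?D \<le> L * (?d s \<bullet> ?d s)"
    proof -
      have "?d s \<bullet> ?D = R e (?d s) \<bullet> ?d s + ?d s \<bullet> (G (y s) - G (z s))"
        by (simp add: inner_add_right inner_commute)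
      also have "\<dots> \<le> 0 + norm (?d s) * (L * norm (?d s))"
        using G_lip[of "y s" "z s"]
        by (intro add_mono R_dissipative[OF e] order_trans[OF norm_cauchy_schwarz] mult_left_mono) auto
      finally show ?thesis by (simp add: power2_norm_eq_inner[symmetric] power2_eq_square mult_ac)
    qed
    ultimately show "\<exists>D. ((\<lambda>t. ?d t \<bullet> ?d t) has_real_derivative D) (at s) \<and> D \<le> 2 * L * (?d s \<bullet> ?d s) + 0"
      by (intro exI[of _ "2 * (?d s \<bullet> ?D)"]) auto
  qed (use L_nonneg in auto)
  then have "(norm (?d t))\<^sup>2 \<le> (norm (?d 0) * exp (L * t))\<^sup>2"
    by (simp add: power2_norm_eq_inner power_mult_distrib exp_double[symmetric] mult_ac)
  then show ?thesis by (rule power2_le_imp_le) simp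
qed

text \<open>The equation is autonomous, so a time shift of a solution is a solution. Stability for
  \<open>y\<close> and its shift by \<open>h\<close>, divided by \<open>h\<close>, passes to the
  derivative; \<open>G\<close> need not be differentiated.\<close>

lemma yosida_derivative_bound:
  assumes e: "0 < e" and y: "yosida e y" and t: "0 \<le> t"
  shows "norm (R e (y t) + G (y t)) \<le> norm (R e (y 0) + G (y 0)) * exp (L * t)"
proof -
  have shift: "yosida e (\<lambda>s. y (s + h))" if h: "h \<ge> 0" for h
    unfolding yosida_def
  proof (intro allI impI)
    fix s :: real assume s: "0 \<le> s"
    have "(y has_vector_derivative R e (y (s + h)) + G (y (s + h))) (at (s + h) within {0..})"
      using y h s unfolding yosida_def by simp
    then have "(y has_vector_derivative R e (y (s + h)) + G (y (s + h))) (at (s + h) within (\<lambda>s. s + h) ` {0..})"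
      by (rule has_vector_derivative_within_subset) (use h in auto)
    moreover have "((\<lambda>s. s + h) has_vector_derivative 1) (at s within {0..})"
      by (auto intro!: derivative_eq_intros)
    ultimately have "(y \<circ> (\<lambda>s. s + h) has_vector_derivative 1 *\<^sub>R (R e (y (s + h)) + G (y (s + h)))) (at s within {0..})"
      by (intro vector_diff_chain_within) auto
    then show "((\<lambda>s. y (s + h)) has_vector_derivative R e (y (s + h)) + G (y (s + h))) (at s within {0..})"
      by (simp add: o_def)
  qed
  have lim: "(\<lambda>n. norm ((1 / eps n) *\<^sub>R (y (s + eps n) - y s))) \<longlonglongrightarrow> norm (R e (y s) + G (y s))" if s: "s \<ge> 0" for s
  proof -
    have "((\<lambda>r. norm ((1 / (r - s)) *\<^sub>R (y r - y s) - (R e (y s) + G (y s)))) \<longlongrightarrow> 0) (at s within {0..})"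
      using y s unfolding yosida_def has_vector_derivative_iff_tendsto_norm by blast
    moreover have "filterlim (\<lambda>n. s + eps n) (at s within {0..}) sequentially"
      unfolding filterlim_at
    proof (intro conjI)
      show "\<forall>\<^sub>F n in sequentially. s + eps n \<in> {0..} \<and> s + eps n \<noteq> s" using s by (intro always_eventually) (auto simp: field_simps)
      show "filterlim (\<lambda>n. s + eps n) (nhds s) sequentially"
        using tendsto_add[OF tendsto_const LIMSEQ_inverse_real_of_nat, of s] by simp
    qed
    ultimately have "(\<lambda>n. norm ((1 / (s + eps n - s)) *\<^sub>R (y (s + eps n) - y s) - (R e (y s) + G (y s)))) \<longlonglongrightarrow> 0"
      by (rule filterlim_compose)
    then have "(\<lambda>n. (1 / eps n) *\<^sub>R (y (s + eps n) - y s)) \<longlonglongrightarrow> R e (y s) + G (y s)"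
      by (simp add: LIM_zero_iff tendsto_norm_zero_iff)
    then show ?thesis by (rule tendsto_norm)
  qed
  show ?thesis
  proof (rule LIMSEQ_le[OF lim[OF t]])
    show "(\<lambda>n. norm ((1 / eps n) *\<^sub>R (y (0 + eps n) - y 0)) * exp (L * t)) \<longlonglongrightarrow> norm (R e (y 0) + G (y 0)) * exp (L * t)"
      by (intro tendsto_mult lim tendsto_const) simp
    show "\<exists>N. \<forall>n\<ge>N. norm ((1 / eps n) *\<^sub>R (y (t + eps n) - y t)) \<le> norm ((1 / eps n) *\<^sub>R (y (0 + eps n) - y 0)) * exp (L * t)"
    proof (intro exI allI impI)
      fix n
      have "norm (y (t + eps n) - y t) \<le> norm (y (0 + eps n) - y 0) * exp (L * t)"
        by (rule yosida_stability[OF e shift y t]) simp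
      then show "norm ((1 / eps n) *\<^sub>R (y (t + eps n) - y t)) \<le> norm ((1 / eps n) *\<^sub>R (y (0 + eps n) - y 0)) * exp (L * t)"
        using mult_left_mono[of "norm (y (t + eps n) - y t)" _ "1 / eps n"] by (simp add: mult.assoc del: of_nat_Suc)
    qed
  qed
qed

text \<open>Write \<open>y = (B - e) a\<close> and \<open>w = (B - f) b\<close>. By skewness only \<open>f b - e a\<close> contributes to
  \<open>(y - w) \<bullet> (a - b)\<close>, and the bound on the time derivatives makes \<open>a\<close> and \<open>b\<close> bounded.\<close>

lemma yosida_cauchy_estimate:
  fixes z0 :: 'e and T :: real
  obtains C where "\<And>e f y w t. 0 < e \<Longrightarrow> 0 < f \<Longrightarrow> yosida e y \<Longrightarrow> yosida f w \<Longrightarrow> y 0 = B z0 \<Longrightarrow> w 0 = B z0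
     \<Longrightarrow> 0 \<le> t \<Longrightarrow> t \<le> T \<Longrightarrow> (norm (y t - w t))\<^sup>2 \<le> (e + f) * C" "0 \<le> C"
proof (cases "0 \<le> T")
  case False
  then show ?thesis by (intro that[of 0]) auto
next
  case T: True
  \<comment> \<open>\<open>C1\<close> bounds the time derivative: it starts at
    \<open>R e (B z0) + G (B z0)\<close>, whose first term is at most \<open>2 * norm z0\<close>
    because the data lie in the range of \<open>B\<close>. \<open>C2\<close> bounds
    \<open>R e (y t)\<close> alone, after \<open>G (y t)\<close> has been subtracted and controlled
    by the distance travelled, at most \<open>C1 * T\<close>.\<close>
  define C1 where "C1 = (2 * norm z0 + norm (G (B z0))) * exp (L * T)"
  define C2 where "C2 = C1 + (norm (G (B z0)) + L * (C1 * T))"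
  have C1: "C1 \<ge> 0" by (simp add: C1_def)
  have C2: "C2 \<ge> 0" using C1 L_nonneg T by (simp add: C2_def)
  have bd: "norm (R e (y t)) \<le> C2" if e: "0 < e" and y: "yosida e y" "y 0 = B z0" and t: "0 \<le> t" "t \<le> T" for e y t
  proof -
    have d: "norm (R e (y s) + G (y s)) \<le> C1" if s: "0 \<le> s" "s \<le> T" for s
    proof -
      have "norm (R e (y s) + G (y s)) \<le> norm (R e (y 0) + G (y 0)) * exp (L * s)"
        by (rule yosida_derivative_bound[OF e y(1) s(1)])
      also have "\<dots> \<le> C1" unfolding C1_def y(2)
        using norm_triangle_ineq[of "R e (B z0)" "G (B z0)"] R_B_norm[OF e, of z0] s L_nonneg
        by (intro mult_mono) (auto intro!: mult_left_mono)
      finally show ?thesis .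
    qed
    have "((\<lambda>s. R e (y s) + G (y s)) has_integral y t - y 0) {0..t}"
      using y(1) t unfolding yosida_def
      by (intro fundamental_theorem_of_calculus) (auto intro: has_vector_derivative_within_subset)
    then have "norm (y t - y 0) \<le> C1 * t"
      using has_integral_bound_real[OF C1 finite.emptyI, of "\<lambda>s. R e (y s) + G (y s)" "y t - y 0" 0 t] d t by auto
    also have "\<dots> \<le> C1 * T" using t C1 by (intro mult_left_mono)
    finally have "L * norm (y t - y 0) \<le> L * (C1 * T)" using L_nonneg by (intro mult_left_mono)
    then have "norm (G (y t)) \<le> norm (G (B z0)) + L * (C1 * T)"
      using G_lip[of "y t" "y 0"] norm_triangle_ineq2[of "G (y t)" "G (y 0)"] y(2) by simp
    then show ?thesis using d[OF t] norm_triangle_ineq4[of "R e (y t) + G (y t)" "G (y t)"]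
      unfolding C2_def by simp
  qed
  show thesis
  proof (rule that)
    show "0 \<le> 4 * C2\<^sup>2 * T * exp (2 * L * T)" using T by simp
    fix e f :: real and y w :: "real \<Rightarrow> 'e" and t :: real
    assume e: "0 < e" and f: "0 < f" and y: "yosida e y" "y 0 = B z0" and w: "yosida f w" "w 0 = B z0"
      and t: "0 \<le> t" "t \<le> T"
    let ?d = "\<lambda>t. y t - w t"
    let ?c = "4 * (e + f) * C2\<^sup>2"
    have "?d t \<bullet> ?d t \<le> (?d 0 \<bullet> ?d 0 + ?c * t) * exp (2 * L * t)"
    proof (rule gronwall_differential[OF t(1)])
      show "continuous_on {0..t} (\<lambda>t. ?d t \<bullet> ?d t)"
        by (intro continuous_intros continuous_on_subset[OF yosida_continuous[OF y(1)]]
            continuous_on_subset[OF yosida_continuous[OF w(1)]]) auto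
      fix s :: real assume s: "0 < s" "s < t"
      define a where "a = R e (y s)"
      define b where "b = R f (w s)"
      have ys: "y s = B a - e *\<^sub>R a" and ws: "w s = B b - f *\<^sub>R b"
        unfolding a_def b_def using R_eq[OF e] R_eq[OF f] by simp_all
      have na: "norm a \<le> C2" "norm b \<le> C2"
        unfolding a_def b_def using s t by (auto intro!: bd e f y w)
      let ?D = "(a - b) + (G (y s) - G (w s))"
      have "(y has_vector_derivative a + G (y s)) (at s)"
           "(w has_vector_derivative b + G (w s)) (at s)"
        using y w s by (auto simp: yosida_def a_def b_def intro!: interior_derivative)
      then have "(?d has_vector_derivative ?D) (at s)"
        by (auto intro!: derivative_eq_intros simp: algebra_simps)
      then have "((\<lambda>t. ?d t \<bullet> ?d t) has_real_derivative 2 * (?d s \<bullet> ?D)) (at s)"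
        by (rule has_real_derivative_inner_self)
      moreover have "?d s \<bullet> ?D \<le> L * (?d s \<bullet> ?d s) + 2 * (e + f) * C2\<^sup>2"
      proof -
        have "?d s \<bullet> (a - b) = B (a - b) \<bullet> (a - b) + (f *\<^sub>R b - e *\<^sub>R a) \<bullet> (a - b)"
          unfolding ys ws by (simp add: B.diff inner_diff_left inner_diff_right algebra_simps)
        also have "\<dots> = (f *\<^sub>R b - e *\<^sub>R a) \<bullet> (a - b)" by (simp add: B_self)
        also have "\<dots> \<le> norm (f *\<^sub>R b - e *\<^sub>R a) * norm (a - b)" by (rule norm_cauchy_schwarz)
        also have "\<dots> \<le> (f * C2 + e * C2) * (C2 + C2)"
        proof (rule mult_mono)
          show "norm (f *\<^sub>R b - e *\<^sub>R a) \<le> f * C2 + e * C2"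
            using e f na by (intro order_trans[OF norm_triangle_ineq4] add_mono) auto
          show "norm (a - b) \<le> C2 + C2"
            using na by (intro order_trans[OF norm_triangle_ineq4] add_mono) auto
        qed (use e f C2 in auto)
        finally have 1: "?d s \<bullet> (a - b) \<le> 2 * (e + f) * C2\<^sup>2" by (simp add: power2_eq_square algebra_simps)
        have "?d s \<bullet> (G (y s) - G (w s)) \<le> norm (?d s) * (L * norm (?d s))"
          using G_lip[of "y s" "w s"] by (intro order_trans[OF norm_cauchy_schwarz] mult_left_mono) auto
        also have "\<dots> = L * (?d s \<bullet> ?d s)" by (simp add: power2_norm_eq_inner[symmetric] power2_eq_square mult_ac)
        finally show ?thesis using 1 by (simp add: inner_add_right)
      qed
      ultimately show "\<exists>D. ((\<lambda>t. ?d t \<bullet> ?d t) has_real_derivative D) (at s) \<and> D \<le> 2 * L * (?d s \<bullet> ?d s) + ?c"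
        by (intro exI[of _ "2 * (?d s \<bullet> ?D)"]) (auto simp: algebra_simps)
    qed (use L_nonneg e f in auto)
    also have "\<dots> = (e + f) * (4 * C2\<^sup>2 * t * exp (2 * L * t))" using y w by simp
    also have "\<dots> \<le> (e + f) * (4 * C2\<^sup>2 * T * exp (2 * L * T))"
      using e f t L_nonneg by (intro mult_left_mono mult_mono) (auto intro!: mult_left_mono)
    finally show "(norm (y t - w t))\<^sup>2 \<le> (e + f) * (4 * C2\<^sup>2 * T * exp (2 * L * T))"
      by (simp add: power2_norm_eq_inner)
  qed
qed

section \<open>Existence\<close>

text \<open>The Cauchy estimate needs initial data in the range of \<open>B\<close>. For data in its
  closure a nearby \<open>B z\<close> is inserted, and \<open>yosida_stability\<close> controls the
  exchange with a constant that does not depend on the approximation.\<close>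

lemma exists_solution:
  assumes x0: "x0 \<in> closure (range B)"
  obtains x where "x 0 = x0" "continuous_on {0..} x"
    "\<And>t. t \<ge> 0 \<Longrightarrow> ((\<lambda>t. B (x t)) has_vector_derivative x t + B (G (x t))) (at t within {0..})"
proof -
  have "\<forall>n u. \<exists>y. y 0 = u \<and> yosida (eps n) y" using yosida_ex by simp
  then obtain Y where Y: "\<And>n u. Y n u 0 = u" "\<And>n u. yosida (eps n) (Y n u)" by metis
  define x where "x t = lim (\<lambda>n. Y n x0 t)" for t
  have lim: "uniform_limit {0..T} (\<lambda>n. Y n x0) x sequentially" for T
  proof -
    have "uniformly_Cauchy_on {0..T} (\<lambda>n. Y n x0)"
    proof (rule uniformly_Cauchy_onI)
      fix r :: real assume r: "r > 0"
      define r' where "r' = r / 3 / exp (L * \<bar>T\<bar>)"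
      have r': "r' > 0" using r by (simp add: r'_def)
      then have "\<exists>y\<in>range B. dist y x0 < r'"
        using x0 unfolding closure_approachable by blast
      then obtain z where z: "dist (B z) x0 < r'" by blast
      obtain C where C: "\<And>e f y w t. 0 < e \<Longrightarrow> 0 < f \<Longrightarrow> yosida e y \<Longrightarrow> yosida f w \<Longrightarrow> y 0 = B z \<Longrightarrow> w 0 = B z
         \<Longrightarrow> 0 \<le> t \<Longrightarrow> t \<le> T \<Longrightarrow> (norm (y t - w t))\<^sup>2 \<le> (e + f) * C" "0 \<le> C"
        using yosida_cauchy_estimate[of z T] by blast
      have "(r/3)\<^sup>2 / (2 * (C + 1)) > 0" using r C(2) by simp
      then obtain N where N: "eps N < (r/3)\<^sup>2 / (2 * (C + 1))" using reals_Archimedean by blast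
      have close: "norm (Y n x0 t - Y n (B z) t) < r / 3" if t: "t \<in> {0..T}" for n t
      proof -
        have "norm (Y n x0 t - Y n (B z) t) \<le> norm (x0 - B z) * exp (L * t)"
          using yosida_stability[OF _ Y(2) Y(2), of n t x0 "B z"] t Y(1) by simp
        also have "\<dots> \<le> norm (x0 - B z) * exp (L * \<bar>T\<bar>)"
          using t L_nonneg by (intro mult_left_mono) (auto intro!: mult_left_mono)
        also have "\<dots> < r' * exp (L * \<bar>T\<bar>)"
          using z by (simp add: dist_norm norm_minus_commute)
        finally show ?thesis by (simp add: r'_def)
      qed
      show "\<exists>M. \<forall>t\<in>{0..T}. \<forall>m\<ge>M. \<forall>n\<ge>M. dist (Y m x0 t) (Y n x0 t) < r"
      proof (intro exI ballI allI impI)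
        fix t m n assume t: "t \<in> {0..T}" and mn: "m \<ge> N" "n \<ge> N"
        have "eps m \<le> eps N" "eps n \<le> eps N" using mn by (auto intro!: le_imp_inverse_le)
        then have "eps m + eps n \<le> 2 * eps N" by linarith
        have "(norm (Y m (B z) t - Y n (B z) t))\<^sup>2 \<le> (eps m + eps n) * C"
          by (rule C(1)) (use t Y in auto)
        also have "\<dots> \<le> 2 * eps N * (C + 1)"
          using \<open>eps m + eps n \<le> 2 * eps N\<close> C(2) by (intro mult_mono) (auto simp del: of_nat_Suc)
        also have "\<dots> = eps N * (2 * (C + 1))" by (simp del: of_nat_Suc)
        also have "\<dots> < (r/3)\<^sup>2" using C(2) by (intro pos_less_divide_eq[THEN iffD1, OF _ N]) simp
        finally have "norm (Y m (B z) t - Y n (B z) t) < r / 3"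
          by (rule power2_less_imp_less) (use r in simp)
        moreover have "norm ((Y m x0 t - Y m (B z) t) + (Y m (B z) t - Y n (B z) t) - (Y n x0 t - Y n (B z) t))
            \<le> norm (Y m x0 t - Y m (B z) t) + norm (Y m (B z) t - Y n (B z) t) + norm (Y n x0 t - Y n (B z) t)"
          by (rule order_trans[OF norm_triangle_ineq4 add_right_mono[OF norm_triangle_ineq]])
        ultimately show "dist (Y m x0 t) (Y n x0 t) < r"
          using close[OF t, of m] close[OF t, of n] by (simp add: dist_norm)
      qed
    qed
    then have "uniformly_convergent_on {0..T} (\<lambda>n. Y n x0)" by (rule Cauchy_uniformly_convergent)
    then show ?thesis unfolding uniformly_convergent_uniform_limit_iff x_def .
  qed
  have Yc: "continuous_on {0..T} (Y n x0)" for n T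
    using continuous_on_subset[OF yosida_continuous[OF Y(2)]] by auto
  have Gc: "continuous_on UNIV G" using lipschitz_on_continuous_on[OF G] .
  have xcT: "continuous_on {0..T} x" for T
    by (rule uniform_limit_theorem[OF _ lim]) (auto simp: Yc)
  have xc: "continuous_on {0..} x"
    unfolding continuous_on_eq_continuous_within
  proof
    fix t :: real assume "t \<in> {0..}"
    then have "continuous (at t within {0..t+1}) x"
      using xcT[of "t+1"] unfolding continuous_on_eq_continuous_within by auto
    then show "continuous (at t within {0..}) x"
      using at_within_atLeast[of t "t+1"] \<open>t \<in> {0..}\<close> by (simp add: continuous_within)
  qed
  have pt: "(\<lambda>n. Y n x0 t) \<longlonglongrightarrow> x t" if "t \<ge> 0" for t
    using tendsto_uniform_limitI[OF lim[of t], of t] that by simp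
  have eps0: "eps \<longlonglongrightarrow> 0" by (rule LIMSEQ_inverse_real_of_nat)
  have x_0: "x 0 = x0" using pt[of 0] by (simp add: Y(1) LIMSEQ_const_iff)
  have BG: "\<exists>K. K-lipschitz_on UNIV (\<lambda>u. B (G u))"
  proof -
    obtain K where K: "\<And>x. norm (B x) \<le> norm x * K" "K \<ge> 0" using B.nonneg_bounded by blast
    have "(L * K)-lipschitz_on UNIV (\<lambda>u. B (G u))"
    proof (rule lipschitz_onI)
      fix u v
      have "norm (B (G u) - B (G v)) \<le> norm (G u - G v) * K" using K(1)[of "G u - G v"] by (simp add: B.diff)
      also have "\<dots> \<le> (L * norm (u - v)) * K" using K(2) G_lip by (intro mult_right_mono)
      finally show "dist (B (G u)) (B (G v)) \<le> L * K * dist u v" by (simp add: dist_norm mult_ac)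
    qed (use K(2) L_nonneg in simp)
    then show ?thesis ..
  qed
  then obtain K where K: "K-lipschitz_on UNIV (\<lambda>u. B (G u))" ..
  have Gcomp: "continuous_on S (\<lambda>s. G (h s))" "continuous_on S (\<lambda>s. B (G (h s)))" if "continuous_on S h" for S and h :: "real \<Rightarrow> 'e"
    using continuous_on_compose2[OF Gc that] continuous_on_compose2[OF lipschitz_on_continuous_on[OF K] that] by auto
  have eq: "B (x t) = B x0 + integral {0..t} (\<lambda>s. x s + B (G (x s)))" if t: "t \<ge> 0" for t
  proof -
    \<comment> \<open>Applying \<open>B - eps n\<close> to the approximate equation turns
      \<open>R (eps n) y\<close> into \<open>y\<close>. What is left contains no resolvent, only
      terms that converge and terms with the factor \<open>eps n\<close>.\<close>
    have ftc: "B (Y n x0 t) - eps n *\<^sub>R Y n x0 t - (B x0 - eps n *\<^sub>R x0)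
        = integral {0..t} (Y n x0) + integral {0..t} (\<lambda>s. B (G (Y n x0 s))) - eps n *\<^sub>R integral {0..t} (\<lambda>s. G (Y n x0 s))" for n
    proof -
      let ?y = "Y n x0"
      let ?f = "\<lambda>s. ?y s + B (G (?y s)) - eps n *\<^sub>R G (?y s)"
      have "(?f has_integral (B (?y t) - eps n *\<^sub>R ?y t) - (B (?y 0) - eps n *\<^sub>R ?y 0)) {0..t}"
      proof (rule fundamental_theorem_of_calculus[OF t])
        fix s assume s: "s \<in> {0..t}"
        then have d: "(?y has_vector_derivative R (eps n) (?y s) + G (?y s)) (at s within {0..t})"
          using Y(2)[of n x0] unfolding yosida_def
          by (meson atLeastAtMost_iff atLeast_iff has_vector_derivative_within_subset subsetI)
        have "((\<lambda>t. B (?y t) - eps n *\<^sub>R ?y t) has_vector_derivative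
            B (R (eps n) (?y s) + G (?y s)) - eps n *\<^sub>R (R (eps n) (?y s) + G (?y s))) (at s within {0..t})"
          by (intro has_vector_derivative_diff B.has_vector_derivative
              bounded_linear.has_vector_derivative[OF bounded_linear_scaleR_right] d)
        moreover have "B (R (eps n) (?y s) + G (?y s)) - eps n *\<^sub>R (R (eps n) (?y s) + G (?y s)) = ?f s"
          using R_eq[of "eps n" "?y s"] by (simp add: B.add scaleR_add_right algebra_simps del: of_nat_Suc)
        ultimately show "((\<lambda>t. B (?y t) - eps n *\<^sub>R ?y t) has_vector_derivative ?f s) (at s within {0..t})" by simp
      qed
      then have "B (?y t) - eps n *\<^sub>R ?y t - (B x0 - eps n *\<^sub>R x0) = integral {0..t} ?f"
        by (simp add: integral_unique Y(1))
      also have "\<dots> = integral {0..t} ?y + integral {0..t} (\<lambda>s. B (G (?y s))) - eps n *\<^sub>R integral {0..t} (\<lambda>s. G (?y s))"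
        by (simp add: integral_add integral_diff integral_cmul integrable_add integrable_cmul
            integrable_continuous_interval Yc Gcomp del: of_nat_Suc)
      finally show ?thesis .
    qed
    have "(\<lambda>n. B (Y n x0 t) - eps n *\<^sub>R Y n x0 t - (B x0 - eps n *\<^sub>R x0)) \<longlonglongrightarrow> B (x t) - 0 *\<^sub>R x t - (B x0 - 0 *\<^sub>R x0)"
      by (intro tendsto_intros B.tendsto pt[OF t] eps0)
    moreover have "(\<lambda>n. integral {0..t} (Y n x0) + integral {0..t} (\<lambda>s. B (G (Y n x0 s))) - eps n *\<^sub>R integral {0..t} (\<lambda>s. G (Y n x0 s)))
       \<longlonglongrightarrow> integral {0..t} x + integral {0..t} (\<lambda>s. B (G (x s))) - 0 *\<^sub>R integral {0..t} (\<lambda>s. G (x s))"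
      by (intro tendsto_intros eps0 integral_uniform_limit lim Yc Gcomp
          uniform_limit_lipschitz_comp[OF lim G] uniform_limit_lipschitz_comp[OF lim K])
    ultimately have "B (x t) - 0 *\<^sub>R x t - (B x0 - 0 *\<^sub>R x0) = integral {0..t} x + integral {0..t} (\<lambda>s. B (G (x s))) - 0 *\<^sub>R integral {0..t} (\<lambda>s. G (x s))"
      unfolding ftc by (rule LIMSEQ_unique)
    then show ?thesis
      by (simp add: integral_add integrable_continuous_interval xcT Gcomp algebra_simps)
  qed
  show thesis
  proof (rule that[OF x_0 xc])
    fix t :: real assume t: "t \<ge> 0"
    have "((\<lambda>u. B x0 + integral {0..u} (\<lambda>s. x s + B (G (x s)))) has_vector_derivative x t + B (G (x t))) (at t within {0..t+1})"
      using t by (auto intro!: derivative_eq_intros integral_has_vector_derivative continuous_intros xcT Gcomp)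
    then have "((\<lambda>t. B (x t)) has_vector_derivative x t + B (G (x t))) (at t within {0..t+1})"
      by (rule has_vector_derivative_transform[rotated 2]) (use t eq in auto)
    then show "((\<lambda>t. B (x t)) has_vector_derivative x t + B (G (x t))) (at t within {0..})"
      using at_within_atLeast[of t "t+1"] t by simp
  qed
qed

section \<open>The closure of the range, and uniqueness\<close>

text \<open>If \<open>p\<close> is the projection of \<open>x\<close> onto the closed range, then
  \<open>x - p\<close> is orthogonal to the range, and skewness gives \<open>B (x - p) = 0\<close>.
  So \<open>x - p\<close> lies in the kernel and is orthogonal to both \<open>x\<close> and
  \<open>p\<close>.\<close>

lemma orthogonal_kernel_closure:
  assumes x: "\<And>k. B k = 0 \<Longrightarrow> x \<bullet> k = 0"
  shows "x \<in> closure (range B)"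
proof -
  have "subspace (closure (range B))"
    by (intro subspace_closure linear_subspace_image) (auto intro: B bounded_linear.linear)
  then obtain p where p: "p \<in> closure (range B)" "\<And>c. c \<in> closure (range B) \<Longrightarrow> (x - p) \<bullet> c = 0"
    using hilbert_projection_exists[of "closure (range B)" x] by auto
  have p_range: "B u \<in> closure (range B)" for u by (rule subsetD[OF closure_subset rangeI])
  have "B (x - p) \<bullet> B (x - p) = - ((x - p) \<bullet> B (B (x - p)))" by (rule skew)
  also have "\<dots> = 0" using p(2)[OF p_range[of "B (x - p)"]] by (simp only: minus_zero)
  finally have "B (x - p) \<bullet> B (x - p) = 0" .
  then have k: "B (x - p) = 0" by simp
  have "p \<bullet> (x - p) = 0" using p(2)[OF p(1)] by (simp add: inner_commute)
  then have "(x - p) \<bullet> (x - p) = 0" using x[OF k] by (simp add: inner_diff_left)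
  then show ?thesis using p(1) by simp
qed

text \<open>Pairing with \<open>k\<close> annihilates every term in the range of \<open>B\<close>;
  only \<open>x t \<bullet> k\<close> survives in the differentiated equation.\<close>

lemma solution_orthogonal_kernel:
  assumes "((\<lambda>t. B (x t)) has_vector_derivative x t + B g) (at t)" and k: "B k = 0"
  shows "x t \<bullet> k = 0"
proof -
  have Bk: "B u \<bullet> k = 0" for u by (simp add: skew k)
  have "((\<lambda>t. B (x t) \<bullet> k) has_vector_derivative (x t + B g) \<bullet> k) (at t)"
    by (rule bounded_linear.has_vector_derivative[OF bounded_linear_inner_left assms(1)])
  then have "((\<lambda>t. 0::real) has_vector_derivative x t \<bullet> k) (at t)"
    by (simp add: Bk inner_add_left)
  then show ?thesis using vector_derivative_unique_at[OF _ has_vector_derivative_const] by blast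
qed

lemma unique_solution:
  assumes T: "0 < T" and c: "continuous_on {0..T} x" "continuous_on {0..T} z" and i: "x 0 = z 0"
    and dx: "\<And>t. 0 < t \<Longrightarrow> t < T \<Longrightarrow> ((\<lambda>t. B (x t)) has_vector_derivative x t + B (G (x t))) (at t)"
    and dz: "\<And>t. 0 < t \<Longrightarrow> t < T \<Longrightarrow> ((\<lambda>t. B (z t)) has_vector_derivative z t + B (G (z t))) (at t)"
    and t: "t \<in> {0..T}"
  shows "x t = z t"
proof -
  define d where "d t = x t - z t" for t
  define g where "g t = G (x t) - G (z t)" for t
  have dc: "continuous_on {0..T} d" unfolding d_def by (intro continuous_intros c)
  have gd: "norm (g t) \<le> L * norm (d t)" for t unfolding g_def d_def by (rule G_lip)
  have Bd: "((\<lambda>t. B (d t)) has_vector_derivative d t + B (g t)) (at t)" if "0 < t" "t < T" for t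
    using has_vector_derivative_diff[OF dx[OF that] dz[OF that]]
    by (simp add: d_def g_def B.diff algebra_simps)
  have dcl: "d t \<in> closure (range B)" if "0 < t" "t < T" for t
    by (rule orthogonal_kernel_closure) (rule solution_orthogonal_kernel[OF Bd[OF that]])
  define I where "I t = integral {0..t} (\<lambda>s. d s \<bullet> d s)" for t
  have ddc: "continuous_on {0..T} (\<lambda>s. d s \<bullet> d s)" by (intro continuous_intros dc)
  have Ic: "continuous_on {0..T} I" unfolding I_def
    by (intro indefinite_integral_continuous_1 integrable_continuous_interval ddc)
  have Id: "(I has_real_derivative d t \<bullet> d t) (at t)" if "0 < t" "t < T" for t
    unfolding I_def has_real_derivative_iff_has_vector_derivative
    using integral_has_vector_derivative[OF ddc, of t] that at_within_interior[of t "{0..T}"] by simp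
  have main: "d t \<bullet> d t \<le> 8 * L * I t" if t: "0 < t" "t < T" for t
  proof -
    have est: "norm (R e (B (d t))) ^ 2 \<le> 8 * L * I t" if e: "0 < e" for e
    proof -
      interpret R: bounded_linear "R e" by (rule R_bounded_linear[OF e])
      let ?z = "\<lambda>t. R e (B (d t))"
      \<comment> \<open>The factor 8 is 2 from differentiating the square, times 2 and 2 from
        \<open>R_B_norm\<close> applied to \<open>d\<close> and to \<open>g\<close>; the Lipschitz
        constant enters through \<open>gd\<close>.\<close>
      let ?\<phi> = "\<lambda>t. ?z t \<bullet> ?z t - 8 * L * I t"
      have "?\<phi> t \<le> ?\<phi> 0"
      proof (rule DERIV_nonpos_imp_decreasing_open[where f="?\<phi>" and a=0 and b=t])
        show "continuous_on {0..t} ?\<phi>"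
          by (intro continuous_intros R.continuous_on B.continuous_on continuous_on_subset[OF dc] continuous_on_subset[OF Ic])
             (use t in auto)
        fix s assume s: "0 < s" "s < t"
        have zd: "(?z has_vector_derivative R e (d s) + R e (B (g s))) (at s)"
          using R.has_vector_derivative[OF Bd[of s]] s t by (simp add: R.add)
        \<comment> \<open>\<open>R e\<close> commutes with \<open>B\<close>, so \<open>?z s\<close>
          is \<open>B (R e (d s))\<close> and hence orthogonal to \<open>R e (d s)\<close>. This
          removes the term that would not stay bounded as \<open>e\<close> tends to 0.\<close>
        have "R e (d s) \<bullet> ?z s = 0" by (simp add: R_B[OF e] B_R[OF e, symmetric] B_self)
        then have "?z s \<bullet> (R e (d s) + R e (B (g s))) = ?z s \<bullet> R e (B (g s))"
          by (simp add: inner_add_right inner_commute)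
        also have "\<dots> \<le> norm (?z s) * norm (R e (B (g s)))" by (rule norm_cauchy_schwarz)
        also have "\<dots> \<le> (2 * norm (d s)) * (2 * (L * norm (d s)))"
          using R_B_norm[OF e, of "d s"] R_B_norm[OF e, of "g s"] gd[of s] by (intro mult_mono) auto
        also have "\<dots> = 4 * L * (d s \<bullet> d s)" by (simp add: power2_norm_eq_inner[symmetric] power2_eq_square mult_ac)
        finally have "2 * (?z s \<bullet> (R e (d s) + R e (B (g s)))) - 8 * L * (d s \<bullet> d s) \<le> 0" by simp
        moreover have "(?\<phi> has_real_derivative 2 * (?z s \<bullet> (R e (d s) + R e (B (g s)))) - 8 * L * (d s \<bullet> d s)) (at s)"
          using s t by (intro DERIV_diff has_real_derivative_inner_self[OF zd] DERIV_cmult Id) auto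
        ultimately show "\<exists>y. (?\<phi> has_real_derivative y) (at s) \<and> y \<le> 0" by blast
      qed (use t in simp)
      moreover have "d 0 = 0" "I 0 = 0" by (auto simp: d_def i I_def)
      ultimately show ?thesis by (simp add: power2_norm_eq_inner B.zero R.zero)
    qed
    have "(\<lambda>n. R (eps n) (B (d t))) \<longlonglongrightarrow> d t + 0"
      using tendsto_add[OF tendsto_const eps_R_tendsto[OF dcl[OF t]], of "d t"] by (simp add: R_B del: of_nat_Suc)
    then have "(\<lambda>n. (norm (R (eps n) (B (d t))))\<^sup>2) \<longlonglongrightarrow> (norm (d t + 0))\<^sup>2" by (intro tendsto_intros)
    then have "(norm (d t + 0))\<^sup>2 \<le> 8 * L * I t"
      by (rule LIMSEQ_le_const2) (intro exI allI impI est, simp)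
    then show ?thesis by (simp add: power2_norm_eq_inner)
  qed
  have "d t = 0" if t: "0 < t" "t < T" for t
  proof -
    \<comment> \<open>The limit estimate bounds the energy of \<open>d\<close> by the integral of
      that energy, so Gronwall is applied to the integral \<open>I\<close>, which vanishes at
      0.\<close>
    have "I t \<le> (I 0 + 0 * t) * exp (8 * L * t)"
    proof (rule gronwall_differential)
      show "continuous_on {0..t} I" using t by (intro continuous_on_subset[OF Ic]) auto
      fix s assume "0 < s" "s < t"
      then show "\<exists>D. (I has_real_derivative D) (at s) \<and> D \<le> 8 * L * I s + 0"
        using Id[of s] main[of s] t by auto
    qed (use t L_nonneg in auto)
    then have "8 * L * I t \<le> 0" using L_nonneg by (simp add: I_def mult_nonneg_nonpos)
    then have "d t \<bullet> d t \<le> 0" using main[OF t] by linarith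
    then show ?thesis by (simp flip: power2_norm_eq_inner)
  qed
  moreover have "closure {0<..<T} = {0..T}" using T by simp
  ultimately have "d t = 0"
    using continuous_constant_on_closure[of "{0<..<T}" d 0 t] dc t by auto
  then show ?thesis by (simp add: d_def)
qed

end

section \<open>The Hilbert space of square-integrable functions\<close>

abbreviation lebI :: "real measure" where "lebI \<equiv> lebesgue_on {0..pi}"

lemma finite_measure_lebI: "finite_measure lebI"
  by (rule finite_measureI) (simp add: emeasure_restrict_space)

text \<open>For the nonnegative square, gauge and Lebesgue integrability agree. This opens the
  definitions, which are stated with gauge integrals, to Lebesgue integration.\<close>

lemma L2_iff: "L2 u \<longleftrightarrow> u \<in> borel_measurable lebI \<and> integrable lebI (\<lambda>x. (u x)\<^sup>2)"
proof -
  have "integrable lebI (\<lambda>x. (u x)\<^sup>2) \<longleftrightarrow> (\<lambda>x. (u x)\<^sup>2) integrable_on {0..pi}"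
    using integrable_on_lebesgue_on[of "{0..pi}" "\<lambda>x. (u x)\<^sup>2"]
      absolutely_integrable_imp_integrable[OF nonnegative_absolutely_integrable_1, of "\<lambda>x. (u x)\<^sup>2" "{0..pi}"] by auto
  then show ?thesis by (simp add: L2_def measurable_on_iff_borel_measurable)
qed

lemma L2_measurable: "L2 u \<Longrightarrow> u \<in> borel_measurable lebI" by (simp add: L2_iff)

lemma L2_mult_integrable:
  assumes "L2 u" "L2 v"
  shows "integrable lebI (\<lambda>x. u x * v x)"
proof (rule Bochner_Integration.integrable_bound[of _ "\<lambda>x. (u x)\<^sup>2 + (v x)\<^sup>2"])
  show "integrable lebI (\<lambda>x. (u x)\<^sup>2 + (v x)\<^sup>2)" using assms by (auto simp: L2_iff)
  show "(\<lambda>x. u x * v x) \<in> borel_measurable lebI" using assms by (auto simp: L2_iff)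
  have "\<bar>a * b\<bar> \<le> a\<^sup>2 + b\<^sup>2" for a b :: real
  proof -
    have "0 \<le> (\<bar>a\<bar> - \<bar>b\<bar>)\<^sup>2" by simp
    then have "2 * (\<bar>a\<bar> * \<bar>b\<bar>) \<le> a\<^sup>2 + b\<^sup>2" by (simp add: power2_diff algebra_simps)
    moreover have "0 \<le> \<bar>a\<bar> * \<bar>b\<bar>" by simp
    ultimately show ?thesis unfolding abs_mult by linarith
  qed
  then show "AE x in lebI. norm (u x * v x) \<le> norm ((u x)\<^sup>2 + (v x)\<^sup>2)"
    by (intro AE_I2) auto
qed

lemma ip2_eq_lebesgue: "L2 u \<Longrightarrow> L2 v \<Longrightarrow> ip2 u v = (LINT x|lebI. u x * v x)"
  unfolding ip2_def by (rule lebesgue_integral_eq_integral[symmetric]) (auto intro: L2_mult_integrable)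

lemma L2_zero: "L2 (\<lambda>x. 0)" by (simp add: L2_iff)

lemma L2_scale: "L2 u \<Longrightarrow> L2 (\<lambda>x. c * u x)"
  by (auto simp: L2_iff power_mult_distrib)

lemma L2_add: "L2 u \<Longrightarrow> L2 v \<Longrightarrow> L2 (\<lambda>x. u x + v x)"
proof -
  assume uv: "L2 u" "L2 v"
  have "integrable lebI (\<lambda>x. ((u x)\<^sup>2 + (v x)\<^sup>2) + 2 * (u x * v x))"
    by (intro Bochner_Integration.integrable_add integrable_mult_right L2_mult_integrable uv)
       (use uv in \<open>auto simp: L2_iff\<close>)
  then have "integrable lebI (\<lambda>x. (u x + v x)\<^sup>2)" by (simp add: power2_sum mult.assoc)
  then show ?thesis using uv by (auto simp: L2_iff)
qed

lemma L2_diff: "L2 u \<Longrightarrow> L2 v \<Longrightarrow> L2 (\<lambda>x. u x - v x)"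
  using L2_add[OF _ L2_scale[of v "-1"]] by simp

lemma L2_minus: "L2 u \<Longrightarrow> L2 (\<lambda>x. - u x)"
  using L2_scale[of u "-1"] by simp

lemma L2_cong_AE: "L2 u \<Longrightarrow> v \<in> borel_measurable lebI \<Longrightarrow> AE x in lebI. u x = v x \<Longrightarrow> L2 v"
  unfolding L2_iff
  by (auto elim!: integrable_cong_AE_imp) 

lemma L2_cong: "L2 u \<Longrightarrow> (\<And>x. x \<in> {0..pi} \<Longrightarrow> u x = v x) \<Longrightarrow> L2 v"
  unfolding L2_iff
  by (metis (mono_tags, lifting) Bochner_Integration.integrable_cong measurable_cong space_lebesgue_on)

lemma L2_bounded_mult:
  assumes u: "L2 u" and c: "c \<in> borel_measurable lebI" and K: "\<And>x. x \<in> {0..pi} \<Longrightarrow> \<bar>c x\<bar> \<le> K"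
  shows "L2 (\<lambda>x. c x * u x)"
  unfolding L2_iff
proof
  show "(\<lambda>x. c x * u x) \<in> borel_measurable lebI" using u c by (auto simp: L2_iff)
  show "integrable lebI (\<lambda>x. (c x * u x)\<^sup>2)"
  proof (rule Bochner_Integration.integrable_bound[of _ "\<lambda>x. K\<^sup>2 * (u x)\<^sup>2"])
    show "integrable lebI (\<lambda>x. K\<^sup>2 * (u x)\<^sup>2)" using u by (auto simp: L2_iff)
    show "(\<lambda>x. (c x * u x)\<^sup>2) \<in> borel_measurable lebI" using u c by (auto simp: L2_iff)
    show "AE x in lebI. norm ((c x * u x)\<^sup>2) \<le> norm (K\<^sup>2 * (u x)\<^sup>2)"
    proof (rule AE_I2)
      fix x assume "x \<in> space lebI"
      then have "\<bar>c x\<bar>\<^sup>2 \<le> K\<^sup>2" using K[of x] by (intro power_mono) auto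
      then show "norm ((c x * u x)\<^sup>2) \<le> norm (K\<^sup>2 * (u x)\<^sup>2)"
        by (simp add: power_mult_distrib mult_right_mono)
    qed
  qed
qed

lemma L2_const: "L2 (\<lambda>x. c)"
  using finite_measure.integrable_const[OF finite_measure_lebI] by (simp add: L2_iff)

lemma continuous_measurable_lebI: "continuous_on {0..pi} c \<Longrightarrow> c \<in> borel_measurable lebI"
  by (simp add: continuous_imp_measurable_on_sets_lebesgue)

lemma L2_continuous_mult: "continuous_on {0..pi} c \<Longrightarrow> L2 u \<Longrightarrow> L2 (\<lambda>x. c x * u x)"
proof -
  assume c: "continuous_on {0..pi} c" and u: "L2 u"
  have "compact (c ` {0..pi})" using c by (intro compact_continuous_image) auto
  then obtain K where "\<And>x. x \<in> {0..pi} \<Longrightarrow> \<bar>c x\<bar> \<le> K"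
    using compact_imp_bounded bounded_iff by (metis (no_types, lifting) imageI real_norm_def)
  then show ?thesis using L2_bounded_mult[OF u continuous_measurable_lebI[OF c]] by blast
qed

lemma L2_continuous: "continuous_on {0..pi} c \<Longrightarrow> L2 c"
  using L2_continuous_mult[OF _ L2_const[of 1], of c] by simp

section \<open>The quotient by equality almost everywhere\<close>

definition l2eq :: "(real \<Rightarrow> real) \<Rightarrow> (real \<Rightarrow> real) \<Rightarrow> bool" where
  "l2eq f g \<longleftrightarrow> L2 f \<and> L2 g \<and> (AE x in lebI. f x = g x)"

\<comment> \<open>The quotient is partial: functions that are not square-integrable are related to
  nothing, so facts about \<open>cls f\<close> always carry the hypothesis
  \<open>L2 f\<close>.\<close>
quotient_type l2 = "real \<Rightarrow> real" / partial: l2eq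
proof (rule part_equivpI)
  show "\<exists>x. l2eq x x" using L2_zero by (auto simp: l2eq_def)
  show "symp l2eq" by (auto simp: symp_def l2eq_def)
  show "transp l2eq" unfolding transp_def l2eq_def by auto
qed

lemma l2eq_refl: "L2 f \<Longrightarrow> l2eq f f" by (simp add: l2eq_def)

lemma ip2_cong_l2eq:
  assumes "l2eq f f'" "l2eq g g'"
  shows "ip2 f g = ip2 f' g'"
proof -
  have "(LINT x|lebI. f x * g x) = (LINT x|lebI. f' x * g' x)"
    by (rule integral_cong_AE) (use assms in \<open>auto simp: l2eq_def L2_iff\<close>)
  then show ?thesis using assms by (simp add: l2eq_def ip2_eq_lebesgue)
qed

instantiation l2 :: real_vector
begin

lift_definition zero_l2 :: l2 is "\<lambda>x. 0" by (simp add: l2eq_def L2_zero)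
lift_definition plus_l2 :: "l2 \<Rightarrow> l2 \<Rightarrow> l2" is "\<lambda>f g x. f x + g x" by (auto simp: l2eq_def L2_add)
lift_definition minus_l2 :: "l2 \<Rightarrow> l2 \<Rightarrow> l2" is "\<lambda>f g x. f x - g x" by (auto simp: l2eq_def L2_diff)
lift_definition uminus_l2 :: "l2 \<Rightarrow> l2" is "\<lambda>f x. - f x" by (auto simp: l2eq_def L2_minus)
lift_definition scaleR_l2 :: "real \<Rightarrow> l2 \<Rightarrow> l2" is "\<lambda>r f x. r * f x" by (auto simp: l2eq_def L2_scale)

instance
proof
  fix a b c :: l2 and r r' :: real
  show "a + b + c = a + (b + c)" by transfer (auto simp: l2eq_def L2_add)
  show "a + b = b + a" by transfer (auto simp: l2eq_def L2_add)
  show "0 + a = a" by transfer (auto simp: l2eq_def)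
  show "- a + a = 0" by transfer (auto simp: l2eq_def L2_zero)
  show "a - b = a + - b" by transfer (auto simp: l2eq_def L2_diff)
  show "r *\<^sub>R (a + b) = r *\<^sub>R a + r *\<^sub>R b"
    by transfer (use L2_scale[OF L2_add] in \<open>auto simp: l2eq_def distrib_left\<close>)
  show "(r + r') *\<^sub>R a = r *\<^sub>R a + r' *\<^sub>R a"
    by transfer (use L2_scale in \<open>auto simp: l2eq_def distrib_right L2_add\<close>)
  show "r *\<^sub>R r' *\<^sub>R a = (r * r') *\<^sub>R a"
    by transfer (use L2_scale in \<open>auto simp: l2eq_def mult.assoc\<close>)
  show "1 *\<^sub>R a = a" by transfer (auto simp: l2eq_def)
qed

end

instantiation l2 :: real_inner
begin

lift_definition inner_l2 :: "l2 \<Rightarrow> l2 \<Rightarrow> real" is ip2 by (rule ip2_cong_l2eq)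
definition norm_l2 :: "l2 \<Rightarrow> real" where "norm_l2 x = sqrt (inner x x)"
definition dist_l2 :: "l2 \<Rightarrow> l2 \<Rightarrow> real" where "dist_l2 x y = norm (x - y)"
definition sgn_l2 :: "l2 \<Rightarrow> l2" where "sgn_l2 x = x /\<^sub>R norm x"
definition uniformity_l2 :: "(l2 \<times> l2) filter" where
  "uniformity_l2 = (INF e\<in>{0<..}. principal {(x, y). dist x y < e})"
definition open_l2 :: "l2 set \<Rightarrow> bool" where
  "open_l2 U \<longleftrightarrow> (\<forall>x\<in>U. eventually (\<lambda>(x', y). x' = x \<longrightarrow> y \<in> U) uniformity)"

instance
proof
  fix x y z :: l2 and r :: real
  show "dist x y = norm (x - y)" by (simp add: dist_l2_def)
  show "sgn x = x /\<^sub>R norm x" by (simp add: sgn_l2_def)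
  show "uniformity = (INF e\<in>{0<..}. principal {(x, y). dist (x::l2) y < e})" by (simp add: uniformity_l2_def)
  show "open U \<longleftrightarrow> (\<forall>x\<in>U. eventually (\<lambda>(x', y). x' = x \<longrightarrow> y \<in> U) uniformity)" for U :: "l2 set"
    by (simp add: open_l2_def)
  show "inner x y = inner y x" by transfer (simp add: ip2_def mult.commute)
  show "inner (x + y) z = inner x z + inner y z"
  proof transfer
    fix x y z assume "l2eq x x" "l2eq y y" "l2eq z z"
    then show "ip2 (\<lambda>t. x t + y t) z = ip2 x z + ip2 y z"
      by (simp add: l2eq_def ip2_eq_lebesgue L2_add distrib_right L2_mult_integrable)
  qed
  show "inner (r *\<^sub>R x) y = r * inner x y"
    by transfer (simp add: ip2_def mult.assoc)
  show "0 \<le> inner x x"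
  proof transfer
    fix x assume "l2eq x x"
    then show "0 \<le> ip2 x x" by (simp add: l2eq_def ip2_eq_lebesgue)
  qed
  show "inner x x = 0 \<longleftrightarrow> x = 0"
  proof transfer
    fix x assume x: "l2eq x x"
    have "ip2 x x = 0 \<longleftrightarrow> (AE t in lebI. x t * x t = 0)"
      using x by (simp add: l2eq_def ip2_eq_lebesgue integral_nonneg_eq_0_iff_AE L2_mult_integrable)
    then show "ip2 x x = 0 \<longleftrightarrow> l2eq x (\<lambda>x. 0)" using x by (simp add: l2eq_def L2_zero)
  qed
  show "norm x = sqrt (inner x x)" by (simp add: norm_l2_def)
qed

end

abbreviation cls :: "(real \<Rightarrow> real) \<Rightarrow> l2" where "cls \<equiv> abs_l2"
abbreviation rep :: "l2 \<Rightarrow> real \<Rightarrow> real" where "rep \<equiv> rep_l2"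

lemma L2_rep [simp]: "L2 (rep q)"
  using Quotient_rep_reflp[OF Quotient_l2] by (simp add: l2eq_def)

lemma cls_rep [simp]: "cls (rep q) = q"
  by (rule Quotient_abs_rep[OF Quotient_l2])

lemma cls_eq_iff: "L2 f \<Longrightarrow> L2 g \<Longrightarrow> cls f = cls g \<longleftrightarrow> (AE x in lebI. f x = g x)"
  using Quotient_rel_abs2 Quotient_rel[OF Quotient_l2, of f g] by (auto simp: l2eq_def)

lemma cls_eqI: "L2 f \<Longrightarrow> (\<And>x. x \<in> {0..pi} \<Longrightarrow> f x = g x) \<Longrightarrow> cls f = cls g"
  by (subst cls_eq_iff) (auto intro: L2_cong)

lemma rep_cls_AE: "L2 f \<Longrightarrow> AE x in lebI. rep (cls f) x = f x"
  using cls_eq_iff[of "rep (cls f)" f] by simp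

lemma inner_cls: "L2 f \<Longrightarrow> L2 g \<Longrightarrow> cls f \<bullet> cls g = ip2 f g"
  by (simp add: inner_l2.abs_eq l2eq_refl)

lemma norm_cls: "L2 f \<Longrightarrow> norm (cls f) = norm2 f"
  by (simp add: norm_eq_sqrt_inner inner_cls norm2_def)

lemma norm_cls_sq: "L2 f \<Longrightarrow> (norm (cls f))\<^sup>2 = (LINT x|lebI. (f x)\<^sup>2)"
  unfolding power2_norm_eq_inner by (simp add: inner_cls ip2_eq_lebesgue power2_eq_square)

lemma cls_add: "L2 f \<Longrightarrow> L2 g \<Longrightarrow> cls (\<lambda>x. f x + g x) = cls f + cls g"
  by (simp add: plus_l2.abs_eq l2eq_refl)

lemma cls_diff: "L2 f \<Longrightarrow> L2 g \<Longrightarrow> cls (\<lambda>x. f x - g x) = cls f - cls g"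
  by (simp add: minus_l2.abs_eq l2eq_refl)

lemma cls_scale: "L2 f \<Longrightarrow> cls (\<lambda>x. r * f x) = r *\<^sub>R cls f"
  by (simp add: scaleR_l2.abs_eq l2eq_refl)

lemma norm_cls_bound:
  assumes "L2 f" and K: "\<And>x. x \<in> {0..pi} \<Longrightarrow> \<bar>f x\<bar> \<le> K"
  shows "norm (cls f) \<le> sqrt pi * K"
proof -
  have K0: "K \<ge> 0" using K[of 0] by auto
  have "ip2 f f \<le> (LINT x|lebI. K\<^sup>2)"
    unfolding ip2_eq_lebesgue[OF assms(1) assms(1)]
  proof (rule integral_mono)
    fix x assume "x \<in> space lebI"
    then have "\<bar>f x\<bar>\<^sup>2 \<le> K\<^sup>2" using K[of x] by (intro power_mono) auto
    then show "f x * f x \<le> K\<^sup>2" by (simp add: power2_eq_square)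
  qed (auto intro: L2_mult_integrable assms(1) finite_measure.integrable_const[OF finite_measure_lebI])
  also have "\<dots> = pi * K\<^sup>2" by (simp add: measure_restrict_space)
  finally have "norm (cls f) \<le> sqrt (pi * K\<^sup>2)" by (simp add: norm_eq_sqrt_inner inner_cls assms(1))
  then show ?thesis using K0 by (simp add: real_sqrt_mult)
qed

text \<open>Riesz-Fischer. On an interval of finite length a Cauchy sequence in L2 is Cauchy in L1,
  so a subsequence converges almost everywhere; Fatou's lemma shows that its pointwise limit is the
  limit in norm.\<close>

instance l2 :: complete_space
proof
  fix X :: "nat \<Rightarrow> l2" assume X: "Cauchy X"
  define f where "f n = rep (X n)" for n
  have L2f: "L2 (f n)" for n by (simp add: f_def)
  have Xf: "X n = cls (f n)" for n by (simp add: f_def)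
  have L2abs: "L2 (\<lambda>x. \<bar>h x\<bar>)" if "L2 h" for h using that by (auto simp: L2_iff)
  have L1: "(LINT x|lebI. norm (f i x - f j x)) \<le> sqrt pi * norm (X i - X j)" for i j
  proof -
    let ?h = "\<lambda>x. f i x - f j x"
    have h: "L2 ?h" by (simp add: L2_diff L2f)
    have "(LINT x|lebI. norm (f i x - f j x)) = cls (\<lambda>x. \<bar>?h x\<bar>) \<bullet> cls (\<lambda>x. 1)"
      by (simp add: inner_cls L2abs h L2_const ip2_eq_lebesgue)
    also have "\<dots> \<le> norm (cls (\<lambda>x. \<bar>?h x\<bar>)) * norm (cls (\<lambda>x. 1))" by (rule norm_cauchy_schwarz)
    also have "norm (cls (\<lambda>x. \<bar>?h x\<bar>)) = norm (X i - X j)"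
      by (simp add: norm_cls L2abs h norm2_def ip2_def Xf cls_diff[symmetric] L2f)
    also have "norm (X i - X j) * norm (cls (\<lambda>x. 1)) \<le> norm (X i - X j) * sqrt pi"
      using norm_cls_bound[OF L2_const, of 1 1] by (intro mult_left_mono) auto
    finally show ?thesis by (simp add: mult.commute)
  qed
  have int: "integrable lebI (f n)" for n
    using L2_mult_integrable[OF L2f L2_const[of 1]] by simp
  obtain r where r: "strict_mono r" "AE x in lebI. Cauchy (\<lambda>i. f (r i) x)"
  proof (rule cauchy_L1_AE_cauchy_subseq[of lebI f])
    show "integrable lebI (f n)" for n by (rule int)
    fix e :: real assume "e > 0"
    then have "e / sqrt pi > 0" by simp
    then obtain N where N: "\<And>i j. i \<ge> N \<Longrightarrow> j \<ge> N \<Longrightarrow> norm (X i - X j) < e / sqrt pi"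
      using X CauchyD by meson
    show "\<exists>N. \<forall>i\<ge>N. \<forall>j\<ge>N. (LINT x|lebI. norm (f i x - f j x)) < e"
    proof (intro exI allI impI)
      fix i j assume "i \<ge> N" "j \<ge> N"
      then have "sqrt pi * norm (X i - X j) < e" using N[of i j] by (simp add: field_simps)
      then show "(LINT x|lebI. norm (f i x - f j x)) < e" using L1[of i j] by linarith
    qed
  qed
  define F where "F x = lim (\<lambda>i. f (r i) x)" for x
  have Fm: "F \<in> borel_measurable lebI" unfolding F_def
    by (rule borel_measurable_lim_metric) (simp add: L2_measurable L2f)
  have Flim: "AE x in lebI. (\<lambda>i. f (r i) x) \<longlonglongrightarrow> F x"
    using r(2) by eventually_elim (simp add: F_def convergent_LIMSEQ_iff[symmetric] Cauchy_convergent)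
  \<comment> \<open>Fatou along the subsequence, against the fixed term \<open>f n\<close>.
    Finiteness puts \<open>F - f n\<close>, hence \<open>F\<close>, in L2, and the same inequality
    is the distance estimate.\<close>
  have key: "L2 F \<and> norm (cls F - X n) \<le> e"
    if e: "e > 0" and N: "\<And>i. i \<ge> N \<Longrightarrow> norm (X i - X n) \<le> e" for e n N
  proof -
    let ?u = "\<lambda>i x. ennreal ((f (r i) x - f n x)\<^sup>2)"
    have nn: "(\<integral>\<^sup>+x. ?u i x \<partial>lebI) = ennreal ((norm (X (r i) - X n))\<^sup>2)" for i
    proof -
      have h: "L2 (\<lambda>x. f (r i) x - f n x)" by (simp add: L2_diff L2f)
      then have "(\<integral>\<^sup>+x. ?u i x \<partial>lebI) = ennreal (LINT x|lebI. (f (r i) x - f n x)\<^sup>2)"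
        by (intro nn_integral_eq_integral) (auto simp: L2_iff)
      also have "(LINT x|lebI. (f (r i) x - f n x)\<^sup>2) = (norm (X (r i) - X n))\<^sup>2"
        using norm_cls_sq[OF h] by (simp add: Xf cls_diff L2f)
      finally show ?thesis .
    qed
    have "(\<integral>\<^sup>+x. ennreal ((F x - f n x)\<^sup>2) \<partial>lebI) = (\<integral>\<^sup>+x. liminf (\<lambda>i. ?u i x) \<partial>lebI)"
    proof (rule nn_integral_cong_AE)
      show "AE x in lebI. ennreal ((F x - f n x)\<^sup>2) = liminf (\<lambda>i. ?u i x)"
        using Flim
      proof eventually_elim
        case (elim x)
        then have "(\<lambda>i. ?u i x) \<longlonglongrightarrow> ennreal ((F x - f n x)\<^sup>2)" by (intro tendsto_intros tendsto_ennrealI)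
        then show ?case using lim_imp_Liminf[OF sequentially_bot] by metis
      qed
    qed
    also have "\<dots> \<le> liminf (\<lambda>i. \<integral>\<^sup>+x. ?u i x \<partial>lebI)"
    proof (rule nn_integral_liminf)
      show "?u i \<in> borel_measurable lebI" for i
        using L2_measurable[OF L2f] by measurable
    qed
    also have "\<dots> \<le> ennreal (e\<^sup>2)"
    proof (rule Liminf_le)
      show "\<forall>\<^sub>F i in sequentially. (\<integral>\<^sup>+x. ?u i x \<partial>lebI) \<le> ennreal (e\<^sup>2)"
        using eventually_ge_at_top[of N]
      proof eventually_elim
        case (elim i)
        then have "N \<le> r i" using strict_mono_imp_increasing[OF r(1), of i] by linarith
        then show ?case unfolding nn using N[of "r i"] by (intro ennreal_leI power_mono) auto
      qed
    qed simp
    finally have fin: "(\<integral>\<^sup>+x. ennreal ((F x - f n x)\<^sup>2) \<partial>lebI) \<le> ennreal (e\<^sup>2)" .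
    have L2d: "L2 (\<lambda>x. F x - f n x)"
      unfolding L2_iff
    proof
      show m: "(\<lambda>x. F x - f n x) \<in> borel_measurable lebI" using Fm L2_measurable[OF L2f] by measurable
      show "integrable lebI (\<lambda>x. (F x - f n x)\<^sup>2)"
        using m fin by (intro integrableI_bounded) (auto intro: le_less_trans)
    qed
    have L2F: "L2 F" using L2_add[OF L2d L2f[of n]] by simp
    have "ennreal ((norm (cls F - X n))\<^sup>2) = (\<integral>\<^sup>+x. ennreal ((F x - f n x)\<^sup>2) \<partial>lebI)"
      using L2d norm_cls_sq[OF L2d] cls_diff[OF L2F L2f[of n]]
      by (subst nn_integral_eq_integral) (auto simp: L2_iff Xf)
    then have "ennreal ((norm (cls F - X n))\<^sup>2) \<le> ennreal (e\<^sup>2)" using fin by simp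
    then have "(norm (cls F - X n))\<^sup>2 \<le> e\<^sup>2" by (simp add: ennreal_le_iff)
    then have "norm (cls F - X n) \<le> e" by (rule power2_le_imp_le) (use e in simp)
    with L2F show ?thesis by blast
  qed
  have "X \<longlonglongrightarrow> cls F"
  proof (rule LIMSEQ_I)
    fix e :: real assume "e > 0"
    then obtain N where N: "\<And>i j. i \<ge> N \<Longrightarrow> j \<ge> N \<Longrightarrow> norm (X i - X j) < e / 2"
      using X CauchyD half_gt_zero by meson
    show "\<exists>N. \<forall>n\<ge>N. norm (X n - cls F) < e"
    proof (intro exI allI impI)
      fix n assume n: "n \<ge> N"
      have "norm (cls F - X n) \<le> e / 2"
        using key[of "e/2" N n] N n \<open>e > 0\<close> by (auto intro: less_imp_le)
      then show "norm (X n - cls F) < e" using \<open>e > 0\<close> by (simp add: norm_minus_commute)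
    qed
  qed
  then show "convergent X" by (rule convergentI)
qed

instance l2 :: banach ..

section \<open>Multiplication by continuous functions\<close>

definition Mul :: "(real \<Rightarrow> real) \<Rightarrow> l2 \<Rightarrow> l2" where
  "Mul c q = cls (\<lambda>x. c x * rep q x)"

lemma Mul_cls:
  assumes c: "continuous_on {0..pi} c" and f: "L2 f"
  shows "Mul c (cls f) = cls (\<lambda>x. c x * f x)"
proof -
  have "AE x in lebI. c x * rep (cls f) x = c x * f x"
    using rep_cls_AE[OF f] by eventually_elim simp
  then show ?thesis unfolding Mul_def
    by (simp add: cls_eq_iff L2_continuous_mult c f)
qed

lemma Mul_bounded_linear:
  assumes c: "continuous_on {0..pi} c"
  shows "bounded_linear (Mul c)"
proof -
  have "compact (c ` {0..pi})" using c by (intro compact_continuous_image) auto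
  then obtain K where K: "\<And>x. x \<in> {0..pi} \<Longrightarrow> \<bar>c x\<bar> \<le> K"
    using compact_imp_bounded bounded_iff by (metis (no_types, lifting) imageI real_norm_def)
  have K0: "K \<ge> 0" using K[of 0] by auto
  note L = L2_continuous_mult[OF c]
  show ?thesis
  proof (rule bounded_linear_intro)
    fix p q :: l2 and r :: real
    have "Mul c (p + q) = Mul c (cls (\<lambda>x. rep p x + rep q x))" by (simp add: cls_add)
    also have "\<dots> = cls (\<lambda>x. c x * rep p x + c x * rep q x)"
      by (simp add: Mul_cls[OF c] L2_add distrib_left)
    also have "\<dots> = Mul c p + Mul c q" by (simp add: cls_add L Mul_def)
    finally show "Mul c (p + q) = Mul c p + Mul c q" .
    have "Mul c (r *\<^sub>R p) = Mul c (cls (\<lambda>x. r * rep p x))" by (simp add: cls_scale)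
    also have "\<dots> = cls (\<lambda>x. r * (c x * rep p x))"
      by (simp add: Mul_cls[OF c] L2_scale mult_ac)
    also have "\<dots> = r *\<^sub>R Mul c p" by (simp add: cls_scale L Mul_def)
    finally show "Mul c (r *\<^sub>R p) = r *\<^sub>R Mul c p" .
    have "(norm (Mul c p))\<^sup>2 = (LINT x|lebI. (c x * rep p x)\<^sup>2)"
      unfolding Mul_def by (rule norm_cls_sq[OF L]) simp
    also have "\<dots> \<le> (LINT x|lebI. K\<^sup>2 * (rep p x)\<^sup>2)"
    proof (rule integral_mono)
      show "integrable lebI (\<lambda>x. (c x * rep p x)\<^sup>2)" using L[OF L2_rep[of p]] by (simp add: L2_iff)
      show "integrable lebI (\<lambda>x. K\<^sup>2 * (rep p x)\<^sup>2)" using L2_rep[of p] by (simp add: L2_iff)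
      fix x assume "x \<in> space lebI"
      then have "\<bar>c x\<bar>\<^sup>2 \<le> K\<^sup>2" using K[of x] by (intro power_mono) auto
      then show "(c x * rep p x)\<^sup>2 \<le> K\<^sup>2 * (rep p x)\<^sup>2"
        by (simp add: power_mult_distrib mult_right_mono)
    qed
    also have "\<dots> = (norm p * K)\<^sup>2" using norm_cls_sq[OF L2_rep, of p] by (simp add: power_mult_distrib)
    finally show "norm (Mul c p) \<le> norm p * K" by (rule power2_le_imp_le) (use K0 in simp)
  qed
qed

lemma Mul_self_adjoint:
  assumes c: "continuous_on {0..pi} c"
  shows "Mul c p \<bullet> q = p \<bullet> Mul c q"
proof -
  have "Mul c p \<bullet> q = cls (\<lambda>x. c x * rep p x) \<bullet> cls (rep q)" by (simp add: Mul_def)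
  also have "\<dots> = cls (rep p) \<bullet> cls (\<lambda>x. c x * rep q x)"
    by (subst (1 2) inner_cls) (auto intro!: L2_continuous_mult[OF c] simp: ip2_def mult_ac)
  finally show ?thesis by (simp add: Mul_def)
qed

lemma Mul_Mul:
  assumes "continuous_on {0..pi} c" "continuous_on {0..pi} e"
  shows "Mul c (Mul e q) = Mul (\<lambda>x. c x * e x) q"
  unfolding Mul_def[of e] Mul_cls[OF assms(1) L2_continuous_mult[OF assms(2) L2_rep]]
  by (simp add: Mul_def mult.assoc)

lemma Mul_one: "(\<And>x. x \<in> {0..pi} \<Longrightarrow> c x = 1) \<Longrightarrow> Mul c q = q"
  unfolding Mul_def using cls_eqI[of "rep q" "\<lambda>x. c x * rep q x"] by simp

lemma Mul_inverse:
  assumes c: "continuous_on {0..pi} c" and nz: "\<And>x. x \<in> {0..pi} \<Longrightarrow> c x \<noteq> 0"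
  shows "Mul (\<lambda>x. 1 / c x) (Mul c q) = q" "Mul c (Mul (\<lambda>x. 1 / c x) q) = q"
proof -
  have i: "continuous_on {0..pi} (\<lambda>x. 1 / c x)" using c nz by (intro continuous_intros) auto
  show "Mul (\<lambda>x. 1 / c x) (Mul c q) = q" "Mul c (Mul (\<lambda>x. 1 / c x) q) = q"
    by (subst Mul_Mul, auto intro!: c i Mul_one nz)+
qed

section \<open>Primitives\<close>

definition ind :: "real \<Rightarrow> l2" where "ind x = cls (indicator {0..x})"

text \<open>Writing the primitive as an inner product makes it independent of the representative and
  exhibits evaluation at \<open>x\<close> as a bounded linear functional.\<close>

definition prim :: "l2 \<Rightarrow> real \<Rightarrow> real" where "prim q x = q \<bullet> ind x"

definition Ip :: "l2 \<Rightarrow> l2" where "Ip q = cls (prim q)"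

lemma L2_indicator: "L2 (indicator {0..x::real} :: real \<Rightarrow> real)"
proof -
  have "L2 (\<lambda>y. (indicator {0..x} y :: real) * 1)"
    by (rule L2_bounded_mult[where K=1, OF L2_const])
       (rule measurable_restrict_space1[OF borel_measurable_indicator], auto simp: indicator_def)
  then show ?thesis by simp
qed

lemma integral_eq_prim:
  assumes f: "L2 f" and x: "x \<in> {0..pi}"
  shows "integral {0..x} f = prim (cls f) x"
proof -
  have "prim (cls f) x = integral {0..pi} (\<lambda>y. if y \<in> {0..x} then f y else 0)"
    unfolding prim_def ind_def inner_cls[OF f L2_indicator] ip2_def
    by (intro integral_cong) (auto simp: indicator_def)
  also have "\<dots> = integral ({0..x} \<inter> {0..pi}) f" by (rule integral_restrict_Int)
  also have "{0..x} \<inter> {0..pi} = {0..x}" using x by auto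
  finally show ?thesis by simp
qed

lemma L2_integrable_on:
  assumes "L2 f"
  shows "f integrable_on {0..pi}"
proof (rule integrable_on_lebesgue_on)
  show "integrable lebI f" using L2_mult_integrable[OF assms L2_const[of 1]] by simp
qed simp

lemma prim_continuous: "continuous_on {0..pi} (prim q)"
proof -
  have "continuous_on {0..pi} (\<lambda>x. integral {0..x} (rep q))"
    by (intro indefinite_integral_continuous_1 L2_integrable_on) simp
  moreover have "integral {0..x} (rep q) = prim q x" if "x \<in> {0..pi}" for x
    using integral_eq_prim[OF L2_rep that] by simp
  ultimately show ?thesis by (rule continuous_on_eq)
qed

lemma L2_prim: "L2 (prim q)" by (rule L2_continuous[OF prim_continuous])

lemma prim_linear: "prim (p + q) x = prim p x + prim q x" "prim (r *\<^sub>R p) x = r * prim p x"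
  "prim (p - q) x = prim p x - prim q x" "prim 0 x = 0"
  by (simp_all add: prim_def inner_add_left inner_diff_left)

lemma prim_0 [simp]: "prim q 0 = 0"
proof -
  have "integral {0..0} (rep q) = prim (cls (rep q)) 0" by (rule integral_eq_prim) auto
  then show ?thesis by simp
qed

lemma norm_ind: "norm (ind x) \<le> sqrt pi"
proof -
  have "norm (ind x) \<le> sqrt pi * 1"
    unfolding ind_def by (rule norm_cls_bound[OF L2_indicator]) (simp add: indicator_def)
  then show ?thesis by simp
qed

lemma prim_bound: "\<bar>prim q x\<bar> \<le> norm q * sqrt pi"
  unfolding prim_def
  by (rule order_trans[OF Cauchy_Schwarz_ineq2 mult_left_mono[OF norm_ind norm_ge_zero]])

lemma Ip_bounded_linear: "bounded_linear Ip"
proof (rule bounded_linear_intro)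
  fix p q :: l2 and r :: real
  have "prim (p + q) = (\<lambda>x. prim p x + prim q x)" "prim (r *\<^sub>R p) = (\<lambda>x. r * prim p x)"
    by (auto simp: prim_linear)
  then show "Ip (p + q) = Ip p + Ip q" "Ip (r *\<^sub>R p) = r *\<^sub>R Ip p"
    by (simp_all add: Ip_def cls_add cls_scale L2_prim)
  show "norm (Ip q) \<le> norm q * (sqrt pi * sqrt pi)"
    unfolding Ip_def using norm_cls_bound[OF L2_prim prim_bound, of q] by (simp only: mult_ac)
qed

section \<open>Density of polynomials\<close>

lemma L2_convergence:
  assumes f: "L2 f" and g: "\<And>n. L2 (g n)" and w: "integrable lebI w"
    and lim: "AE x in lebI. (\<lambda>n. g n x) \<longlonglongrightarrow> f x"
    and dom: "\<And>n. AE x in lebI. (g n x - f x)\<^sup>2 \<le> w x"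
  shows "(\<lambda>n. cls (g n)) \<longlonglongrightarrow> cls f"
proof -
  have L: "L2 (\<lambda>x. g n x - f x)" for n by (intro L2_diff g f)
  have "(\<lambda>n. LINT x|lebI. (g n x - f x)\<^sup>2) \<longlonglongrightarrow> (LINT x|lebI. 0)"
  proof (rule integral_dominated_convergence[where w=w])
    show "(\<lambda>x. (g n x - f x)\<^sup>2) \<in> borel_measurable lebI" for n using L[of n] by (auto simp: L2_iff)
    show "AE x in lebI. (\<lambda>n. (g n x - f x)\<^sup>2) \<longlonglongrightarrow> 0"
      using lim
    proof eventually_elim
      case (elim x)
      then have "(\<lambda>n. (g n x - f x)\<^sup>2) \<longlonglongrightarrow> (f x - f x)\<^sup>2" by (intro tendsto_intros)
      then show ?case by simp
    qed
    show "AE x in lebI. norm ((g n x - f x)\<^sup>2) \<le> w x" for n using dom[of n] by simp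
  qed (use w in auto)
  then have "(\<lambda>n. (norm (cls (g n) - cls f))\<^sup>2) \<longlonglongrightarrow> 0"
    using norm_cls_sq[OF L] by (simp add: cls_diff[OF g f])
  then have "(\<lambda>n. sqrt ((norm (cls (g n) - cls f))\<^sup>2)) \<longlonglongrightarrow> sqrt 0" by (intro tendsto_intros)
  then show ?thesis by (simp add: LIM_zero_iff tendsto_norm_zero_iff)
qed

lemma polynomial_continuous:
  "real_polynomial_function p \<Longrightarrow> continuous_on S p" for p :: "real \<Rightarrow> real"
  by (rule continuous_on_polymonial_function) (simp add: real_polynomial_function_eq)

text \<open>The closure of the polynomials is enlarged in three stages: it contains the continuous
  functions by Stone-Weierstrass, then the bounded ones by dominated convergence, then everything by
  truncation.\<close>

lemma polynomials_dense: "\<exists>p. (\<forall>n. real_polynomial_function (p n)) \<and> (\<lambda>n. cls (p n)) \<longlonglongrightarrow> q"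
proof -
  define X where "X = closure {cls p |p. real_polynomial_function p}"
  have Xc: "closed X" by (simp add: X_def)
  have cont: "cls c \<in> X" if c: "continuous_on {0..pi} c" for c
    unfolding X_def closure_approachable
  proof (intro allI impI)
    fix e :: real assume e: "e > 0"
    then have "e / (2 * sqrt pi) > 0" by simp
    then obtain p where p: "real_polynomial_function p" "\<And>x. x \<in> {0..pi} \<Longrightarrow> \<bar>c x - p x\<bar> < e / (2 * sqrt pi)"
      using Stone_Weierstrass_real_polynomial_function[OF _ c] compact_Icc by metis
    have pc: "continuous_on {0..pi} p" by (rule polynomial_continuous[OF p(1)])
    have "norm (cls (\<lambda>x. c x - p x)) \<le> sqrt pi * (e / (2 * sqrt pi))"
      by (rule norm_cls_bound[OF L2_continuous]) (auto intro!: continuous_intros c pc less_imp_le p(2))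
    also have "\<dots> < e" using e by simp
    finally have "dist (cls p) (cls c) < e"
      by (simp add: cls_diff L2_continuous c pc dist_norm norm_minus_commute)
    then show "\<exists>y\<in>{cls p |p. real_polynomial_function p}. dist y (cls c) < e" using p(1) by blast
  qed
  have bdd: "cls f \<in> X" if f: "L2 f" and K: "\<And>x. \<bar>f x\<bar> \<le> K" for f K
  proof -
    from f obtain N g where N: "negligible N" and g: "\<And>n. continuous_on UNIV (g n)"
      and lim: "\<And>x. x \<notin> N \<Longrightarrow> (\<lambda>n. g n x) \<longlonglongrightarrow> (if x \<in> {0..pi} then f x else 0)"
      unfolding L2_def measurable_on_def by blast
    \<comment> \<open>Measurability supplies continuous functions converging off a negligible set.
      Clipping them to the range of \<open>f\<close> keeps the limit and provides the dominating
      constant \<open>(2 * K)\<^sup>2\<close>.\<close>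
    define h where "h n x = max (- K) (min K (g n x))" for n x
    have K0: "K \<ge> 0" using K[of 0] by linarith
    have hc: "continuous_on {0..pi} (h n)" for n
      unfolding h_def by (intro continuous_intros continuous_on_subset[OF g]) auto
    have "(\<lambda>n. cls (h n)) \<longlonglongrightarrow> cls f"
    proof (rule L2_convergence[OF f, where w="\<lambda>x. (2 * K)\<^sup>2"])
      show "L2 (h n)" for n by (rule L2_continuous[OF hc])
      show "integrable lebI (\<lambda>x. (2 * K)\<^sup>2)" by (rule finite_measure.integrable_const[OF finite_measure_lebI])
      have "AE x in lebesgue. x \<notin> N"
        using N by (auto simp: negligible_iff_null_sets intro: AE_not_in)
      then have "AE x in lebI. x \<notin> N" by (subst AE_restrict_space_iff) auto
      then show "AE x in lebI. (\<lambda>n. h n x) \<longlonglongrightarrow> f x"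
      proof (rule AE_mp, intro AE_I2 impI)
        fix x assume x: "x \<in> space lebI" "x \<notin> N"
        then have "(\<lambda>n. g n x) \<longlonglongrightarrow> f x" using lim[of x] by simp
        then have "(\<lambda>n. h n x) \<longlonglongrightarrow> max (- K) (min K (f x))" unfolding h_def by (intro tendsto_intros)
        then show "(\<lambda>n. h n x) \<longlonglongrightarrow> f x" using K[of x] by (simp add: abs_le_iff max_def min_def split: if_splits)
      qed
      show "AE x in lebI. (h n x - f x)\<^sup>2 \<le> (2 * K)\<^sup>2" for n
      proof (rule AE_I2)
        fix x
        have "\<bar>h n x\<bar> \<le> K" using K0 by (auto simp: h_def)
        then have "\<bar>h n x - f x\<bar> \<le> \<bar>2 * K\<bar>" using K[of x] by linarith
        then show "(h n x - f x)\<^sup>2 \<le> (2 * K)\<^sup>2" by (simp only: abs_le_square_iff)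
      qed
    qed
    then show ?thesis using closed_sequentially[OF Xc, of "\<lambda>n. cls (h n)"] cont[OF hc] by auto
  qed
  have all: "q \<in> X"
  proof -
    define h where "h n x = max (- real n) (min (real n) (rep q x))" for n x
    have hL: "L2 (h n)" for n
    proof (rule L2_cong_AE[OF L2_bounded_mult[OF L2_const[of 1]]])
      show m: "h n \<in> borel_measurable lebI" unfolding h_def
        by (intro borel_measurable_max borel_measurable_min borel_measurable_const L2_measurable L2_rep)
      show "h n \<in> borel_measurable lebI" by (rule m)
      show "\<bar>h n x\<bar> \<le> real n" for x by (auto simp: h_def)
    qed simp
    have "(\<lambda>n. cls (h n)) \<longlonglongrightarrow> cls (rep q)"
    proof (rule L2_convergence[OF L2_rep hL, where w="\<lambda>x. (rep q x)\<^sup>2"])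
      show "integrable lebI (\<lambda>x. (rep q x)\<^sup>2)" using L2_rep[of q] by (simp add: L2_iff)
      show "AE x in lebI. (\<lambda>n. h n x) \<longlonglongrightarrow> rep q x"
      proof (rule AE_I2)
        fix x
        obtain N :: nat where N: "\<bar>rep q x\<bar> \<le> real N" using real_arch_simple by blast
        have "\<forall>n\<ge>N. h n x = rep q x" using N by (auto simp: h_def)
        then show "(\<lambda>n. h n x) \<longlonglongrightarrow> rep q x"
          by (intro tendsto_eventually) (auto simp: eventually_sequentially)
      qed
      show "AE x in lebI. (h n x - rep q x)\<^sup>2 \<le> (rep q x)\<^sup>2" for n
      proof (rule AE_I2)
        fix x
        have "\<bar>h n x - rep q x\<bar> \<le> \<bar>rep q x\<bar>" by (auto simp: h_def)
        then show "(h n x - rep q x)\<^sup>2 \<le> (rep q x)\<^sup>2" by (simp only: abs_le_square_iff)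
      qed
    qed
    moreover have "cls (h n) \<in> X" for n by (rule bdd[OF hL, of n "real n"]) (auto simp: h_def)
    ultimately show ?thesis using closed_sequentially[OF Xc, of "\<lambda>n. cls (h n)"] by auto
  qed
  from all obtain u where u: "\<And>n. u n \<in> {cls p |p. real_polynomial_function p}" "u \<longlonglongrightarrow> q"
    unfolding X_def closure_sequential by blast
  then have "\<forall>n. \<exists>p. real_polynomial_function p \<and> u n = cls p" by blast
  then obtain p where "\<And>n. real_polynomial_function (p n)" "\<And>n. u n = cls (p n)" by metis
  moreover from this(2) have "u = (\<lambda>n. cls (p n))" by auto
  ultimately show ?thesis using u(2) by auto
qed

lemma inner_polynomial_eq_0:
  assumes "\<And>p :: real \<Rightarrow> real. real_polynomial_function p \<Longrightarrow> q \<bullet> cls p = 0"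
  shows "q = 0"
proof -
  obtain p where p: "\<And>n. real_polynomial_function (p n)" "(\<lambda>n. cls (p n)) \<longlonglongrightarrow> q"
    using polynomials_dense by blast
  have "(\<lambda>n. q \<bullet> cls (p n)) \<longlonglongrightarrow> q \<bullet> q" by (intro tendsto_intros p(2))
  then have "q \<bullet> q = 0" using assms p(1) by (simp add: LIMSEQ_const_iff)
  then show ?thesis by simp
qed

section \<open>The product rule, and uniqueness of weak derivatives\<close>

lemma prim_cls_derivative:
  assumes f: "continuous_on {0..pi} f" and x: "x \<in> {0..pi}"
  shows "(prim (cls f) has_real_derivative f x) (at x within {0..pi})"
proof -
  have "((\<lambda>u. integral {0..u} f) has_vector_derivative f x) (at x within {0..pi})"
    by (rule integral_has_vector_derivative[OF f x])
  then have "(prim (cls f) has_vector_derivative f x) (at x within {0..pi})"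
    by (rule has_vector_derivative_transform[rotated 2])
       (use x in \<open>auto simp: integral_eq_prim L2_continuous f\<close>)
  then show ?thesis by (simp add: has_real_derivative_iff_has_vector_derivative)
qed

lemma prim_of_derivative:
  assumes "\<And>y. y \<in> {0..pi} \<Longrightarrow> (F has_real_derivative f y) (at y within {0..pi})"
    and f: "continuous_on {0..pi} f" and x: "x \<in> {0..pi}"
  shows "prim (cls f) x = F x - F 0"
proof -
  have "(f has_integral F x - F 0) {0..x}"
  proof (rule fundamental_theorem_of_calculus)
    fix y assume "y \<in> {0..x}"
    then have "(F has_real_derivative f y) (at y within {0..x})"
      using x by (intro DERIV_subset[OF assms(1)]) auto
    then show "(F has_vector_derivative f y) (at y within {0..x})"
      by (simp add: has_real_derivative_iff_has_vector_derivative)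
  qed (use x in simp)
  then show ?thesis using integral_eq_prim[OF L2_continuous[OF f] x] integral_unique by metis
qed

text \<open>For continuous \<open>q\<close> this is the fundamental theorem of calculus, and both sides are continuous in \<open>q\<close>.\<close>

lemma prim_product:
  assumes c: "\<And>x. x \<in> {0..pi} \<Longrightarrow> (c has_real_derivative c' x) (at x within {0..pi})"
    and c': "continuous_on {0..pi} c'" and x: "x \<in> {0..pi}"
  shows "prim (Mul c q + Mul c' (Ip q)) x = c x * prim q x"
proof -
  have cc: "continuous_on {0..pi} c" using c by (rule DERIV_continuous_on)
  interpret m: bounded_linear "Mul c" by (rule Mul_bounded_linear[OF cc])
  interpret m': bounded_linear "Mul c'" by (rule Mul_bounded_linear[OF c'])
  interpret I: bounded_linear Ip by (rule Ip_bounded_linear)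
  obtain p where p: "\<And>n. real_polynomial_function (p n)" "(\<lambda>n. cls (p n)) \<longlonglongrightarrow> q"
    using polynomials_dense by blast
  have eq: "prim (Mul c (cls (p n)) + Mul c' (Ip (cls (p n)))) x = c x * prim (cls (p n)) x" for n
  proof -
    have pc: "continuous_on {0..pi} (p n)" by (rule polynomial_continuous[OF p(1)])
    have "Mul c (cls (p n)) + Mul c' (Ip (cls (p n))) = cls (\<lambda>x. c x * p n x + c' x * prim (cls (p n)) x)"
      by (simp add: Ip_def Mul_cls cc c' L2_continuous pc L2_prim cls_add L2_continuous_mult)
    also have "prim \<dots> x = c x * prim (cls (p n)) x - c 0 * prim (cls (p n)) 0"
    proof (rule prim_of_derivative[OF _ _ x])
      show "continuous_on {0..pi} (\<lambda>x. c x * p n x + c' x * prim (cls (p n)) x)"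
        by (intro continuous_intros cc pc c' prim_continuous)
      fix y assume y: "y \<in> {0..pi}"
      show "((\<lambda>x. c x * prim (cls (p n)) x) has_real_derivative c y * p n y + c' y * prim (cls (p n)) y) (at y within {0..pi})"
        using DERIV_mult[OF c[OF y] prim_cls_derivative[OF pc y]] by (simp add: mult_ac add.commute)
    qed
    finally show ?thesis by simp
  qed
  have "(\<lambda>n. prim (Mul c (cls (p n)) + Mul c' (Ip (cls (p n)))) x) \<longlonglongrightarrow> prim (Mul c q + Mul c' (Ip q)) x"
    unfolding prim_def by (intro tendsto_intros m.tendsto m'.tendsto I.tendsto p(2))
  moreover have "(\<lambda>n. c x * prim (cls (p n)) x) \<longlonglongrightarrow> c x * prim q x"
    unfolding prim_def by (intro tendsto_intros p(2))
  ultimately show ?thesis unfolding eq by (rule LIMSEQ_unique)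
qed

lemma ind_pi: "ind pi = cls (\<lambda>x. 1)"
  unfolding ind_def by (rule cls_eqI[OF L2_indicator]) (simp add: indicator_def)

text \<open>Integration by parts against a polynomial: when the primitive of \<open>q\<close>
  vanishes, \<open>prim_product\<close> at \<open>pi\<close> shows that \<open>q\<close> is
  orthogonal to the polynomial. Density then replaces Lebesgue's differentiation theorem.\<close>

lemma prim_eq_0:
  assumes q: "\<And>x. x \<in> {0..pi} \<Longrightarrow> prim q x = 0"
  shows "q = 0"
proof (rule inner_polynomial_eq_0)
  fix p :: "real \<Rightarrow> real" assume p: "real_polynomial_function p"
  then obtain p' where p': "real_polynomial_function p'" "\<And>x. (p has_real_derivative p' x) (at x)"
    using has_real_derivative_polynomial_function by blast
  have "Ip q = cls (\<lambda>x. 0)" unfolding Ip_def by (rule cls_eqI[OF L2_prim]) (use q in simp)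
  also have "\<dots> = 0" by (simp add: zero_l2_def)
  finally have I: "Ip q = 0" .
  have c': "continuous_on {0..pi} p'" by (rule polynomial_continuous[OF p'(1)])
  have pc: "continuous_on {0..pi} p" by (rule polynomial_continuous[OF p])
  have "prim (Mul p q + Mul p' (Ip q)) pi = p pi * prim q pi"
    by (rule prim_product[OF _ c']) (auto intro: p'(2) has_field_derivative_at_within)
  then have "Mul p q \<bullet> ind pi = 0"
    using q[of pi] bounded_linear.linear[OF Mul_bounded_linear[OF c']] by (simp add: I prim_def linear_0)
  then have "q \<bullet> Mul p (cls (\<lambda>x. 1)) = 0" by (simp add: Mul_self_adjoint[OF pc] ind_pi)
  then show "q \<bullet> cls p = 0" by (simp add: Mul_cls pc L2_const)
qed

lemma continuous_cls_eq_0: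
  assumes f: "continuous_on {0..pi} f" and "cls f = 0" and x: "x \<in> {0..pi}"
  shows "f x = 0"
proof -
  have "cls f \<bullet> cls f = 0" using assms by simp
  then have "integral {0..pi} (\<lambda>x. f x * f x) = 0" by (simp add: inner_cls L2_continuous f ip2_def)
  moreover have "continuous_on {0..pi} (\<lambda>x. f x * f x)" by (intro continuous_intros f)
  ultimately have "\<forall>x\<in>{0..pi}. f x * f x = 0" using integral_eq_0_iff[of 0 pi "\<lambda>x. f x * f x"] by simp
  then show ?thesis using x by simp
qed

section \<open>Sobolev spaces\<close>

text \<open>\<open>J\<close> reconstructs a function from its derivative \<open>d u\<close>, which ranges over \<open>K\<close>.\<close>

locale sobolev =
  fixes P :: "(real \<Rightarrow> real) \<Rightarrow> bool" and d :: "(real \<Rightarrow> real) \<Rightarrow> real \<Rightarrow> real"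
    and J :: "l2 \<Rightarrow> real \<Rightarrow> real" and K :: "l2 set"
  assumes K_subspace: "subspace K" and K_closed: "closed K"
    and J_unique: "\<And>q u. q \<in> K \<Longrightarrow> (\<And>x. x \<in> {0..pi} \<Longrightarrow> u x = J q x) \<Longrightarrow> P u \<and> cls (d u) = q"
    and P_rep: "\<And>u. P u \<Longrightarrow> L2 (d u) \<and> cls (d u) \<in> K \<and> (\<forall>x\<in>{0..pi}. u x = J (cls (d u)) x)"
    and J_add: "\<And>p q x. J (p + q) x = J p x + J q x"
    and J_scale: "\<And>r p x. J (r *\<^sub>R p) x = r * J p x"
    and J_continuous: "\<And>q. continuous_on {0..pi} (J q)"
    and J_bound: "\<exists>C. \<forall>q. \<forall>x\<in>{0..pi}. \<bar>J q x\<bar> \<le> norm q * C"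
    and P_polynomial: "\<And>w. real_polynomial_function w \<Longrightarrow> w 0 = 0 \<Longrightarrow> w pi = 0 \<Longrightarrow> P w"
begin

definition D :: "(real \<Rightarrow> real) \<Rightarrow> l2" where "D u = cls (d u)"

definition j :: "l2 \<Rightarrow> l2" where "j q = cls (J q)"

lemma L2_d: "P u \<Longrightarrow> L2 (d u)" using P_rep by blast

lemma D_K: "P u \<Longrightarrow> D u \<in> K" using P_rep by (simp add: D_def)

lemma P_J: "P u \<Longrightarrow> x \<in> {0..pi} \<Longrightarrow> u x = J (D u) x" using P_rep by (simp add: D_def)

lemma J_P: "q \<in> K \<Longrightarrow> P (J q)" "q \<in> K \<Longrightarrow> D (J q) = q"
  using J_unique[of q "J q"] by (auto simp: D_def)

lemma L2_J: "L2 (J q)" by (rule L2_continuous[OF J_continuous])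

lemma P_cong:
  assumes "P u" "\<And>x. x \<in> {0..pi} \<Longrightarrow> u x = v x"
  shows "P v" "D v = D u"
  using J_unique[OF D_K[OF assms(1)], of v] P_J[OF assms(1)] assms(2) by (auto simp: D_def)

lemma P_L2: "P u \<Longrightarrow> L2 u"
  using L2_cong[OF L2_J[of "D u"]] P_J by metis

lemma cls_P: "P u \<Longrightarrow> cls u = j (D u)"
  unfolding j_def using P_J by (intro cls_eqI) (auto intro: P_L2)

lemma j_bounded_linear: "bounded_linear j"
proof -
  obtain C where C: "\<And>q x. x \<in> {0..pi} \<Longrightarrow> \<bar>J q x\<bar> \<le> norm q * C" using J_bound by blast
  show ?thesis
  proof (rule bounded_linear_intro)
    fix p q :: l2 and r :: real
    have "J (p + q) = (\<lambda>x. J p x + J q x)" "J (r *\<^sub>R p) = (\<lambda>x. r * J p x)"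
      by (auto simp: J_add J_scale)
    then show "j (p + q) = j p + j q" "j (r *\<^sub>R p) = r *\<^sub>R j p"
      by (simp_all add: j_def cls_add cls_scale L2_J)
    show "norm (j q) \<le> norm q * (sqrt pi * C)"
      unfolding j_def using norm_cls_bound[OF L2_J C, of q] by (simp add: mult_ac)
  qed
qed

lemma P_linear:
  assumes u: "P u" and v: "P v"
  shows "P (\<lambda>x. a * u x + b * v x)" "D (\<lambda>x. a * u x + b * v x) = a *\<^sub>R D u + b *\<^sub>R D v"
proof -
  have K: "a *\<^sub>R D u + b *\<^sub>R D v \<in> K"
    using D_K[OF u] D_K[OF v] K_subspace by (simp add: subspace_add subspace_scale)
  have "a * u x + b * v x = J (a *\<^sub>R D u + b *\<^sub>R D v) x" if "x \<in> {0..pi}" for x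
    using P_J[OF u that] P_J[OF v that] by (simp add: J_add J_scale)
  from J_unique[OF K this] show "P (\<lambda>x. a * u x + b * v x)" "D (\<lambda>x. a * u x + b * v x) = a *\<^sub>R D u + b *\<^sub>R D v"
    by (auto simp: D_def)
qed

lemma P_diff:
  assumes "P u" "P v"
  shows "P (\<lambda>x. u x - v x)" "D (\<lambda>x. u x - v x) = D u - D v"
  using P_linear[OF assms, of 1 "-1"] by simp_all

lemma sqrt_ip2_d: "P u \<Longrightarrow> sqrt (ip2 (d u) (d u)) = norm (D u)"
  by (simp add: norm_eq_sqrt_inner D_def inner_cls L2_d)

lemma j_inj:
  assumes q: "q \<in> K" and z: "j q = 0"
  shows "q = 0"
proof -
  have z0: "J q x = 0" if "x \<in> {0..pi}" for x
    by (rule continuous_cls_eq_0[OF J_continuous _ that]) (use z in \<open>simp add: j_def\<close>)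
  have "0 \<in> K" by (rule subspace_0[OF K_subspace])
  moreover have "J 0 x = 0" for x using J_scale[of 0 0 x] by simp
  ultimately have "cls (d (J q)) = 0" using J_unique[of 0 "J q"] z0 by simp
  then show ?thesis using J_P(2)[OF q] by (simp add: D_def)
qed

text \<open>Density of the test space in L2. Multiplying any polynomial by
  \<open>x * (pi - x)\<close> makes it admissible, so this weight times \<open>h\<close> is
  orthogonal to all polynomials; the weight vanishes only at the two endpoints, a null set.\<close>

lemma orthogonal_P_eq_0:
  assumes h: "\<And>w. P w \<Longrightarrow> h \<bullet> cls w = 0"
  shows "h = 0"
proof -
  define b :: "real \<Rightarrow> real" where "b x = x * (pi - x)" for x
  have bc: "continuous_on {0..pi} b" unfolding b_def by (intro continuous_intros)
  have id: "real_polynomial_function (\<lambda>x::real. x)"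
    by (rule real_polynomial_function.intros(1)) (rule bounded_linear_ident)
  have "Mul b h = 0"
  proof (rule inner_polynomial_eq_0)
    fix p :: "real \<Rightarrow> real" assume p: "real_polynomial_function p"
    have "real_polynomial_function (\<lambda>x. b x * p x)"
      unfolding b_def
      by (intro real_polynomial_function.intros(2,4) real_polynomial_function_diff id p)
    then have "h \<bullet> cls (\<lambda>x. b x * p x) = 0" by (intro h P_polynomial) (auto simp: b_def)
    then show "Mul b h \<bullet> cls p = 0"
      by (simp add: Mul_self_adjoint bc Mul_cls L2_continuous polynomial_continuous p)
  qed
  then have "cls (\<lambda>x. b x * rep h x) = cls (\<lambda>x. 0)" by (simp add: Mul_def zero_l2_def)
  then have "AE x in lebI. b x * rep h x = 0"
    by (simp add: cls_eq_iff L2_continuous_mult bc L2_const)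
  moreover have "AE x in lebI. x \<notin> {0, pi}"
  proof -
    have "AE x in lebesgue. x \<notin> {0, pi}"
      by (rule AE_not_in) (simp add: negligible_iff_null_sets[symmetric])
    then show ?thesis by (subst AE_restrict_space_iff) auto
  qed
  ultimately have "AE x in lebI. rep h x = 0"
    by eventually_elim (auto simp: b_def)
  then have "cls (rep h) = cls (\<lambda>x. 0)" by (subst cls_eq_iff) (simp_all add: L2_const)
  then show ?thesis by (simp add: zero_l2_def)
qed

end

section \<open>The space with one derivative\<close>

text \<open>A primitive vanishes at 0 by itself, so the only condition on the derivative is the one
  at \<open>pi\<close>: zero mean. The choice made inside \<open>d1\<close> is harmless by
  \<open>prim_eq_0\<close>, since derivatives with the same primitive define the same class.\<close>

interpretation H10: sobolev H10 d1 prim "{q. prim q pi = 0}"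
proof
  have J: "H10 u \<and> L2 (d1 u) \<and> cls (d1 u) = q" if q: "prim q pi = 0" and u: "\<And>x. x \<in> {0..pi} \<Longrightarrow> u x = prim q x" for q u
  proof -
    have i: "L2 (rep q) \<and> (\<forall>x\<in>{0..pi}. u x = u 0 + integral {0..x} (rep q))"
      using u[of 0] u by (auto simp: integral_eq_prim)
    then have s: "L2 (d1 u) \<and> (\<forall>x\<in>{0..pi}. u x = u 0 + integral {0..x} (d1 u))"
      unfolding d1_def by (rule someI[where P="\<lambda>g. L2 g \<and> (\<forall>x\<in>{0..pi}. u x = u 0 + integral {0..x} g)"])
    have "H10 u" unfolding H10_def
    proof
      show "\<exists>g. L2 g \<and> (\<forall>x\<in>{0..pi}. u x = integral {0..x} g)"
        using i u[of 0] by (intro exI[of _ "rep q"]) simp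
      show "u pi = 0" using u[of pi] q by simp
    qed
    moreover have "cls (d1 u) - q = 0"
    proof (rule prim_eq_0)
      fix x assume x: "x \<in> {0..pi}"
      show "prim (cls (d1 u) - q) x = 0"
        using s x u[OF x] u[of 0] by (simp add: prim_linear integral_eq_prim)
    qed
    ultimately show ?thesis using s by simp
  qed
  show "subspace {q. prim q pi = 0}" by (auto simp: subspace_def prim_linear)
  show "closed {q. prim q pi = 0}" unfolding prim_def by (intro closed_Collect_eq continuous_intros)
  show "q \<in> {q. prim q pi = 0} \<Longrightarrow> (\<And>x. x \<in> {0..pi} \<Longrightarrow> u x = prim q x) \<Longrightarrow> H10 u \<and> cls (d1 u) = q" for q u
    using J by simp
  show "L2 (d1 u) \<and> cls (d1 u) \<in> {q. prim q pi = 0} \<and> (\<forall>x\<in>{0..pi}. u x = prim (cls (d1 u)) x)" if "H10 u" for u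
  proof -
    from that obtain g where g: "L2 g" "\<And>x. x \<in> {0..pi} \<Longrightarrow> u x = integral {0..x} g" "u pi = 0"
      unfolding H10_def by blast
    then have u: "u x = prim (cls g) x" if "x \<in> {0..pi}" for x using that by (simp add: integral_eq_prim)
    then have "prim (cls g) pi = 0" using g(3) u[of pi] by simp
    from J[OF this u] this u show ?thesis by simp
  qed
  show "prim (p + q) x = prim p x + prim q x" "prim (r *\<^sub>R p) x = r * prim p x" for p q x r
    by (simp_all add: prim_linear)
  show "continuous_on {0..pi} (prim q)" for q by (rule prim_continuous)
  show "\<exists>C. \<forall>q. \<forall>x\<in>{0..pi}. \<bar>prim q x\<bar> \<le> norm q * C" using prim_bound by blast
  fix w :: "real \<Rightarrow> real" assume w: "real_polynomial_function w" "w 0 = 0" "w pi = 0"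
  then obtain w' where w': "real_polynomial_function w'" "\<And>x. (w has_real_derivative w' x) (at x)"
    using has_real_derivative_polynomial_function by blast
  have p: "prim (cls w') x = w x" if "x \<in> {0..pi}" for x
    using prim_of_derivative[OF has_field_derivative_at_within[OF w'(2)] polynomial_continuous[OF w'(1)] that] w(2) by simp
  then show "H10 w" using J[of "cls w'" w] w(3) p[of pi] by simp
qed

section \<open>The space with two derivatives\<close>

text \<open>The solution operator of \<open>u'' = q\<close> with zero boundary values: the double
  primitive minus the linear function that agrees with it at both ends. Both conditions are met for
  every \<open>q\<close>, so the second derivative is unconstrained.\<close>

definition J2 :: "l2 \<Rightarrow> real \<Rightarrow> real" where
  "J2 q x = prim (Ip q) x - prim (Ip q) pi / pi * x"

lemma prim_one: "x \<in> {0..pi} \<Longrightarrow> prim (cls (\<lambda>x. 1)) x = x"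
  using integral_eq_prim[OF L2_const, of x 1] by simp

text \<open>\<open>k\<close> is the unknown initial slope; the boundary condition at
  \<open>pi\<close> determines it.\<close>

lemma J2_eqI:
  assumes u: "\<And>x. x \<in> {0..pi} \<Longrightarrow> u x = prim (k *\<^sub>R cls (\<lambda>x. 1) + Ip q) x" and "u pi = 0" and x: "x \<in> {0..pi}"
  shows "u x = J2 q x"
proof -
  have "k * pi + prim (Ip q) pi = 0" using u[of pi] assms(2) by (simp add: prim_linear prim_one)
  then have "k = - (prim (Ip q) pi / pi)" by (simp add: field_simps)
  then show ?thesis using u[OF x] x by (simp add: J2_def prim_linear prim_one)
qed

lemma cls_affine:
  assumes h: "L2 h" and g: "\<And>x. x \<in> {0..pi} \<Longrightarrow> g x = g 0 + integral {0..x} h"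
  shows "L2 g" "cls g = g 0 *\<^sub>R cls (\<lambda>x. 1) + Ip (cls h)"
proof -
  have L: "L2 (\<lambda>x. g 0 + prim (cls h) x)" by (intro L2_add L2_const L2_prim)
  have e: "g 0 + prim (cls h) x = g x" if "x \<in> {0..pi}" for x
    using g[OF that] integral_eq_prim[OF h that] by simp
  show "L2 g" by (rule L2_cong[OF L e])
  have "cls g = cls (\<lambda>x. g 0 + prim (cls h) x)" using cls_eqI[OF L e] by simp
  also have "\<dots> = cls (\<lambda>x. g 0 * 1) + cls (prim (cls h))" by (simp add: cls_add L2_const L2_prim)
  also have "cls (\<lambda>x. g 0 * 1) = g 0 *\<^sub>R cls (\<lambda>x. 1)" by (rule cls_scale[OF L2_const])
  finally show "cls g = g 0 *\<^sub>R cls (\<lambda>x. 1) + Ip (cls h)" by (simp add: Ip_def)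
qed

interpretation H2: sobolev H2 d2 J2 UNIV
proof
  interpret I: bounded_linear Ip by (rule Ip_bounded_linear)
  let ?one = "cls (\<lambda>x. 1)"
  have J: "H2 u \<and> L2 (d2 u) \<and> cls (d2 u) = q" if u: "\<And>x. x \<in> {0..pi} \<Longrightarrow> u x = J2 q x" for q u
  proof -
    \<comment> \<open>\<open>c\<close> is the mean of \<open>prim q\<close>, so that
      \<open>g\<close> has mean zero; \<open>g\<close> is the first derivative of
      \<open>J2 q\<close>.\<close>
    define c where "c = prim (Ip q) pi / pi"
    define g where "g x = prim q x - c" for x
    have gL: "L2 g" unfolding g_def by (intro L2_diff L2_prim L2_const)
    have gi: "g x = g 0 + integral {0..x} (rep q)" if "x \<in> {0..pi}" for x
      using that by (simp add: g_def integral_eq_prim)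
    have clsg: "cls g = (- c) *\<^sub>R ?one + Ip q" using cls_affine(2)[OF L2_rep gi] unfolding g_def by simp
    have up: "u x = prim (cls g) x" if x: "x \<in> {0..pi}" for x
      using u[OF x] x unfolding clsg by (simp add: J2_def prim_linear prim_one c_def)
    have u0: "u 0 = 0" using up[of 0] by simp
    have upi: "u pi = 0" using u[of pi] by (simp add: J2_def)
    have "H10 u" using H10.J_unique[of "cls g" u] up upi up[of pi] by simp
    moreover have ui: "u x = u 0 + integral {0..x} g" if "x \<in> {0..pi}" for x
      using up[OF that] u0 by (simp add: integral_eq_prim[OF gL that])
    have ex: "L2 (rep q) \<and> (\<exists>g. (\<forall>x\<in>{0..pi}. u x = u 0 + integral {0..x} g)
        \<and> (\<forall>x\<in>{0..pi}. g x = g 0 + integral {0..x} (rep q)))"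
      by (intro conjI exI[of _ g] ballI ui gi L2_rep)
    then have s: "L2 (d2 u) \<and> (\<exists>g. (\<forall>x\<in>{0..pi}. u x = u 0 + integral {0..x} g)
        \<and> (\<forall>x\<in>{0..pi}. g x = g 0 + integral {0..x} (d2 u)))"
      unfolding d2_def by (rule someI[where P="\<lambda>h. L2 h \<and> (\<exists>g. (\<forall>x\<in>{0..pi}. u x = u 0 + integral {0..x} g)
        \<and> (\<forall>x\<in>{0..pi}. g x = g 0 + integral {0..x} h))"])
    ultimately have "H2 u" unfolding H2_def using ex by blast
    from s obtain g' where g': "\<And>x. x \<in> {0..pi} \<Longrightarrow> u x = u 0 + integral {0..x} g'"
      "\<And>x. x \<in> {0..pi} \<Longrightarrow> g' x = g' 0 + integral {0..x} (d2 u)" and L: "L2 (d2 u)" by blast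
    note ca = cls_affine[OF L g'(2)]
    have "cls g' - cls g = 0"
    proof (rule prim_eq_0)
      fix x assume x: "x \<in> {0..pi}"
      show "prim (cls g' - cls g) x = 0"
        using up[OF x] g'(1)[OF x] u0 integral_eq_prim[OF ca(1) x] by (simp add: prim_linear)
    qed
    then have "cls g' = cls g" by simp
    then have "g' 0 *\<^sub>R ?one + Ip (cls (d2 u)) = (- c) *\<^sub>R ?one + Ip q" using ca(2) clsg by metis
    \<comment> \<open>A constant plus a primitive that vanishes as a class vanishes pointwise by
      continuity. Evaluation at 0 separates the constant from the primitive.\<close>
    then have e0: "(g' 0 + c) *\<^sub>R ?one + Ip (cls (d2 u) - q) = 0"
      by (simp add: I.diff algebra_simps)
    have e: "(g' 0 + c) + prim (cls (d2 u) - q) x = 0" if "x \<in> {0..pi}" for x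
    proof (rule continuous_cls_eq_0[OF _ _ that])
      show "continuous_on {0..pi} (\<lambda>x. (g' 0 + c) + prim (cls (d2 u) - q) x)"
        by (intro continuous_intros prim_continuous)
      have "cls (\<lambda>x. (g' 0 + c) + prim (cls (d2 u) - q) x) = cls (\<lambda>x. (g' 0 + c) * 1) + Ip (cls (d2 u) - q)"
        by (simp add: cls_add L2_const L2_prim Ip_def)
      also have "cls (\<lambda>x. (g' 0 + c) * 1) = (g' 0 + c) *\<^sub>R ?one" by (rule cls_scale[OF L2_const])
      finally show "cls (\<lambda>x. (g' 0 + c) + prim (cls (d2 u) - q) x) = 0" using e0 by simp
    qed
    have "g' 0 + c = 0" using e[of 0] by simp
    with e have "cls (d2 u) - q = 0" by (intro prim_eq_0) simp
    with \<open>H2 u\<close> L show ?thesis by simp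
  qed
  show "subspace (UNIV :: l2 set)" "closed (UNIV :: l2 set)" by auto
  show "(\<And>x. x \<in> {0..pi} \<Longrightarrow> u x = J2 q x) \<Longrightarrow> H2 u \<and> cls (d2 u) = q" for q u using J by blast
  show "L2 (d2 u) \<and> cls (d2 u) \<in> UNIV \<and> (\<forall>x\<in>{0..pi}. u x = J2 (cls (d2 u)) x)" if "H2 u" for u
  proof -
    from that obtain g h where gh: "H10 u" "L2 h" "\<And>x. x \<in> {0..pi} \<Longrightarrow> u x = u 0 + integral {0..x} g"
      "\<And>x. x \<in> {0..pi} \<Longrightarrow> g x = g 0 + integral {0..x} h"
      unfolding H2_def by blast
    have u0: "u 0 = 0" "u pi = 0" using gh(1) unfolding H10_def by auto
    note ca = cls_affine[OF gh(2) gh(4)]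
    have "u x = prim (g 0 *\<^sub>R ?one + Ip (cls h)) x" if "x \<in> {0..pi}" for x
      using gh(3)[OF that] u0 integral_eq_prim[OF ca(1) that] ca(2) by simp
    from J2_eqI[OF this u0(2)] have e: "u x = J2 (cls h) x" if "x \<in> {0..pi}" for x using that by simp
    from J[OF e] e show ?thesis by simp
  qed
  show "J2 (p + q) x = J2 p x + J2 q x" "J2 (r *\<^sub>R p) x = r * J2 p x" for p q x r
    by (simp_all add: J2_def I.add I.scaleR prim_linear add_divide_distrib algebra_simps)
  show "continuous_on {0..pi} (J2 q)" for q unfolding J2_def by (intro continuous_intros prim_continuous)
  show "\<exists>C. \<forall>q. \<forall>x\<in>{0..pi}. \<bar>J2 q x\<bar> \<le> norm q * C"
  proof -
    obtain C where C: "\<And>q. norm (Ip q) \<le> norm q * C" using I.bounded by blast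
    have b: "\<bar>prim (Ip q) y\<bar> \<le> norm q * (C * sqrt pi)" for q y
      using order_trans[OF prim_bound[of "Ip q" y] mult_right_mono[OF C[of q], of "sqrt pi"]] by (simp add: mult_ac)
    have "\<bar>J2 q x\<bar> \<le> norm q * (2 * (C * sqrt pi))" if x: "x \<in> {0..pi}" for q x
    proof -
      have "\<bar>prim (Ip q) pi / pi * x\<bar> = \<bar>prim (Ip q) pi\<bar> * (x / pi)" using x by (simp add: abs_mult)
      also have "\<dots> \<le> \<bar>prim (Ip q) pi\<bar> * 1" using x by (intro mult_left_mono) auto
      finally have "\<bar>J2 q x\<bar> \<le> \<bar>prim (Ip q) x\<bar> + \<bar>prim (Ip q) pi\<bar>" unfolding J2_def by linarith
      then show ?thesis using b[of q x] b[of q pi] by linarith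
    qed
    then show ?thesis by blast
  qed
  fix w :: "real \<Rightarrow> real" assume w: "real_polynomial_function w" "w 0 = 0" "w pi = 0"
  then obtain w' where w': "real_polynomial_function w'" "\<And>x. (w has_real_derivative w' x) (at x)"
    using has_real_derivative_polynomial_function by blast
  then obtain w'' where w'': "real_polynomial_function w''" "\<And>x. (w' has_real_derivative w'' x) (at x)"
    using has_real_derivative_polynomial_function by blast
  have p: "prim (cls w') x = w x" if "x \<in> {0..pi}" for x
    using prim_of_derivative[OF has_field_derivative_at_within[OF w'(2)] polynomial_continuous[OF w'(1)] that] w(2) by simp
  have L: "L2 w''" by (rule L2_continuous[OF polynomial_continuous[OF w''(1)]])
  have "w' x = w' 0 + integral {0..x} w''" if "x \<in> {0..pi}" for x
    using prim_of_derivative[OF has_field_derivative_at_within[OF w''(2)] polynomial_continuous[OF w''(1)] that]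
    by (simp add: integral_eq_prim[OF L that])
  from cls_affine(2)[OF L this] have "w x = prim (w' 0 *\<^sub>R ?one + Ip (cls w'')) x" if "x \<in> {0..pi}" for x
    using p[OF that] by simp
  from J2_eqI[OF this w(3)] show "H2 w" using J by blast
qed

section \<open>Weak and mild formulations of one equation\<close>

lemma tendsto_norm_0:
  fixes h :: "real \<Rightarrow> 'a::real_normed_vector"
  assumes "continuous_on {0..T} h" "t \<in> {0..T}"
  shows "((\<lambda>s. norm (h s - h t)) \<longlongrightarrow> 0) (at t within {0..T})"
proof -
  have "(h \<longlongrightarrow> h t) (at t within {0..T})" using assms by (simp add: continuous_on_def)
  then show ?thesis by (intro tendsto_norm_zero LIM_zero)
qed

text \<open>The definitions for the two dual spaces differ only in the test space and its
  derivative. With these as parameters, each passage between the formulations is proved once for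
  waves and beam alike.\<close>

definition gdual :: "((real \<Rightarrow> real) \<Rightarrow> bool) \<Rightarrow> ((real \<Rightarrow> real) \<Rightarrow> real \<Rightarrow> real) \<Rightarrow> ((real \<Rightarrow> real) \<Rightarrow> real) \<Rightarrow> bool" where
  "gdual P d \<phi> \<longleftrightarrow>
     (\<forall>u v a b. P u \<longrightarrow> P v \<longrightarrow> \<phi> (\<lambda>x. a * u x + b * v x) = a * \<phi> u + b * \<phi> v) \<and>
     (\<exists>C. \<forall>v. P v \<longrightarrow> \<bar>\<phi> v\<bar> \<le> C * sqrt (ip2 (d v) (d v)))"

definition gdnorm :: "((real \<Rightarrow> real) \<Rightarrow> bool) \<Rightarrow> ((real \<Rightarrow> real) \<Rightarrow> real \<Rightarrow> real) \<Rightarrow> ((real \<Rightarrow> real) \<Rightarrow> real) \<Rightarrow> real" where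
  "gdnorm P d \<phi> = Sup {\<bar>\<phi> v\<bar> | v. P v \<and> sqrt (ip2 (d v) (d v)) \<le> 1}"

definition greg :: "((real \<Rightarrow> real) \<Rightarrow> bool) \<Rightarrow> ((real \<Rightarrow> real) \<Rightarrow> real \<Rightarrow> real) \<Rightarrow> real
    \<Rightarrow> (real \<Rightarrow> real \<Rightarrow> real) \<Rightarrow> (real \<Rightarrow> real \<Rightarrow> real) \<Rightarrow> (real \<Rightarrow> (real \<Rightarrow> real) \<Rightarrow> real) \<Rightarrow> bool" where
  "greg P d T U V W \<longleftrightarrow>
    (\<forall>t\<in>{0..T}. P (U t)) \<and>
    (\<forall>t\<in>{0..T}. ((\<lambda>s. sqrt (ip2 (d (\<lambda>x. U s x - U t x)) (d (\<lambda>x. U s x - U t x)))) \<longlongrightarrow> 0) (at t within {0..T})) \<and>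
    (\<forall>t\<in>{0..T}. L2 (V t)) \<and>
    (\<forall>t\<in>{0..T}. ((\<lambda>s. norm2 (\<lambda>x. (U s x - U t x) / (s - t) - V t x)) \<longlongrightarrow> 0) (at t within {0..T})) \<and>
    (\<forall>t\<in>{0..T}. ((\<lambda>s. norm2 (\<lambda>x. V s x - V t x)) \<longlongrightarrow> 0) (at t within {0..T})) \<and>
    (\<forall>t\<in>{0..T}. gdual P d (W t)) \<and>
    (\<forall>t\<in>{0..T}. ((\<lambda>s. gdnorm P d (\<lambda>v. ip2 (\<lambda>x. (V s x - V t x) / (s - t)) v - W t v)) \<longlongrightarrow> 0)
                     (at t within {0..T})) \<and>
    (\<forall>t\<in>{0..T}. ((\<lambda>s. gdnorm P d (\<lambda>v. W s v - W t v)) \<longlongrightarrow> 0) (at t within {0..T}))"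

lemma reg1_greg: "reg1 T U V W = greg H10 d1 T U V W"
  unfolding reg1_def greg_def h1norm_def dualH1_def dnorm1_def gdual_def gdnorm_def ..

lemma reg2_greg: "reg2 T U V W = greg H2 d2 T U V W"
  unfolding reg2_def greg_def h2norm_def dualH2_def dnorm2_def gdual_def gdnorm_def ..

lemma greg_D: "greg P d T U V W \<Longrightarrow> t \<in> {0..T} \<Longrightarrow> P (U t) \<and> L2 (V t)"
  unfolding greg_def by blast

context sobolev
begin

lemma P_zero: "P (\<lambda>x. 0)" "D (\<lambda>x. 0) = 0"
proof -
  show z: "P (\<lambda>x. 0)" by (rule P_polynomial) (auto intro: real_polynomial_function.intros)
  show "D (\<lambda>x. 0) = 0" using P_linear(2)[OF z z, of 0 0] by simp
qed

lemma gdnorm_eq: "gdnorm P d \<phi> = Sup {\<bar>\<phi> v\<bar> | v. P v \<and> norm (D v) \<le> 1}"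
  unfolding gdnorm_def by (simp only: sqrt_ip2_d cong: conj_cong)

text \<open>A real supremum has to be bounded and over a nonempty set to be meaningful; the zero
  test function gives nonemptiness and, through an absolute value, the sign.\<close>

lemma gdnorm_le:
  assumes c: "0 \<le> c" and \<phi>: "\<And>w. P w \<Longrightarrow> \<bar>\<phi> w\<bar> \<le> c * norm (D w)"
  shows "0 \<le> gdnorm P d \<phi>" "gdnorm P d \<phi> \<le> c"
proof -
  let ?A = "{\<bar>\<phi> v\<bar> | v. P v \<and> norm (D v) \<le> 1}"
  have ub: "a \<le> c" if "a \<in> ?A" for a
  proof -
    from that obtain v where v: "a = \<bar>\<phi> v\<bar>" "P v" "norm (D v) \<le> 1" by blast
    have "a \<le> c * norm (D v)" using \<phi>[OF v(2)] v(1) by simp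
    also have "\<dots> \<le> c * 1" using c v(3) by (intro mult_left_mono)
    finally show ?thesis by simp
  qed
  have ne: "\<bar>\<phi> (\<lambda>x. 0)\<bar> \<in> ?A" using P_zero by auto
  show "gdnorm P d \<phi> \<le> c" unfolding gdnorm_eq by (rule cSup_least) (use ne ub in auto)
  have "\<bar>\<phi> (\<lambda>x. 0)\<bar> \<le> gdnorm P d \<phi>" unfolding gdnorm_eq
    by (rule cSup_upper[OF ne]) (use ub in \<open>auto intro!: bdd_aboveI\<close>)
  then show "0 \<le> gdnorm P d \<phi>" by linarith
qed

lemma gdnorm_bound:
  assumes \<phi>: "gdual P d \<phi>" and v: "P v"
  shows "\<bar>\<phi> v\<bar> \<le> gdnorm P d \<phi> * norm (D v)"
proof -
  from \<phi> obtain C where C: "\<And>v. P v \<Longrightarrow> \<bar>\<phi> v\<bar> \<le> C * norm (D v)"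
    unfolding gdual_def by (auto simp: sqrt_ip2_d)
  show ?thesis
  proof (cases "D v = 0")
    case True
    then show ?thesis using C[OF v] by simp
  next
    case False
    define n where "n = norm (D v)"
    have n: "n > 0" using False by (simp add: n_def)
    \<comment> \<open>Linearity in \<open>gdual\<close> is stated for combinations of two functions,
      hence the dummy second summand in this normalisation of \<open>v\<close>.\<close>
    let ?w = "\<lambda>x. (1 / n) * v x + 0 * v x"
    have w: "P ?w" "D ?w = (1 / n) *\<^sub>R D v" using P_linear[OF v v, of "1 / n" 0] by simp_all
    have \<phi>w: "\<phi> ?w = \<phi> v / n" using \<phi> v unfolding gdual_def by (metis add.right_neutral mult_zero_left times_divide_eq_left mult_1)
    have "norm (D ?w) = 1" unfolding w(2) using n by (simp add: n_def)
    then have m: "\<bar>\<phi> ?w\<bar> \<in> {\<bar>\<phi> v\<bar> | v. P v \<and> norm (D v) \<le> 1}"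
      using w(1) by (intro CollectI exI[of _ ?w]) simp
    have "\<bar>\<phi> ?w\<bar> \<le> gdnorm P d \<phi>" unfolding gdnorm_eq
    proof (rule cSup_upper[OF m], rule bdd_aboveI)
      fix a assume "a \<in> {\<bar>\<phi> v\<bar> | v. P v \<and> norm (D v) \<le> 1}"
      then obtain u where u: "a = \<bar>\<phi> u\<bar>" "P u" "norm (D u) \<le> 1" by blast
      have "a \<le> C * norm (D u)" using C[OF u(2)] u(1) by simp
      also have "\<dots> \<le> \<bar>C\<bar> * 1" using u(3) by (intro mult_mono) auto
      finally show "a \<le> \<bar>C\<bar>" by simp
    qed
    then have "\<bar>\<phi> v / n\<bar> \<le> gdnorm P d \<phi>" unfolding \<phi>w .
    then show ?thesis using n by (simp add: n_def[symmetric] field_simps)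
  qed
qed

end

text \<open>The second-order equation with density \<open>\<rho>\<close> and stiffness \<open>\<sigma>\<close>. The functional \<open>W = u\<^sub>t\<^sub>t\<close> pairs
  with the unweighted product, so it is tested with \<open>\<rho> w\<close>; hence multiplication and division by
  \<open>\<rho>\<close> must be bounded on the test space.\<close>

locale component = sobolev P d J K for P d J K +
  fixes \<sigma> \<rho> :: "real \<Rightarrow> real"
  assumes \<sigma>_c: "continuous_on {0..pi} \<sigma>" and \<sigma>_pos: "\<And>x. x \<in> {0..pi} \<Longrightarrow> \<sigma> x > 0"
    and \<rho>_c: "continuous_on {0..pi} \<rho>" and \<rho>_pos: "\<And>x. x \<in> {0..pi} \<Longrightarrow> \<rho> x > 0"
    and P_mult: "\<And>w. P w \<Longrightarrow> P (\<lambda>x. \<rho> x * w x)"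
    and P_div: "\<And>w. P w \<Longrightarrow> P (\<lambda>x. w x / \<rho> x)"
    and D_mult: "\<exists>C. \<forall>w. P w \<longrightarrow> norm (D (\<lambda>x. \<rho> x * w x)) \<le> C * norm (D w)"
    and D_div: "\<exists>C. \<forall>w. P w \<longrightarrow> norm (D (\<lambda>x. w x / \<rho> x)) \<le> C * norm (D w)"
begin

abbreviation "rs \<equiv> \<lambda>x. sqrt (\<sigma> x)"
abbreviation "rr \<equiv> \<lambda>x. sqrt (\<rho> x)"
abbreviation "irs \<equiv> \<lambda>x. 1 / sqrt (\<sigma> x)"
abbreviation "irr \<equiv> \<lambda>x. 1 / sqrt (\<rho> x)"

lemma weight_nonzero: "x \<in> {0..pi} \<Longrightarrow> rs x \<noteq> 0" "x \<in> {0..pi} \<Longrightarrow> rr x \<noteq> 0"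
  using \<sigma>_pos[of x] \<rho>_pos[of x] by auto

lemma rs_c: "continuous_on {0..pi} rs" by (intro continuous_intros \<sigma>_c)
lemma rr_c: "continuous_on {0..pi} rr" by (intro continuous_intros \<rho>_c)
lemma irs_c: "continuous_on {0..pi} irs" using weight_nonzero by (intro continuous_intros \<sigma>_c) auto
lemma irr_c: "continuous_on {0..pi} irr" using weight_nonzero by (intro continuous_intros \<rho>_c) auto

sublocale Mrs: bounded_linear "Mul rs" by (rule Mul_bounded_linear[OF rs_c])
sublocale Mrr: bounded_linear "Mul rr" by (rule Mul_bounded_linear[OF rr_c])
sublocale Mirs: bounded_linear "Mul irs" by (rule Mul_bounded_linear[OF irs_c])
sublocale Mirr: bounded_linear "Mul irr" by (rule Mul_bounded_linear[OF irr_c])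

lemma Mul_cancel: "Mul irs (Mul rs q) = q" "Mul rs (Mul irs q) = q" "Mul irr (Mul rr q) = q" "Mul rr (Mul irr q) = q"
  using Mul_inverse[OF rs_c weight_nonzero(1)] Mul_inverse[OF rr_c weight_nonzero(2)] by auto

lemma Mul_square: "Mul rs (Mul rs q) = Mul \<sigma> q" "Mul rr (Mul rr q) = Mul \<rho> q"
proof -
  have "Mul (\<lambda>x. rs x * rs x) q = Mul \<sigma> q"
    unfolding Mul_def using \<sigma>_pos less_imp_le
    by (intro cls_eqI L2_continuous_mult continuous_on_mult rs_c L2_rep) fastforce
  then show "Mul rs (Mul rs q) = Mul \<sigma> q" by (simp add: Mul_Mul rs_c)
  have "Mul (\<lambda>x. rr x * rr x) q = Mul \<rho> q"
    unfolding Mul_def using \<rho>_pos less_imp_le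
    by (intro cls_eqI L2_continuous_mult continuous_on_mult rr_c L2_rep) fastforce
  then show "Mul rr (Mul rr q) = Mul \<rho> q" by (simp add: Mul_Mul rr_c)
qed

definition KK :: "l2 set" where "KK = {q. Mul irs q \<in> K}"

lemma KK_subspace: "subspace KK"
  using K_subspace by (auto simp: KK_def subspace_def Mirs.zero Mirs.add Mirs.scaleR)

lemma KK_closed: "closed KK"
proof -
  have "closed (Mul irs -` K)"
    by (rule closed_vimage[OF K_closed Mirs.continuous_on[OF continuous_on_id]])
  then show ?thesis by (simp add: KK_def vimage_def)
qed

text \<open>Not every \<open>q\<close> is of the form \<open>\<surd>\<sigma> D u\<close> (for \<open>H\<^sup>1\<^sub>0\<close>, \<open>u(\<pi>) = 0\<close> is a linear constraint on \<open>u'\<close>), so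
  \<open>S\<close> first projects orthogonally onto these; solutions never leave the range of the projection.\<close>

definition Q :: "l2 \<Rightarrow> l2" where
  "Q = (SOME Q. bounded_linear Q \<and> (\<forall>x. Q x \<in> KK) \<and> (\<forall>x\<in>KK. Q x = x) \<and> (\<forall>x y. Q x \<bullet> y = x \<bullet> Q y))"

lemma Q_spec: "bounded_linear Q \<and> (\<forall>x. Q x \<in> KK) \<and> (\<forall>x\<in>KK. Q x = x) \<and> (\<forall>x y. Q x \<bullet> y = x \<bullet> Q y)"
proof -
  obtain Q where "bounded_linear Q" "\<And>x. Q x \<in> KK" "\<And>x. x \<in> KK \<Longrightarrow> Q x = x" "\<And>x y. Q x \<bullet> y = x \<bullet> Q y"
    using orthogonal_projection_exists[OF KK_subspace KK_closed] by metis
  then have "\<exists>Q. bounded_linear Q \<and> (\<forall>x. Q x \<in> KK) \<and> (\<forall>x\<in>KK. Q x = x) \<and> (\<forall>x y. Q x \<bullet> y = x \<bullet> Q y)" by blast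
  then show ?thesis unfolding Q_def by (rule someI_ex)
qed

lemma Q_KK: "Q x \<in> KK" and Q_id: "x \<in> KK \<Longrightarrow> Q x = x" and Q_adj: "Q x \<bullet> y = x \<bullet> Q y"
  using Q_spec by auto

sublocale Q: bounded_linear Q using Q_spec by blast
sublocale jl: bounded_linear j by (rule j_bounded_linear)

section \<open>The reconstruction operator, its adjoint and their kernels\<close>

definition S :: "l2 \<Rightarrow> l2" where "S q = Mul rr (j (Mul irs (Q q)))"

lemma S_bounded_linear: "bounded_linear S"
proof -
  have "bounded_linear (\<lambda>q. Mul rr (j (Mul irs (Q q))))"
    by (intro bounded_linear_compose[OF Mrr.bounded_linear_axioms]
        bounded_linear_compose[OF jl.bounded_linear_axioms]
        bounded_linear_compose[OF Mirs.bounded_linear_axioms] Q.bounded_linear_axioms)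
  then show ?thesis by (simp add: S_def[abs_def])
qed

sublocale S: bounded_linear S by (rule S_bounded_linear)

definition S' :: "l2 \<Rightarrow> l2" where "S' = (SOME S'. bounded_linear S' \<and> (\<forall>x y. S x \<bullet> y = x \<bullet> S' y))"

lemma S'_spec: "bounded_linear S' \<and> (\<forall>x y. S x \<bullet> y = x \<bullet> S' y)"
proof -
  obtain R where "bounded_linear R" "\<And>x y. S x \<bullet> y = x \<bullet> R y" using hilbert_adjoint_exists[OF S_bounded_linear] by blast
  then have "\<exists>S'. bounded_linear S' \<and> (\<forall>x y. S x \<bullet> y = x \<bullet> S' y)" by blast
  then show ?thesis unfolding S'_def by (rule someI_ex)
qed

sublocale S': bounded_linear S' using S'_spec by blast

lemma S_adj: "S x \<bullet> y = x \<bullet> S' y" and S_adj': "y \<bullet> S x = S' y \<bullet> x"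
  using S'_spec by (auto simp: inner_commute)

lemma KK_D: "P w \<Longrightarrow> Mul rs (D w) \<in> KK" by (simp add: KK_def Mul_cancel D_K)

lemma S_D: "P w \<Longrightarrow> S (Mul rs (D w)) = Mul rr (cls w)"
  by (simp add: S_def Q_id KK_D Mul_cancel cls_P)

text \<open>For \<open>q\<close> in \<open>KK\<close>, the displacement whose weighted strain is
  \<open>q\<close>.\<close>

definition pos :: "l2 \<Rightarrow> real \<Rightarrow> real" where "pos q = J (Mul irs q)"

lemma pos:
  assumes "q \<in> KK"
  shows "P (pos q)" "D (pos q) = Mul irs q" "Mul rs (D (pos q)) = q" "S q = Mul rr (cls (pos q))"
proof -
  show 1: "P (pos q)" and 2: "D (pos q) = Mul irs q" using assms J_P by (auto simp: KK_def pos_def)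
  show 3: "Mul rs (D (pos q)) = q" by (simp add: 2 Mul_cancel)
  show "S q = Mul rr (cls (pos q))" using S_D[OF 1] by (simp add: 3)
qed

lemma S_Q: "S (Q q) = S q" by (simp add: S_def Q_id Q_KK)

lemma S_kernel:
  assumes k: "S k = 0" and q: "q \<in> KK"
  shows "q \<bullet> k = 0"
proof -
  have "j (Mul irs (Q k)) = 0" using k Mul_cancel(3)[of "j (Mul irs (Q k))"] by (simp add: S_def Mirr.zero)
  then have "Mul irs (Q k) = 0" using j_inj Q_KK by (auto simp: KK_def)
  then have "Q k = 0" using Mul_cancel(2)[of "Q k"] by (simp add: Mrs.zero)
  then show ?thesis using Q_adj[of q k] Q_id[OF q] by simp
qed

text \<open>The range of \<open>S\<close> contains \<open>Mul rr (cls w)\<close> for every test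
  function \<open>w\<close>, and these are dense; so the adjoint is injective, and the kernel of the
  block operator comes from strains only.\<close>

lemma S'_kernel:
  assumes h: "S' h = 0"
  shows "h = 0"
proof -
  have "Mul rr h = 0"
  proof (rule orthogonal_P_eq_0)
    fix w assume w: "P w"
    have "Mul rr h \<bullet> cls w = h \<bullet> S (Mul rs (D w))" by (simp add: Mul_self_adjoint[OF rr_c] S_D[OF w])
    then show "Mul rr h \<bullet> cls w = 0" by (simp add: S_adj' h)
  qed
  then show ?thesis using Mul_cancel(3)[of h] by (simp add: Mirr.zero)
qed

text \<open>\<open>S\<close> ignores \<open>q - Q q\<close>, so \<open>q\<close> is orthogonal to
  \<open>q - Q q\<close> and therefore equals its projection.\<close>

lemma KK_orthogonal:
  assumes "\<And>k. S k = 0 \<Longrightarrow> q \<bullet> k = 0"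
  shows "q \<in> KK"
proof -
  have "S (q - Q q) = 0" by (simp add: S.diff S_Q)
  then have "q \<bullet> (q - Q q) = 0" by (rule assms)
  moreover have "Q q \<bullet> (q - Q q) = 0" using Q_adj[of q "q - Q q"] by (simp add: Q.diff Q_id Q_KK)
  ultimately have "(q - Q q) \<bullet> (q - Q q) = 0" by (simp add: inner_diff_left)
  then have "q = Q q" by simp
  then show ?thesis using Q_KK by metis
qed

lemma ip2_weighted:
  assumes "P u" "P w"
  shows "ip2 (\<lambda>x. \<sigma> x * d u x) (d w) = Mul rs (D u) \<bullet> Mul rs (D w)"
proof -
  have "Mul rs (D u) \<bullet> Mul rs (D w) = Mul \<sigma> (D u) \<bullet> D w"
    by (simp add: Mul_square[symmetric] Mul_self_adjoint[OF rs_c])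
  then show ?thesis using assms
    by (simp add: D_def Mul_cls \<sigma>_c L2_d inner_cls L2_continuous_mult)
qed

text \<open>The bound with division by \<open>\<rho>\<close> serves the passage from mild to weak,
  the one with multiplication the converse.\<close>

lemma multiplier_bounds:
  obtains C where "C \<ge> 0"
    "\<And>w. P w \<Longrightarrow> norm (Mul rs (D (\<lambda>x. w x / \<rho> x))) \<le> C * norm (D w)"
    "\<And>w. w \<in> KK \<Longrightarrow> norm (D (\<lambda>x. \<rho> x * pos w x)) \<le> C * norm w"
proof -
  obtain C1 where C1: "\<And>w. P w \<Longrightarrow> norm (D (\<lambda>x. w x / \<rho> x)) \<le> C1 * norm (D w)" using D_div by blast
  obtain C2 where C2: "\<And>w. P w \<Longrightarrow> norm (D (\<lambda>x. \<rho> x * w x)) \<le> C2 * norm (D w)" using D_mult by blast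
  obtain K1 where K1: "\<And>q. norm (Mul rs q) \<le> norm q * K1" "K1 \<ge> 0" using Mrs.nonneg_bounded by blast
  obtain K2 where K2: "\<And>q. norm (Mul irs q) \<le> norm q * K2" "K2 \<ge> 0" using Mirs.nonneg_bounded by blast
  show thesis
  proof (rule that)
    show "0 \<le> \<bar>C1\<bar> * K1 + \<bar>C2\<bar> * K2" using K1(2) K2(2) by simp
    fix w assume w: "P w"
    have "norm (Mul rs (D (\<lambda>x. w x / \<rho> x))) \<le> norm (D (\<lambda>x. w x / \<rho> x)) * K1" by (rule K1(1))
    also have "\<dots> \<le> (\<bar>C1\<bar> * norm (D w)) * K1"
      by (intro mult_right_mono K1(2) order_trans[OF C1[OF w] mult_right_mono[OF abs_ge_self norm_ge_zero]])
    also have "\<dots> \<le> (\<bar>C1\<bar> * K1 + \<bar>C2\<bar> * K2) * norm (D w)" using K2(2) by (simp add: algebra_simps)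
    finally show "norm (Mul rs (D (\<lambda>x. w x / \<rho> x))) \<le> (\<bar>C1\<bar> * K1 + \<bar>C2\<bar> * K2) * norm (D w)" .
  next
    fix w assume w: "w \<in> KK"
    have "norm (D (\<lambda>x. \<rho> x * pos w x)) \<le> C2 * norm (D (pos w))" by (rule C2[OF pos(1)[OF w]])
    also have "\<dots> \<le> \<bar>C2\<bar> * (norm w * K2)"
      using K2(1)[of w] by (intro mult_mono) (auto simp: pos(2)[OF w])
    also have "\<dots> \<le> (\<bar>C1\<bar> * K1 + \<bar>C2\<bar> * K2) * norm w" using K1(2) by (simp add: algebra_simps)
    finally show "norm (D (\<lambda>x. \<rho> x * pos w x)) \<le> (\<bar>C1\<bar> * K1 + \<bar>C2\<bar> * K2) * norm w" .
  qed
qed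

section \<open>Passage between the weak and the mild equation\<close>

text \<open>Since \<open>cls w = Mul rr (S (Mul rs (D (\<lambda>x. w x / \<rho> x))))\<close>, an L2
  pairing of the velocity with \<open>w\<close> becomes a pairing of \<open>S' (v t)\<close> with
  the weighted strain of \<open>w / \<rho>\<close>. Limits in the Hilbert norm therefore give limits
  in the dual norm.\<close>

lemma mild_imp_weak:
  fixes q v F :: "real \<Rightarrow> l2"
  assumes qK: "\<And>t. t \<in> {0..T} \<Longrightarrow> q t \<in> KK"
    and qc: "continuous_on {0..T} q" and vc: "continuous_on {0..T} v" and Fc: "continuous_on {0..T} F"
    and dq: "\<And>t. t \<in> {0..T} \<Longrightarrow> ((\<lambda>t. S (q t)) has_vector_derivative v t) (at t within {0..T})"
    and dv: "\<And>t. t \<in> {0..T} \<Longrightarrow> ((\<lambda>t. S' (v t)) has_vector_derivative S' (F t) - q t) (at t within {0..T})"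
  obtains W where
    "greg P d T (\<lambda>t. pos (q t)) (\<lambda>t. rep (Mul irr (v t))) W"
    "\<And>t w. t \<in> {0..T} \<Longrightarrow> P w \<Longrightarrow> W t (\<lambda>x. \<rho> x * w x) + ip2 (\<lambda>x. \<sigma> x * d (pos (q t)) x) (d w) = Mul rr (F t) \<bullet> cls w"
proof -
  \<comment> \<open>This is the derivative of \<open>S' (v t)\<close> paired with the weighted
    strain of \<open>w / \<rho>\<close>; when tested with \<open>\<rho> w\<close> the density
    cancels and the weak equation appears.\<close>
  define W where "W t w = (S' (F t) - q t) \<bullet> Mul rs (D (\<lambda>x. w x / \<rho> x))" for t w
  obtain C where C: "C \<ge> 0" "\<And>w. P w \<Longrightarrow> norm (Mul rs (D (\<lambda>x. w x / \<rho> x))) \<le> C * norm (D w)"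
    using multiplier_bounds by metis
  have Mw: "\<bar>y \<bullet> Mul rs (D (\<lambda>x. w x / \<rho> x))\<bar> \<le> (norm y * C) * norm (D w)" if w: "P w" for y w
    using order_trans[OF Cauchy_Schwarz_ineq2 mult_left_mono[OF C(2)[OF w] norm_ge_zero]] by (simp add: mult.assoc)
  let ?U = "\<lambda>t. pos (q t)" and ?V = "\<lambda>t. rep (Mul irr (v t))"
  have clsU: "cls (?U t) = Mul irr (S (q t))" if "t \<in> {0..T}" for t
    using pos(4)[OF qK[OF that]] by (simp add: Mul_cancel)
  have 1: "((\<lambda>s. sqrt (ip2 (d (\<lambda>x. ?U s x - ?U t x)) (d (\<lambda>x. ?U s x - ?U t x)))) \<longlongrightarrow> 0) (at t within {0..T})"
    if t: "t \<in> {0..T}" for t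
  proof -
    have "((\<lambda>s. norm (Mul irs (q s) - Mul irs (q t))) \<longlongrightarrow> 0) (at t within {0..T})"
      by (rule tendsto_norm_0[OF Mirs.continuous_on[OF qc] t])
    moreover have "sqrt (ip2 (d (\<lambda>x. ?U s x - ?U t x)) (d (\<lambda>x. ?U s x - ?U t x))) = norm (Mul irs (q s) - Mul irs (q t))"
      if s: "s \<in> {0..T}" for s
      using P_diff[OF pos(1)[OF qK[OF s]] pos(1)[OF qK[OF t]]] by (simp only: sqrt_ip2_d pos(2)[OF qK[OF s]] pos(2)[OF qK[OF t]])
    ultimately show ?thesis by (subst Lim_cong_within[OF refl refl refl]) auto
  qed
  have 2: "((\<lambda>s. norm2 (\<lambda>x. (?U s x - ?U t x) / (s - t) - ?V t x)) \<longlongrightarrow> 0) (at t within {0..T})"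
    if t: "t \<in> {0..T}" for t
  proof -
    have "((\<lambda>t. Mul irr (S (q t))) has_vector_derivative Mul irr (v t)) (at t within {0..T})"
      by (rule Mirr.has_vector_derivative[OF dq[OF t]])
    then have "((\<lambda>s. norm ((1 / (s - t)) *\<^sub>R (Mul irr (S (q s)) - Mul irr (S (q t))) - Mul irr (v t))) \<longlongrightarrow> 0) (at t within {0..T})"
      by (simp only: has_vector_derivative_iff_tendsto_norm)
    moreover have "norm2 (\<lambda>x. (?U s x - ?U t x) / (s - t) - ?V t x) = norm ((1 / (s - t)) *\<^sub>R (Mul irr (S (q s)) - Mul irr (S (q t))) - Mul irr (v t))"
      if s: "s \<in> {0..T}" for s
    proof -
      have L: "L2 (?U s)" "L2 (?U t)" by (auto intro: P_L2 pos qK s t)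
      have L': "L2 (\<lambda>x. (1 / (s - t)) * (?U s x - ?U t x))" by (intro L2_scale L2_diff L)
      have "norm2 (\<lambda>x. (?U s x - ?U t x) / (s - t) - ?V t x) = norm (cls (\<lambda>x. (1 / (s - t)) * (?U s x - ?U t x) - ?V t x))"
        using norm_cls[OF L2_diff[OF L' L2_rep[of "Mul irr (v t)"]]] by simp
      also have "cls (\<lambda>x. (1 / (s - t)) * (?U s x - ?U t x) - ?V t x) = (1 / (s - t)) *\<^sub>R (cls (?U s) - cls (?U t)) - Mul irr (v t)"
        by (simp only: cls_diff[OF L' L2_rep] cls_scale[OF L2_diff[OF L]] cls_diff[OF L] cls_rep)
      finally show ?thesis by (simp only: clsU s t)
    qed
    ultimately show ?thesis by (subst Lim_cong_within[OF refl refl refl]) auto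
  qed
  have 3: "((\<lambda>s. norm2 (\<lambda>x. ?V s x - ?V t x)) \<longlongrightarrow> 0) (at t within {0..T})" if t: "t \<in> {0..T}" for t
  proof -
    have "((\<lambda>s. norm (Mul irr (v s) - Mul irr (v t))) \<longlongrightarrow> 0) (at t within {0..T})"
      by (rule tendsto_norm_0[OF Mirr.continuous_on[OF vc] t])
    then show ?thesis by (simp add: norm_cls[symmetric] L2_diff cls_diff)
  qed
  have 4: "gdual P d (W t)" for t
    unfolding gdual_def
  proof (intro conjI allI impI)
    fix u w a b assume u: "P u" and w: "P w"
    have "(\<lambda>x. (a * u x + b * w x) / \<rho> x) = (\<lambda>x. a * (u x / \<rho> x) + b * (w x / \<rho> x))"
      by (simp add: add_divide_distrib)
    then show "W t (\<lambda>x. a * u x + b * w x) = a * W t u + b * W t w"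
      using P_linear(2)[OF P_div[OF u] P_div[OF w], of a b]
      by (simp add: W_def Mrs.add Mrs.scaleR inner_add_right)
  next
    have "\<bar>W t v\<bar> \<le> (norm (S' (F t) - q t) * C) * sqrt (ip2 (d v) (d v))" if "P v" for v
      unfolding W_def sqrt_ip2_d[OF that] by (rule Mw[OF that])
    then show "\<exists>C. \<forall>v. P v \<longrightarrow> \<bar>W t v\<bar> \<le> C * sqrt (ip2 (d v) (d v))" by blast
  qed
  have cdiv: "cls w = Mul rr (S (Mul rs (D (\<lambda>x. w x / \<rho> x))))" if w: "P w" for w
  proof -
    have "Mul rr (S (Mul rs (D (\<lambda>x. w x / \<rho> x)))) = Mul \<rho> (cls (\<lambda>x. w x / \<rho> x))"
      by (simp only: S_D[OF P_div[OF w]] Mul_square)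
    also have "\<dots> = cls (\<lambda>x. \<rho> x * (w x / \<rho> x))" by (rule Mul_cls[OF \<rho>_c P_L2[OF P_div[OF w]]])
    also have "\<dots> = cls w"
      using \<rho>_pos by (intro cls_eqI L2_continuous_mult[OF \<rho>_c P_L2[OF P_div[OF w]]]) fastforce
    finally show ?thesis by simp
  qed
  have 5: "((\<lambda>s. gdnorm P d (\<lambda>w. ip2 (\<lambda>x. (?V s x - ?V t x) / (s - t)) w - W t w)) \<longlongrightarrow> 0) (at t within {0..T})"
    if t: "t \<in> {0..T}" for t
  proof -
    let ?y = "\<lambda>s. (1 / (s - t)) *\<^sub>R (S' (v s) - S' (v t)) - (S' (F t) - q t)"
    have lim: "((\<lambda>s. norm (?y s) * C) \<longlongrightarrow> 0 * C) (at t within {0..T})"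
      using dv[OF t] by (intro tendsto_mult tendsto_const) (simp only: has_vector_derivative_iff_tendsto_norm)
    have eq: "ip2 (\<lambda>x. (?V s x - ?V t x) / (s - t)) w - W t w = ?y s \<bullet> Mul rs (D (\<lambda>x. w x / \<rho> x))" if w: "P w" for s w
    proof -
      have L: "L2 (\<lambda>x. ?V s x - ?V t x)" by (intro L2_diff L2_rep)
      have "ip2 (\<lambda>x. (?V s x - ?V t x) / (s - t)) w = ip2 (\<lambda>x. (1 / (s - t)) * (?V s x - ?V t x)) w" by simp
      also have "\<dots> = cls (\<lambda>x. (1 / (s - t)) * (?V s x - ?V t x)) \<bullet> cls w"
        by (rule inner_cls[OF L2_scale[OF L] P_L2[OF w], symmetric])
      also have "\<dots> = (1 / (s - t)) *\<^sub>R Mul irr (v s - v t) \<bullet> cls w"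
        by (simp only: cls_scale[OF L] cls_diff[OF L2_rep L2_rep] cls_rep Mirr.diff)
      also have "\<dots> = (1 / (s - t)) *\<^sub>R (v s - v t) \<bullet> S (Mul rs (D (\<lambda>x. w x / \<rho> x)))"
        by (simp only: cdiv[OF w] inner_scaleR_left Mul_self_adjoint[OF irr_c] Mul_cancel)
      finally show ?thesis
        by (simp only: W_def S_adj' S'.scaleR S'.diff inner_diff_left)
    qed
    have "\<bar>ip2 (\<lambda>x. (?V s x - ?V t x) / (s - t)) w - W t w\<bar> \<le> (norm (?y s) * C) * norm (D w)" if "P w" for s w
      unfolding eq[OF that] by (rule Mw[OF that])
    note b = gdnorm_le[OF mult_nonneg_nonneg[OF norm_ge_zero C(1)] this]
    show ?thesis
      by (rule tendsto_sandwich[OF _ _ tendsto_const]) (use lim b in auto)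
  qed
  have 6: "((\<lambda>s. gdnorm P d (\<lambda>w. W s w - W t w)) \<longlongrightarrow> 0) (at t within {0..T})" if t: "t \<in> {0..T}" for t
  proof -
    let ?h = "\<lambda>s. S' (F s) - q s"
    have "continuous_on {0..T} ?h" by (intro continuous_intros S'.continuous_on Fc qc)
    then have lim: "((\<lambda>s. norm (?h s - ?h t) * C) \<longlongrightarrow> 0 * C) (at t within {0..T})"
      by (intro tendsto_mult tendsto_const tendsto_norm_0 t)
    have "\<bar>W s w - W t w\<bar> \<le> (norm (?h s - ?h t) * C) * norm (D w)" if "P w" for s w
      unfolding W_def using Mw[OF that, of "?h s - ?h t"] by (simp only: inner_diff_left)
    note b = gdnorm_le[OF mult_nonneg_nonneg[OF norm_ge_zero C(1)] this]
    show ?thesis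
      by (rule tendsto_sandwich[OF _ _ tendsto_const]) (use lim b in auto)
  qed
  have weak: "W t (\<lambda>x. \<rho> x * w x) + ip2 (\<lambda>x. \<sigma> x * d (?U t) x) (d w) = Mul rr (F t) \<bullet> cls w"
    if t: "t \<in> {0..T}" and w: "P w" for t w
  proof -
    have "D (\<lambda>x. \<rho> x * w x / \<rho> x) = D w"
      using \<rho>_pos by (intro P_cong(2)[OF w]) fastforce
    then have "W t (\<lambda>x. \<rho> x * w x) = S' (F t) \<bullet> Mul rs (D w) - q t \<bullet> Mul rs (D w)"
      by (simp add: W_def inner_diff_left)
    also have "S' (F t) \<bullet> Mul rs (D w) = Mul rr (F t) \<bullet> cls w"
      by (simp only: S_adj'[symmetric] S_D[OF w] Mul_self_adjoint[OF rr_c])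
    also have "q t \<bullet> Mul rs (D w) = ip2 (\<lambda>x. \<sigma> x * d (?U t) x) (d w)"
      using ip2_weighted[OF pos(1)[OF qK[OF t]] w] by (simp only: pos(3)[OF qK[OF t]])
    finally show ?thesis by simp
  qed
  have "greg P d T ?U ?V W"
    unfolding greg_def using 1 2 3 4 5 6 pos(1)[OF qK] by (intro conjI ballI) auto
  then show thesis using weak by (rule that)
qed

text \<open>The converse transfer, from convergence in the dual norm to convergence in the Hilbert
  norm, rests on testing the dual functional with a displacement built from the error itself. The
  weak equation holds only for interior times, hence so does the last conclusion.\<close>

lemma weak_imp_mild:
  assumes reg: "greg P d T U V W" and F: "\<forall>t\<in>{0<..<T}. L2 (f t)"
    and weak: "\<forall>t\<in>{0<..<T}. \<forall>w. P w \<longrightarrow> W t (\<lambda>x. \<rho> x * w x) + ip2 (\<lambda>x. \<sigma> x * d (U t) x) (d w) = ip2 (f t) w"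
  defines "q \<equiv> \<lambda>t. Mul rs (D (U t))" and "v \<equiv> \<lambda>t. Mul rr (cls (V t))"
  shows "continuous_on {0..T} q" "continuous_on {0..T} v"
    "\<And>t. t \<in> {0..T} \<Longrightarrow> ((\<lambda>t. S (q t)) has_vector_derivative v t) (at t within {0..T})"
    "\<And>t. t \<in> {0<..<T} \<Longrightarrow> ((\<lambda>t. S' (v t)) has_vector_derivative S' (Mul irr (cls (f t))) - q t) (at t)"
proof -
  have PU: "P (U t)" and LV: "L2 (V t)" and dW: "gdual P d (W t)" if "t \<in> {0..T}" for t
    using reg that unfolding greg_def by auto
  have DU: "continuous_on {0..T} (\<lambda>t. D (U t))"
    unfolding continuous_on_def
  proof
    fix t assume t: "t \<in> {0..T}"
    have "((\<lambda>s. sqrt (ip2 (d (\<lambda>x. U s x - U t x)) (d (\<lambda>x. U s x - U t x)))) \<longlongrightarrow> 0) (at t within {0..T})"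
      using reg t unfolding greg_def by blast
    moreover have "sqrt (ip2 (d (\<lambda>x. U s x - U t x)) (d (\<lambda>x. U s x - U t x))) = norm (D (U s) - D (U t))" if s: "s \<in> {0..T}" for s
      using P_diff[OF PU[OF s] PU[OF t]] by (simp only: sqrt_ip2_d)
    ultimately have "((\<lambda>s. norm (D (U s) - D (U t))) \<longlongrightarrow> 0) (at t within {0..T})"
      by (subst (asm) Lim_cong_within[OF refl refl refl]) auto
    then show "((\<lambda>t. D (U t)) \<longlongrightarrow> D (U t)) (at t within {0..T})"
      by (simp add: LIM_zero_iff tendsto_norm_zero_iff)
  qed
  then show "continuous_on {0..T} q" unfolding q_def by (rule Mrs.continuous_on)
  have Vc: "continuous_on {0..T} (\<lambda>t. cls (V t))"
    unfolding continuous_on_def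
  proof
    fix t assume t: "t \<in> {0..T}"
    have "((\<lambda>s. norm2 (\<lambda>x. V s x - V t x)) \<longlongrightarrow> 0) (at t within {0..T})"
      using reg t unfolding greg_def by blast
    moreover have "norm2 (\<lambda>x. V s x - V t x) = norm (cls (V s) - cls (V t))" if s: "s \<in> {0..T}" for s
      by (simp only: cls_diff[OF LV[OF s] LV[OF t], symmetric] norm_cls[OF L2_diff[OF LV[OF s] LV[OF t]]])
    ultimately have "((\<lambda>s. norm (cls (V s) - cls (V t))) \<longlongrightarrow> 0) (at t within {0..T})"
      by (subst (asm) Lim_cong_within[OF refl refl refl]) auto
    then show "((\<lambda>t. cls (V t)) \<longlongrightarrow> cls (V t)) (at t within {0..T})"
      by (simp add: LIM_zero_iff tendsto_norm_zero_iff)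
  qed
  then show "continuous_on {0..T} v" unfolding v_def by (rule Mrr.continuous_on)
  show "((\<lambda>t. S (q t)) has_vector_derivative v t) (at t within {0..T})" if t: "t \<in> {0..T}" for t
  proof -
    have "((\<lambda>s. norm2 (\<lambda>x. (U s x - U t x) / (s - t) - V t x)) \<longlongrightarrow> 0) (at t within {0..T})"
      using reg t unfolding greg_def by blast
    moreover have "norm2 (\<lambda>x. (U s x - U t x) / (s - t) - V t x) = norm ((1 / (s - t)) *\<^sub>R (cls (U s) - cls (U t)) - cls (V t))"
      if s: "s \<in> {0..T}" for s
    proof -
      have L: "L2 (U s)" "L2 (U t)" by (auto intro: P_L2 PU s t)
      have L': "L2 (\<lambda>x. (1 / (s - t)) * (U s x - U t x))" by (intro L2_scale L2_diff L)
      have "norm2 (\<lambda>x. (U s x - U t x) / (s - t) - V t x) = norm (cls (\<lambda>x. (1 / (s - t)) * (U s x - U t x) - V t x))"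
        using norm_cls[OF L2_diff[OF L' LV[OF t]]] by simp
      then show ?thesis
        by (simp only: cls_diff[OF L' LV[OF t]] cls_scale[OF L2_diff[OF L]] cls_diff[OF L])
    qed
    ultimately have "((\<lambda>s. norm ((1 / (s - t)) *\<^sub>R (cls (U s) - cls (U t)) - cls (V t))) \<longlongrightarrow> 0) (at t within {0..T})"
      by (subst (asm) Lim_cong_within[OF refl refl refl]) auto
    then have "((\<lambda>t. cls (U t)) has_vector_derivative cls (V t)) (at t within {0..T})"
      by (simp only: has_vector_derivative_iff_tendsto_norm)
    then have "((\<lambda>t. Mul rr (cls (U t))) has_vector_derivative v t) (at t within {0..T})"
      unfolding v_def by (rule Mrr.has_vector_derivative)
    then show ?thesis
      by (rule has_vector_derivative_transform[rotated 2]) (use t in \<open>auto simp: q_def S_D PU\<close>)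
  qed
  show "((\<lambda>t. S' (v t)) has_vector_derivative S' (Mul irr (cls (f t))) - q t) (at t)" if t: "t \<in> {0<..<T}" for t
  proof -
    have t': "t \<in> {0..T}" using t by auto
    define \<phi> where "\<phi> s = (\<lambda>w. ip2 (\<lambda>x. (V s x - V t x) / (s - t)) w - W t w)" for s
    \<comment> \<open>The error of the difference quotient of \<open>S' (v t)\<close> against its
      expected derivative. By \<open>XX\<close> below, pairing it with any \<open>w\<close> equals
      testing \<open>\<phi> s\<close> with \<open>\<rho> * pos (Q w)\<close>.\<close>
    define X where "X s = (1 / (s - t)) *\<^sub>R (S' (v s) - S' (v t)) - (S' (Mul irr (cls (f t))) - q t)" for s
    obtain C where C: "C \<ge> 0" "\<And>w. w \<in> KK \<Longrightarrow> norm (D (\<lambda>x. \<rho> x * pos w x)) \<le> C * norm w"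
      using multiplier_bounds by metis
    obtain KQ where KQ: "\<And>w. norm (Q w) \<le> norm w * KQ" "KQ \<ge> 0" using Q.nonneg_bounded by blast
    have bound: "norm (X s) \<le> gdnorm P d (\<phi> s) * (C * KQ) \<and> 0 \<le> gdnorm P d (\<phi> s)" if s: "s \<in> {0..T}" for s
    proof -
      have L: "L2 (\<lambda>x. V s x - V t x)" by (intro L2_diff LV s t')
      define A where "A = cls (\<lambda>x. (1 / (s - t)) * (V s x - V t x))"
      have ipA: "ip2 (\<lambda>x. (V s x - V t x) / (s - t)) w = A \<bullet> cls w" if w: "P w" for w
        unfolding A_def inner_cls[OF L2_scale[OF L] P_L2[OF w]] by simp
      have dual: "gdual P d (\<phi> s)"
        unfolding gdual_def
      proof (intro conjI allI impI)
        fix u w a b assume u: "P u" and w: "P w"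
        have "cls (\<lambda>x. a * u x + b * w x) = a *\<^sub>R cls u + b *\<^sub>R cls w"
          by (simp add: cls_add L2_scale cls_scale P_L2 u w)
        moreover have "W t (\<lambda>x. a * u x + b * w x) = a * W t u + b * W t w"
          using dW[OF t'] u w unfolding gdual_def by blast
        ultimately show "\<phi> s (\<lambda>x. a * u x + b * w x) = a * \<phi> s u + b * \<phi> s w"
          by (simp add: \<phi>_def ipA P_linear(1) u w inner_add_right algebra_simps)
      next
        obtain C1 where C1: "\<And>w. P w \<Longrightarrow> \<bar>W t w\<bar> \<le> C1 * sqrt (ip2 (d w) (d w))"
          using dW[OF t'] unfolding gdual_def by blast
        obtain Cj where Cj: "\<And>w. norm (j w) \<le> norm w * Cj" using jl.bounded by blast
        have "\<bar>\<phi> s w\<bar> \<le> (norm A * Cj + C1) * sqrt (ip2 (d w) (d w))" if w: "P w" for w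
        proof -
          have "\<bar>A \<bullet> cls w\<bar> \<le> norm A * norm (cls w)" by (rule Cauchy_Schwarz_ineq2)
          also have "\<dots> \<le> norm A * (norm (D w) * Cj)" unfolding cls_P[OF w] by (intro mult_left_mono Cj) simp
          finally have "\<bar>A \<bullet> cls w\<bar> \<le> norm A * Cj * sqrt (ip2 (d w) (d w))" by (simp only: sqrt_ip2_d[OF w] mult_ac)
          then show ?thesis using C1[OF w] abs_triangle_ineq4[of "A \<bullet> cls w" "W t w"]
            unfolding \<phi>_def ipA[OF w] distrib_right by linarith
        qed
        then show "\<exists>C. \<forall>v. P v \<longrightarrow> \<bar>\<phi> s v\<bar> \<le> C * sqrt (ip2 (d v) (d v))" by blast
      qed
      obtain C0 where "\<And>v. P v \<Longrightarrow> \<bar>\<phi> s v\<bar> \<le> C0 * sqrt (ip2 (d v) (d v))" using dual unfolding gdual_def by blast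
      then have "\<bar>\<phi> s v\<bar> \<le> \<bar>C0\<bar> * norm (D v)" if "P v" for v
        using that sqrt_ip2_d[OF that] by (metis abs_ge_self mult_right_mono norm_ge_zero order_trans)
      from gdnorm_le(1)[OF abs_ge_zero this] have g0: "0 \<le> gdnorm P d (\<phi> s)" .
      have XX: "X s \<bullet> w = \<phi> s (\<lambda>x. \<rho> x * pos (Q w) x)" for w
      proof -
        let ?w = "pos (Q w)"
        note p = pos[OF Q_KK[of w]]
        have "(1 / (s - t)) *\<^sub>R (S' (v s) - S' (v t)) \<bullet> w = (1 / (s - t)) *\<^sub>R (v s - v t) \<bullet> S (Q w)"
          by (simp only: S_Q S_adj' S'.scaleR S'.diff)
        also have "(1 / (s - t)) *\<^sub>R (v s - v t) = Mul rr A"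
          unfolding A_def v_def
          by (simp only: cls_scale[OF L] cls_diff[OF LV[OF s] LV[OF t']] Mrr.scaleR Mrr.diff)
        also have "Mul rr A \<bullet> S (Q w) = A \<bullet> Mul \<rho> (cls ?w)"
          by (simp only: p(4) Mul_self_adjoint[OF rr_c] Mul_square)
        also have "Mul \<rho> (cls ?w) = cls (\<lambda>x. \<rho> x * ?w x)" by (rule Mul_cls[OF \<rho>_c P_L2[OF p(1)]])
        finally have 1: "(1 / (s - t)) *\<^sub>R (S' (v s) - S' (v t)) \<bullet> w = ip2 (\<lambda>x. (V s x - V t x) / (s - t)) (\<lambda>x. \<rho> x * ?w x)"
          by (simp only: ipA[OF P_mult[OF p(1)]])
        have "W t (\<lambda>x. \<rho> x * ?w x) = cls (f t) \<bullet> cls ?w - Mul rs (D (U t)) \<bullet> Mul rs (D ?w)"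
          using weak[rule_format, OF t p(1)] ip2_weighted[OF PU[OF t'] p(1)] inner_cls[OF F[rule_format, OF t] P_L2[OF p(1)]] by linarith
        also have "Mul rs (D (U t)) \<bullet> Mul rs (D ?w) = q t \<bullet> Q w" by (simp only: p(3) q_def)
        also have "\<dots> = q t \<bullet> w" using Q_adj[of "q t" w] Q_id[OF KK_D[OF PU[OF t']]] by (simp add: q_def)
        also have "cls (f t) \<bullet> cls ?w = Mul irr (cls (f t)) \<bullet> S (Q w)"
          by (simp only: p(4) Mul_self_adjoint[OF irr_c] Mul_cancel)
        also have "\<dots> = S' (Mul irr (cls (f t))) \<bullet> w" by (simp only: S_Q S_adj')
        finally show ?thesis using 1 by (simp only: X_def \<phi>_def inner_diff_left)
      qed
      \<comment> \<open>With \<open>w = X s\<close> the pairing becomes the squared norm. The test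
        function is bounded by a multiple of \<open>norm (X s)\<close>, so one factor cancels and
        the dual norm bounds the error.\<close>
      have "X s \<bullet> X s \<le> gdnorm P d (\<phi> s) * norm (D (\<lambda>x. \<rho> x * pos (Q (X s)) x))"
        unfolding XX using gdnorm_bound[OF dual P_mult[OF pos(1)[OF Q_KK]]] by (meson abs_ge_self order_trans)
      also have "\<dots> \<le> gdnorm P d (\<phi> s) * (C * (norm (X s) * KQ))"
        using C(2)[OF Q_KK, of "X s"] mult_left_mono[OF KQ(1)[of "X s"] C(1)] by (intro mult_left_mono g0) linarith
      finally have "norm (X s) * norm (X s) \<le> norm (X s) * (gdnorm P d (\<phi> s) * (C * KQ))"
        by (simp add: power2_norm_eq_inner[symmetric] power2_eq_square mult_ac)
      then have "norm (X s) \<le> gdnorm P d (\<phi> s) * (C * KQ)"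
        using g0 C(1) KQ(2) by (cases "X s = 0") auto
      with g0 show ?thesis by blast
    qed
    have "((\<lambda>s. gdnorm P d (\<phi> s)) \<longlongrightarrow> 0) (at t within {0..T})"
      unfolding \<phi>_def using reg t' unfolding greg_def by blast
    then have lim: "((\<lambda>s. gdnorm P d (\<phi> s) * (C * KQ)) \<longlongrightarrow> 0) (at t within {0..T})"
      by (rule tendsto_mult_left_zero)
    have "((\<lambda>s. norm (X s)) \<longlongrightarrow> 0) (at t within {0..T})"
    proof (rule tendsto_sandwich[OF _ _ tendsto_const lim])
      show "\<forall>\<^sub>F s in at t within {0..T}. norm (X s) \<le> gdnorm P d (\<phi> s) * (C * KQ)"
        using bound by (auto simp: eventually_at_filter)
    qed simp
    then have "((\<lambda>t. S' (v t)) has_vector_derivative S' (Mul irr (cls (f t))) - q t) (at t within {0..T})"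
      unfolding has_vector_derivative_iff_tendsto_norm X_def .
    moreover have "at t within {0..T} = at t" using t by (intro at_within_interior) auto
    ultimately show ?thesis by simp
  qed
qed

text \<open>Every \<open>S' u\<close> is orthogonal to the kernel of \<open>S\<close>, so the second
  mild equation by itself forces \<open>q\<close> to be orthogonal to that kernel, that is, to be
  the weighted strain of an admissible displacement.\<close>

lemma mild_KK:
  assumes "((\<lambda>t. S' (v t)) has_vector_derivative S' F - q) (at t)"
  shows "q \<in> KK"
proof (rule KK_orthogonal)
  fix k assume k: "S k = 0"
  have z: "S' u \<bullet> k = 0" for u by (simp add: S_adj'[symmetric] k)
  have "((\<lambda>t. S' (v t) \<bullet> k) has_vector_derivative (S' F - q) \<bullet> k) (at t)"
    by (rule bounded_linear.has_vector_derivative[OF bounded_linear_inner_left assms])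
  then have "((\<lambda>t. 0::real) has_vector_derivative - (q \<bullet> k)) (at t)"
    by (simp add: z inner_diff_left)
  then show "q \<bullet> k = 0" using vector_derivative_unique_at[OF _ has_vector_derivative_const] by force
qed

section \<open>The skew block operator of one equation\<close>

definition Bc :: "l2 \<times> l2 \<Rightarrow> l2 \<times> l2" where "Bc X = (- S' (snd X), S (fst X))"

lemma Bc_bounded_linear: "bounded_linear Bc"
  unfolding Bc_def[abs_def]
  by (intro bounded_linear_Pair bounded_linear_minus bounded_linear_compose[OF S'.bounded_linear_axioms]
      bounded_linear_compose[OF S.bounded_linear_axioms] bounded_linear_fst bounded_linear_snd)

lemma Bc_skew: "Bc X \<bullet> Y = - (X \<bullet> Bc Y)"
  by (simp add: Bc_def inner_prod_def S_adj S_adj')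

text \<open>Injectivity of \<open>S'\<close> leaves only pairs \<open>(k, 0)\<close> with
  \<open>S k = 0\<close> in the kernel. The velocity therefore needs no condition.\<close>

lemma Bc_kernel:
  assumes "Bc k = 0" "fst X \<in> KK"
  shows "X \<bullet> k = 0"
proof -
  have "snd k = 0" "S (fst k) = 0" using assms(1) S'_kernel by (auto simp: Bc_def zero_prod_def)
  then show ?thesis using S_kernel[OF _ assms(2)] by (simp add: inner_prod_def)
qed

lemma Bc_mild:
  "((\<lambda>t. Bc (X t)) has_vector_derivative X t + Bc (0, F)) (at t within A) \<longleftrightarrow>
    ((\<lambda>t. S (fst (X t))) has_vector_derivative snd (X t)) (at t within A) \<and>
    ((\<lambda>t. S' (snd (X t))) has_vector_derivative S' F - fst (X t)) (at t within A)" (is "?l \<longleftrightarrow> ?r1 \<and> ?r2")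
proof
  assume l: ?l
  have ?r1 using bounded_linear.has_vector_derivative[OF bounded_linear_snd l] by (simp add: Bc_def S.zero)
  moreover have ?r2
    using has_vector_derivative_minus[OF bounded_linear.has_vector_derivative[OF bounded_linear_fst l]] by (simp add: Bc_def)
  ultimately show "?r1 \<and> ?r2" by blast
next
  assume r: "?r1 \<and> ?r2"
  have "((\<lambda>t. (- S' (snd (X t)), S (fst (X t)))) has_vector_derivative (- (S' F - fst (X t)), snd (X t))) (at t within A)"
    using r by (intro has_vector_derivative_Pair has_vector_derivative_minus) auto
  moreover have "(- (S' F - fst (X t)), snd (X t)) = X t + Bc (0, F)"
    by (simp add: Bc_def S.zero plus_prod_def)
  ultimately show ?l by (simp add: Bc_def)
qed

text \<open>Agrees with the class of \<open>pos q\<close> when \<open>q\<close> lies in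
  \<open>KK\<close>, but is bounded and linear on the whole space; the forces can thus be defined
  for arbitrary states.\<close>

definition posl :: "l2 \<Rightarrow> l2" where "posl q = Mul irr (S q)"

lemma posl_bounded_linear: "bounded_linear posl"
  unfolding posl_def[abs_def]
  by (rule bounded_linear_compose[OF Mirr.bounded_linear_axioms S_bounded_linear])

lemma posl_D: "P u \<Longrightarrow> posl (Mul rs (D u)) = cls u"
  by (simp only: posl_def S_D Mul_cancel)

lemma pos_D: "P u \<Longrightarrow> x \<in> {0..pi} \<Longrightarrow> pos (Mul rs (D u)) x = u x"
  unfolding pos_def Mul_cancel by (rule P_J[symmetric])

end

section \<open>The suspension bridge\<close>

text \<open>Hiding the constant lets composite maps be treated by introduction rules alone.\<close>

definition lip :: "('a::metric_space \<Rightarrow> 'b::metric_space) \<Rightarrow> bool" where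
  "lip f \<longleftrightarrow> (\<exists>L. L-lipschitz_on UNIV f)"

lemma lip_linear: "bounded_linear f \<Longrightarrow> lip f"
proof -
  assume f: "bounded_linear f"
  then interpret bounded_linear f .
  obtain K where K: "\<And>x. norm (f x) \<le> norm x * K" "K \<ge> 0" using nonneg_bounded by blast
  have "K-lipschitz_on UNIV f"
    by (rule lipschitz_onI) (use K in \<open>auto simp: dist_norm diff[symmetric] mult.commute\<close>)
  then show "lip f" unfolding lip_def ..
qed

lemma lip_compose:
  assumes "lip h" "lip f"
  shows "lip (\<lambda>x. h (f x))"
proof -
  obtain C C' where "C-lipschitz_on UNIV h" "C'-lipschitz_on UNIV f" using assms unfolding lip_def by blast
  then have "(C * C')-lipschitz_on UNIV (\<lambda>x. h (f x))"
    using lipschitz_on_compose2[of C' UNIV f C h] lipschitz_on_subset[of C UNIV h] by blast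
  then show ?thesis unfolding lip_def ..
qed

lemma lip_add: "lip f \<Longrightarrow> lip h \<Longrightarrow> lip (\<lambda>x. f x + h x)" for f h :: "'a::metric_space \<Rightarrow> 'b::real_normed_vector"
  unfolding lip_def by (elim exE) (rule exI, rule lipschitz_on_add)

lemma lip_linear_compose: "bounded_linear h \<Longrightarrow> lip f \<Longrightarrow> lip (\<lambda>x. h (f x))"
  by (rule lip_compose[OF lip_linear])

lemma lip_minus: "lip f \<Longrightarrow> lip (\<lambda>x. - f x)" for f :: "'a::metric_space \<Rightarrow> 'b::real_normed_vector"
  by (rule lip_linear_compose[OF bounded_linear_minus[OF bounded_linear_ident]])

lemma lip_diff: "lip f \<Longrightarrow> lip h \<Longrightarrow> lip (\<lambda>x. f x - h x)" for f h :: "'a::metric_space \<Rightarrow> 'b::real_normed_vector"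
  using lip_add[of f "\<lambda>x. - h x"] lip_minus[of h] by simp

lemma lip_scaleR: "lip f \<Longrightarrow> lip (\<lambda>x. r *\<^sub>R f x)" for f :: "'a::metric_space \<Rightarrow> 'b::real_normed_vector"
  by (rule lip_linear_compose[OF bounded_linear_scaleR_right])

lemma lip_Pair: "lip f \<Longrightarrow> lip h \<Longrightarrow> lip (\<lambda>x. (f x, h x))"
  for f :: "'a::metric_space \<Rightarrow> 'b::real_normed_vector" and h :: "'a \<Rightarrow> 'c::real_normed_vector"
proof -
  assume f: "lip f" and h: "lip h"
  show "lip (\<lambda>x. (f x, h x))"
    using lip_add[OF lip_linear_compose[OF bounded_linear_Pair[OF bounded_linear_ident bounded_linear_zero] f]
        lip_linear_compose[OF bounded_linear_Pair[OF bounded_linear_zero bounded_linear_ident] h]] by simp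
qed

lemma lip_const: "lip (\<lambda>x. c)"
  unfolding lip_def by (rule exI[of _ 0]) (rule lipschitz_on_constant)

text \<open>By \<open>prim_product\<close> the derivative of \<open>c w\<close> is \<open>?T\<close>
  applied to the derivative of \<open>w\<close>. This \<open>?T\<close> is bounded on L2, and its
  value again satisfies the constraint at \<open>pi\<close>.\<close>

lemma H10_multiplier:
  assumes c: "\<And>x. x \<in> {0..pi} \<Longrightarrow> (c has_real_derivative c' x) (at x within {0..pi})"
    and c': "continuous_on {0..pi} c'"
  shows "H10 w \<Longrightarrow> H10 (\<lambda>x. c x * w x)"
    "\<exists>C. \<forall>w. H10 w \<longrightarrow> norm (H10.D (\<lambda>x. c x * w x)) \<le> C * norm (H10.D w)"
proof -
  have cc: "continuous_on {0..pi} c" using c by (rule DERIV_continuous_on)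
  let ?T = "\<lambda>q. Mul c q + Mul c' (Ip q)"
  have bl: "bounded_linear ?T"
    by (intro bounded_linear_add Mul_bounded_linear cc
        bounded_linear_compose[OF Mul_bounded_linear[OF c'] Ip_bounded_linear])
  have *: "H10 (\<lambda>x. c x * w x) \<and> H10.D (\<lambda>x. c x * w x) = ?T (H10.D w)" if w: "H10 w" for w
    unfolding H10.D_def
  proof (rule H10.J_unique)
    have w': "w x = prim (cls (d1 w)) x" if "x \<in> {0..pi}" for x
      using H10.P_J[OF w that] by (simp add: H10.D_def)
    have "prim (cls (d1 w)) pi = 0" using H10.D_K[OF w] by (simp add: H10.D_def)
    then show "?T (cls (d1 w)) \<in> {q. prim q pi = 0}"
      using prim_product[OF c c', of pi] by simp
    show "c x * w x = prim (?T (cls (d1 w))) x" if "x \<in> {0..pi}" for x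
      using prim_product[OF c c' that] w'[OF that] by simp
  qed
  then show "H10 w \<Longrightarrow> H10 (\<lambda>x. c x * w x)" by blast
  obtain C where "\<And>q. norm (?T q) \<le> norm q * C" using bounded_linear.bounded[OF bl] by blast
  then show "\<exists>C. \<forall>w. H10 w \<longrightarrow> norm (H10.D (\<lambda>x. c x * w x)) \<le> C * norm (H10.D w)"
    using * by (metis mult.commute)
qed

lemma H10_component:
  assumes "continuous_on {0..pi} \<sigma>" "\<And>x. x \<in> {0..pi} \<Longrightarrow> \<sigma> x > 0" "\<And>x. x \<in> {0..pi} \<Longrightarrow> \<rho> x > 0"
    and \<rho>: "\<And>x. x \<in> {0..pi} \<Longrightarrow> (\<rho> has_real_derivative \<rho>' x) (at x within {0..pi})"
    and \<rho>': "continuous_on {0..pi} \<rho>'"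
  shows "component H10 d1 prim {q. prim q pi = 0} \<sigma> \<rho>"
proof -
  have \<rho>c: "continuous_on {0..pi} \<rho>" using \<rho> by (rule DERIV_continuous_on)
  have i: "((\<lambda>x. 1 / \<rho> x) has_real_derivative - \<rho>' x / (\<rho> x)\<^sup>2) (at x within {0..pi})" if "x \<in> {0..pi}" for x
    using \<rho>[OF that] assms(3)[OF that] by (auto intro!: derivative_eq_intros simp: power2_eq_square)
  have i': "continuous_on {0..pi} (\<lambda>x. - \<rho>' x / (\<rho> x)\<^sup>2)"
    using assms(3) by (intro continuous_intros \<rho>' \<rho>c) fastforce
  show ?thesis
    using H10_multiplier[OF \<rho> \<rho>'] H10_multiplier[OF i i'] assms \<rho>c
    by unfold_locales auto
qed

lemma H2_component:
  assumes "c > 0"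
  shows "component H2 d2 J2 UNIV (\<lambda>x. c) (\<lambda>x. 1)"
proof -
  have "\<exists>C. \<forall>w. H2 w \<longrightarrow> norm (H2.D w) \<le> C * norm (H2.D w)" by (rule exI[of _ 1]) simp
  then show ?thesis using assms by unfold_locales auto
qed

section \<open>The hanger force on square-integrable functions\<close>

lemma L2_abs: "L2 u \<Longrightarrow> L2 (\<lambda>x. \<bar>u x\<bar>)" by (auto simp: L2_iff)

lemma L2_Phi:
  assumes k: "continuous_on {0..pi} \<kappa>" and r: "L2 r"
  shows "L2 (\<lambda>x. Phi \<kappa> M g x (r x))"
proof -
  let ?a = "\<lambda>x. \<kappa> x * r x + M * g / 2"
  have a: "L2 ?a" by (intro L2_add L2_continuous_mult k r L2_const)
  have "L2 (\<lambda>x. (1/2) * (?a x + \<bar>?a x\<bar>) - M * g / 2)"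
    by (intro L2_diff L2_scale L2_add a L2_abs L2_const)
  moreover have "(\<lambda>x. (1/2) * (?a x + \<bar>?a x\<bar>) - M * g / 2) = (\<lambda>x. Phi \<kappa> M g x (r x))"
    by (auto simp: Phi_def max_def)
  ultimately show ?thesis by simp
qed

text \<open>The Nemytskii, or superposition, operator of the hanger force.\<close>

definition Nem :: "(real \<Rightarrow> real) \<Rightarrow> real \<Rightarrow> real \<Rightarrow> l2 \<Rightarrow> l2" where
  "Nem \<kappa> M g r = cls (\<lambda>x. Phi \<kappa> M g x (rep r x))"

lemma Nem_cls:
  assumes k: "continuous_on {0..pi} \<kappa>" and r: "L2 r"
  shows "Nem \<kappa> M g (cls r) = cls (\<lambda>x. Phi \<kappa> M g x (r x))"
proof -
  have "AE x in lebI. Phi \<kappa> M g x (rep (cls r) x) = Phi \<kappa> M g x (r x)"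
    using rep_cls_AE[OF r] by eventually_elim simp
  then show ?thesis unfolding Nem_def by (simp only: cls_eq_iff L2_Phi k r L2_rep)
qed

text \<open>The positive part does not increase distances, so the pointwise Lipschitz constant is
  the stiffness, which is bounded on the compact interval.\<close>

lemma Nem_lip:
  assumes k: "continuous_on {0..pi} \<kappa>"
  shows "lip (Nem \<kappa> M g)"
proof -
  have "compact (\<kappa> ` {0..pi})" using k by (intro compact_continuous_image) auto
  then obtain K where K: "\<And>x. x \<in> {0..pi} \<Longrightarrow> \<bar>\<kappa> x\<bar> \<le> K"
    using compact_imp_bounded bounded_iff by (metis (no_types, lifting) imageI real_norm_def)
  have K0: "K \<ge> 0" using K[of 0] by auto
  have "K-lipschitz_on UNIV (Nem \<kappa> M g)"
  proof (rule lipschitz_onI[OF _ K0])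
    fix r t :: l2
    let ?f = "\<lambda>x. Phi \<kappa> M g x (rep r x) - Phi \<kappa> M g x (rep t x)"
    let ?h = "\<lambda>x. rep r x - rep t x"
    have L: "L2 ?f" "L2 ?h" by (intro L2_diff L2_Phi k L2_rep)+
    have "(norm (cls ?f))\<^sup>2 \<le> (K * norm (cls ?h))\<^sup>2"
    proof -
      have "(norm (cls ?f))\<^sup>2 = (LINT x|lebI. (?f x)\<^sup>2)" by (rule norm_cls_sq[OF L(1)])
      also have "\<dots> \<le> (LINT x|lebI. K\<^sup>2 * (?h x)\<^sup>2)"
      proof (rule integral_mono)
        show "integrable lebI (\<lambda>x. (?f x)\<^sup>2)" using L(1) by (simp only: L2_iff)
        show "integrable lebI (\<lambda>x. K\<^sup>2 * (?h x)\<^sup>2)" using L(2) by (simp add: L2_iff)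
        fix x assume x: "x \<in> space lebI"
        have "\<bar>?f x\<bar> \<le> \<bar>\<kappa> x * rep r x - \<kappa> x * rep t x\<bar>" unfolding Phi_def by linarith
        also have "\<dots> = \<bar>\<kappa> x\<bar> * \<bar>?h x\<bar>" by (simp add: abs_mult[symmetric] right_diff_distrib)
        also have "\<dots> \<le> K * \<bar>?h x\<bar>" using K[of x] x by (intro mult_right_mono) auto
        finally have "\<bar>?f x\<bar>\<^sup>2 \<le> (K * \<bar>?h x\<bar>)\<^sup>2" by (intro power_mono) auto
        then show "(?f x)\<^sup>2 \<le> K\<^sup>2 * (?h x)\<^sup>2" by (simp add: power_mult_distrib)
      qed
      also have "\<dots> = (K * norm (cls ?h))\<^sup>2" using norm_cls_sq[OF L(2)] by (simp add: power_mult_distrib)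
      finally show ?thesis .
    qed
    then have "norm (cls ?f) \<le> K * norm (cls ?h)" by (rule power2_le_imp_le) (use K0 in simp)
    then show "dist (Nem \<kappa> M g r) (Nem \<kappa> M g t) \<le> K * dist r t"
      by (simp add: dist_norm Nem_def cls_diff L2_Phi k)
  qed
  then show ?thesis unfolding lip_def ..
qed

lemma has_vector_derivative_prod_iff:
  "(f has_vector_derivative f') (at t within A) \<longleftrightarrow>
    ((\<lambda>t. fst (f t)) has_vector_derivative fst f') (at t within A) \<and> ((\<lambda>t. snd (f t)) has_vector_derivative snd f') (at t within A)"
proof
  assume "(f has_vector_derivative f') (at t within A)"
  then show "((\<lambda>t. fst (f t)) has_vector_derivative fst f') (at t within A) \<and> ((\<lambda>t. snd (f t)) has_vector_derivative snd f') (at t within A)"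
    by (auto intro: bounded_linear.has_vector_derivative[OF bounded_linear_fst]
        bounded_linear.has_vector_derivative[OF bounded_linear_snd])
next
  assume *: "((\<lambda>t. fst (f t)) has_vector_derivative fst f') (at t within A) \<and> ((\<lambda>t. snd (f t)) has_vector_derivative snd f') (at t within A)"
  then have "((\<lambda>t. (fst (f t), snd (f t))) has_vector_derivative (fst f', snd f')) (at t within A)"
    by (intro has_vector_derivative_Pair) auto
  then show "(f has_vector_derivative f') (at t within A)" by simp
qed

section \<open>The coupled system\<close>

text \<open>The order is ((p1, p2), (y, theta)); each entry is a pair of weighted strain and
  weighted velocity.\<close>

type_synonym state = "((l2 \<times> l2) \<times> (l2 \<times> l2)) \<times> ((l2 \<times> l2) \<times> (l2 \<times> l2))"

locale bridge =
  fixes m M g H0 EI GK l A E :: real and s1 s2 \<kappa> :: "real \<Rightarrow> real"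
  assumes m: "m > 0" and M: "M > 0" and H0: "H0 > 0" and EI: "EI > 0" and GK: "GK > 0" and l: "l > 0"
    and s1: "\<And>x. x \<in> {0..pi} \<Longrightarrow> (s1 has_real_derivative s2 x) (at x within {0..pi})"
    and s2: "continuous_on {0..pi} s2" and \<kappa>: "continuous_on {0..pi} \<kappa>"
begin

abbreviation "\<xi> \<equiv> xi s1"

lemma \<xi>_pos: "\<xi> x > 0"
  unfolding xi_def by (simp add: add_pos_nonneg)

lemma s1_c: "continuous_on {0..pi} s1" using s1 by (rule DERIV_continuous_on)

lemma \<xi>_c: "continuous_on {0..pi} \<xi>" unfolding xi_def by (intro continuous_intros s1_c)

text \<open>This derivative is continuous, which makes the cable density a multiplier on
  \<open>H10\<close>, as \<open>H10_component\<close> requires.\<close>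

lemma \<xi>_derivative:
  assumes "x \<in> {0..pi}"
  shows "(\<xi> has_real_derivative s1 x * s2 x / \<xi> x) (at x within {0..pi})"
proof -
  have p: "1 + (s1 x)\<^sup>2 > 0" by (simp add: add_pos_nonneg)
  have "((\<lambda>x. 1 + (s1 x)\<^sup>2) has_real_derivative 2 * s1 x * s2 x) (at x within {0..pi})"
    using s1[OF assms] by (auto intro!: derivative_eq_intros)
  from DERIV_chain2[OF DERIV_real_sqrt[OF p] this]
  have "((\<lambda>x. sqrt (1 + (s1 x)\<^sup>2)) has_real_derivative inverse (sqrt (1 + (s1 x)\<^sup>2)) / 2 * (2 * s1 x * s2 x)) (at x within {0..pi})" .
  moreover have "inverse (sqrt (1 + (s1 x)\<^sup>2)) / 2 * (2 * s1 x * s2 x) = s1 x * s2 x / \<xi> x"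
    by (simp add: xi_def field_simps)
  ultimately show ?thesis by (simp add: xi_def[abs_def])
qed

text \<open>The equations are divided by the constants \<open>m\<close>, \<open>M\<close> and \<open>M l\<^sup>2 / 3\<close>, so that the densities
  are \<open>\<xi>\<close> for the cables and 1 for the deck.\<close>

abbreviation "\<sigma>p \<equiv> \<lambda>x. H0 / (m * (\<xi> x)\<^sup>2)"
abbreviation "\<sigma>y \<equiv> \<lambda>x::real. EI / M"
abbreviation "\<sigma>t \<equiv> \<lambda>x::real. GK / (M / 3 * l\<^sup>2)"

sublocale cp: component H10 d1 prim "{q. prim q pi = 0}" \<sigma>p \<xi>
proof (rule H10_component)
  have nz: "\<xi> x \<noteq> 0" for x using \<xi>_pos[of x] by simp
  show "continuous_on {0..pi} \<sigma>p" using m nz by (intro continuous_intros \<xi>_c) auto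
  show "\<sigma>p x > 0" for x using m H0 \<xi>_pos[of x] by simp
  show "continuous_on {0..pi} (\<lambda>x. s1 x * s2 x / \<xi> x)" using nz by (intro continuous_intros s1_c s2 \<xi>_c) auto
qed (auto intro: \<xi>_pos \<xi>_derivative)

sublocale ct: component H10 d1 prim "{q. prim q pi = 0}" \<sigma>t "\<lambda>x. 1"
  by (rule H10_component[where \<rho>'="\<lambda>x. 0"]) (use M GK l in \<open>auto intro: derivative_eq_intros\<close>)

sublocale cy: component H2 d2 J2 UNIV \<sigma>y "\<lambda>x. 1"
  by (rule H2_component) (use M EI in simp)

definition aa :: real where "aa = A * E / integral {0..pi} \<xi>"

abbreviation "\<Phi> \<equiv> Phi \<kappa> M g"
abbreviation "N\<Phi> \<equiv> Nem \<kappa> M g"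
abbreviation "\<gamma> \<equiv> \<lambda>x. s2 x / (\<xi> x) ^ 3"

lemma \<gamma>_L2: "L2 \<gamma>"
  using \<xi>_pos by (intro L2_continuous continuous_intros s2 \<xi>_c) (metis less_irrefl power_eq_0_iff)

lemma s1\<xi>_L2: "L2 (\<lambda>x. s1 x / \<xi> x)"
  using \<xi>_pos by (intro L2_continuous continuous_intros s1_c \<xi>_c) (metis less_irrefl)

text \<open>The nonlocal tension coefficient of a cable as a bounded linear functional of its
  weighted strain.\<close>

definition Np :: "l2 \<Rightarrow> real" where "Np q = aa * (Mul cp.irs q \<bullet> cls (\<lambda>x. s1 x / \<xi> x))"

lemma Np_D:
  assumes u: "H10 u"
  shows "Np (Mul cp.rs (H10.D u)) = aa * integral {0..pi} (\<lambda>x. s1 x * d1 u x / \<xi> x)"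
proof -
  have "H10.D u \<bullet> cls (\<lambda>x. s1 x / \<xi> x) = ip2 (d1 u) (\<lambda>x. s1 x / \<xi> x)"
    unfolding H10.D_def by (rule inner_cls[OF H10.L2_d[OF u] s1\<xi>_L2])
  then show ?thesis by (simp only: Np_def cp.Mul_cancel ip2_def) (simp add: mult.commute)
qed

definition fp :: "(real \<Rightarrow> real) \<Rightarrow> (real \<Rightarrow> real) \<Rightarrow> real \<Rightarrow> real" where
  "fp u r x = (1 / m) * (aa * integral {0..pi} (\<lambda>x. s1 x * d1 u x / \<xi> x) * \<gamma> x + \<Phi> x (r x))"

definition fy :: "(real \<Rightarrow> real) \<Rightarrow> (real \<Rightarrow> real) \<Rightarrow> real \<Rightarrow> real" where
  "fy r1 r2 x = (- (1 / M)) * (\<Phi> x (r1 x) + \<Phi> x (r2 x))"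

definition ft :: "(real \<Rightarrow> real) \<Rightarrow> (real \<Rightarrow> real) \<Rightarrow> real \<Rightarrow> real" where
  "ft r1 r2 x = (1 / (M / 3 * l\<^sup>2)) * (l * \<Phi> x (r2 x) - l * \<Phi> x (r1 x))"

text \<open>The force density \<open>fp\<close> at the level of states. The division by
  \<open>\<surd>\<xi>\<close> comes from using the weighted velocity, \<surd>\<xi> times u_t, as
  unknown.\<close>

definition Fp :: "l2 \<Rightarrow> l2 \<Rightarrow> l2" where
  "Fp q r = Mul cp.irr ((1 / m) *\<^sub>R (Np q *\<^sub>R cls \<gamma> + N\<Phi> r))"

definition Fy :: "l2 \<Rightarrow> l2 \<Rightarrow> l2" where
  "Fy r1 r2 = Mul cy.irr ((- (1 / M)) *\<^sub>R (N\<Phi> r1 + N\<Phi> r2))"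

definition Ft :: "l2 \<Rightarrow> l2 \<Rightarrow> l2" where
  "Ft r1 r2 = Mul ct.irr ((1 / (M / 3 * l\<^sup>2)) *\<^sub>R (l *\<^sub>R N\<Phi> r2 - l *\<^sub>R N\<Phi> r1))"

lemmas LPhi = L2_Phi[OF \<kappa>, of _ M g] and NPhi = Nem_cls[OF \<kappa>, of _ M g]

lemma fp_cls:
  assumes "H10 u" "L2 r"
  shows "L2 (fp u r)"
    "cls (fp u r) = (1 / m) *\<^sub>R ((aa * integral {0..pi} (\<lambda>x. s1 x * d1 u x / \<xi> x)) *\<^sub>R cls \<gamma> + cls (\<lambda>x. \<Phi> x (r x)))"
    "Fp (Mul cp.rs (H10.D u)) (cls r) = Mul cp.irr (cls (fp u r))"
proof -
  let ?c = "aa * integral {0..pi} (\<lambda>x. s1 x * d1 u x / \<xi> x)"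
  have L: "L2 (\<lambda>x. ?c * \<gamma> x)" "L2 (\<lambda>x. \<Phi> x (r x))" using L2_scale[OF \<gamma>_L2] LPhi[OF assms(2)] by blast+
  show "L2 (fp u r)" unfolding fp_def[abs_def] by (intro L2_scale L2_add L)
  show e: "cls (fp u r) = (1 / m) *\<^sub>R (?c *\<^sub>R cls \<gamma> + cls (\<lambda>x. \<Phi> x (r x)))"
    unfolding fp_def[abs_def] by (simp only: cls_scale[OF L2_add[OF L]] cls_add[OF L] cls_scale[OF \<gamma>_L2])
  show "Fp (Mul cp.rs (H10.D u)) (cls r) = Mul cp.irr (cls (fp u r))"
    by (simp only: Fp_def e Np_D[OF assms(1)] NPhi[OF assms(2)])
qed

lemma fy_cls:
  assumes "L2 r1" "L2 r2"
  shows "L2 (fy r1 r2)"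
    "cls (fy r1 r2) = (- (1 / M)) *\<^sub>R cls (\<lambda>x. \<Phi> x (r1 x) + \<Phi> x (r2 x))"
    "Fy (cls r1) (cls r2) = Mul cy.irr (cls (fy r1 r2))"
proof -
  note L = LPhi[OF assms(1)] LPhi[OF assms(2)]
  show "L2 (fy r1 r2)" unfolding fy_def[abs_def] by (intro L2_scale L2_add L)
  show e: "cls (fy r1 r2) = (- (1 / M)) *\<^sub>R cls (\<lambda>x. \<Phi> x (r1 x) + \<Phi> x (r2 x))"
    unfolding fy_def[abs_def] by (rule cls_scale[OF L2_add[OF L]])
  show "Fy (cls r1) (cls r2) = Mul cy.irr (cls (fy r1 r2))"
    by (simp only: Fy_def e cls_add[OF L] NPhi assms)
qed

lemma ft_cls:
  assumes "L2 r1" "L2 r2"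
  shows "L2 (ft r1 r2)"
    "cls (ft r1 r2) = (1 / (M / 3 * l\<^sup>2)) *\<^sub>R cls (\<lambda>x. l * \<Phi> x (r2 x) - l * \<Phi> x (r1 x))"
    "Ft (cls r1) (cls r2) = Mul ct.irr (cls (ft r1 r2))"
proof -
  note L = L2_scale[OF LPhi[OF assms(2)], of l] L2_scale[OF LPhi[OF assms(1)], of l]
  show "L2 (ft r1 r2)" unfolding ft_def[abs_def] by (intro L2_scale L2_diff LPhi assms)
  show e: "cls (ft r1 r2) = (1 / (M / 3 * l\<^sup>2)) *\<^sub>R cls (\<lambda>x. l * \<Phi> x (r2 x) - l * \<Phi> x (r1 x))"
    unfolding ft_def[abs_def] by (rule cls_scale[OF L2_diff[OF L]])
  show "Ft (cls r1) (cls r2) = Mul ct.irr (cls (ft r1 r2))"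
    by (simp only: Ft_def e cls_diff[OF L] cls_scale[OF LPhi[OF assms(1)]] cls_scale[OF LPhi[OF assms(2)]] NPhi assms)
qed

text \<open>\<open>W\<close> is any real number, standing for the value of the dual pairing; the
  equivalence is therefore division by \<open>m\<close> and needs nothing about the second time
  derivative.\<close>

lemma equation_p:
  assumes u: "H10 u" and w: "H10 w" and r: "L2 r"
  shows "m * W + integral {0..pi} (\<lambda>x. H0 / (\<xi> x)\<^sup>2 * d1 u x * d1 w x)
      = aa * integral {0..pi} (\<lambda>x. s1 x * d1 u x / \<xi> x) * ip2 \<gamma> w + ip2 (\<lambda>x. \<Phi> x (r x)) w
    \<longleftrightarrow> W + ip2 (\<lambda>x. \<sigma>p x * d1 u x) (d1 w) = ip2 (fp u r) w"
proof -
  let ?I = "integral {0..pi} (\<lambda>x. H0 / (\<xi> x)\<^sup>2 * d1 u x * d1 w x)"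
  have "ip2 (\<lambda>x. \<sigma>p x * d1 u x) (d1 w) = integral {0..pi} (\<lambda>x. (1 / m) * (H0 / (\<xi> x)\<^sup>2 * d1 u x * d1 w x))"
    unfolding ip2_def by (intro integral_cong) simp
  then have 1: "ip2 (\<lambda>x. \<sigma>p x * d1 u x) (d1 w) = (1 / m) * ?I" by (simp only: integral_mult_right)
  let ?J = "aa * integral {0..pi} (\<lambda>x. s1 x * d1 u x / \<xi> x) * ip2 \<gamma> w + ip2 (\<lambda>x. \<Phi> x (r x)) w"
  have "ip2 (fp u r) w = cls (fp u r) \<bullet> cls w" by (rule inner_cls[OF fp_cls(1)[OF u r] H10.P_L2[OF w], symmetric])
  also have "\<dots> = (1 / m) * ?J"
    by (simp only: fp_cls(2)[OF u r] inner_scaleR_left inner_add_left inner_cls[OF \<gamma>_L2 H10.P_L2[OF w]]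
        inner_cls[OF LPhi[OF r] H10.P_L2[OF w]])
  finally show ?thesis using m unfolding 1 by (simp add: field_simps)
qed

lemma equation_y:
  assumes u: "H2 u" and w: "H2 w" and r: "L2 r1" "L2 r2"
  shows "M * W + EI * ip2 (d2 u) (d2 w) = - ip2 (\<lambda>x. \<Phi> x (r1 x) + \<Phi> x (r2 x)) w
    \<longleftrightarrow> W + ip2 (\<lambda>x. \<sigma>y x * d2 u x) (d2 w) = ip2 (fy r1 r2) w"
proof -
  have 1: "ip2 (\<lambda>x. \<sigma>y x * d2 u x) (d2 w) = EI / M * ip2 (d2 u) (d2 w)"
    unfolding ip2_def mult.assoc by (rule integral_mult_right)
  have "ip2 (fy r1 r2) w = cls (fy r1 r2) \<bullet> cls w" by (rule inner_cls[OF fy_cls(1)[OF r] H2.P_L2[OF w], symmetric])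
  also have "\<dots> = (- (1 / M)) * ip2 (\<lambda>x. \<Phi> x (r1 x) + \<Phi> x (r2 x)) w"
    by (simp only: fy_cls(2)[OF r] inner_scaleR_left inner_cls[OF L2_add[OF LPhi[OF r(1)] LPhi[OF r(2)]] H2.P_L2[OF w]])
  finally show ?thesis using M unfolding 1 by (simp add: field_simps)
qed

lemma equation_t:
  assumes u: "H10 u" and w: "H10 w" and r: "L2 r1" "L2 r2"
  shows "M / 3 * l\<^sup>2 * W + GK * ip2 (d1 u) (d1 w) = ip2 (\<lambda>x. l * \<Phi> x (r2 x) - l * \<Phi> x (r1 x)) w
    \<longleftrightarrow> W + ip2 (\<lambda>x. \<sigma>t x * d1 u x) (d1 w) = ip2 (ft r1 r2) w"
proof -
  define c where "c = M / 3 * l\<^sup>2"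
  have c: "c > 0" using M l by (simp add: c_def)
  have 1: "ip2 (\<lambda>x. GK / c * d1 u x) (d1 w) = GK / c * ip2 (d1 u) (d1 w)"
    unfolding ip2_def mult.assoc by (rule integral_mult_right)
  have "ip2 (ft r1 r2) w = cls (ft r1 r2) \<bullet> cls w" by (rule inner_cls[OF ft_cls(1)[OF r] H10.P_L2[OF w], symmetric])
  also have "\<dots> = (1 / c) * ip2 (\<lambda>x. l * \<Phi> x (r2 x) - l * \<Phi> x (r1 x)) w"
    by (simp only: ft_cls(2)[OF r] inner_scaleR_left c_def
        inner_cls[OF L2_diff[OF L2_scale[OF LPhi[OF r(2)]] L2_scale[OF LPhi[OF r(1)]]] H10.P_L2[OF w]])
  finally show ?thesis using c unfolding c_def[symmetric] 1 by (simp add: field_simps)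
qed

section \<open>The evolution equation for the full state\<close>

text \<open>The argument of the force in the first row of hangers, y + l theta - p1, read off from
  the state; \<open>R2\<close> is the one of the second row.\<close>

definition R1 :: "state \<Rightarrow> l2" where
  "R1 X = cy.posl (fst (fst (snd X))) + l *\<^sub>R ct.posl (fst (snd (snd X))) - cp.posl (fst (fst (fst X)))"

definition R2 :: "state \<Rightarrow> l2" where
  "R2 X = cy.posl (fst (fst (snd X))) - l *\<^sub>R ct.posl (fst (snd (snd X))) - cp.posl (fst (snd (fst X)))"

definition G :: "state \<Rightarrow> state" where
  "G X = (((0, Fp (fst (fst (fst X))) (R1 X)), (0, Fp (fst (snd (fst X))) (R2 X))),
          ((0, Fy (R1 X) (R2 X)), (0, Ft (R1 X) (R2 X))))"

definition B :: "state \<Rightarrow> state" where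
  "B X = ((cp.Bc (fst (fst X)), cp.Bc (snd (fst X))), (cy.Bc (fst (snd X)), ct.Bc (snd (snd X))))"

lemma R1_lip: "lip R1" and R2_lip: "lip R2"
  unfolding R1_def[abs_def] R2_def[abs_def]
  by (intro lip_add lip_diff lip_scaleR lip_linear
      bounded_linear_compose[OF cy.posl_bounded_linear] bounded_linear_compose[OF cp.posl_bounded_linear]
      bounded_linear_compose[OF ct.posl_bounded_linear] bounded_linear_compose[OF bounded_linear_fst]
      bounded_linear_compose[OF bounded_linear_snd] bounded_linear_fst bounded_linear_snd)+

lemma Fp_lip:
  assumes q: "bounded_linear q" and R: "lip R"
  shows "lip (\<lambda>X. Fp (q X) (R X))"
proof -
  have "bounded_linear (\<lambda>X. Np (q X) *\<^sub>R cls \<gamma>)"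
    unfolding Np_def
    by (intro bounded_linear_scaleR_const bounded_linear_const_mult bounded_linear_inner_left_comp
        bounded_linear_compose[OF cp.Mirs.bounded_linear_axioms] q)
  then show ?thesis unfolding Fp_def
    by (intro lip_linear_compose[OF cp.Mirr.bounded_linear_axioms] lip_scaleR lip_add lip_linear
        lip_compose[OF Nem_lip[OF \<kappa>] R])
qed

lemma Fy_lip: "lip (\<lambda>X. Fy (R1 X) (R2 X))" and Ft_lip: "lip (\<lambda>X. Ft (R1 X) (R2 X))"
  unfolding Fy_def Ft_def
  by (rule lip_linear_compose[OF Mul_bounded_linear[OF cy.irr_c]] lip_linear_compose[OF Mul_bounded_linear[OF ct.irr_c]],
      intro lip_scaleR lip_add lip_diff lip_compose[OF Nem_lip[OF \<kappa>] R1_lip] lip_compose[OF Nem_lip[OF \<kappa>] R2_lip])+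

lemma G_lip: "lip G"
  unfolding G_def[abs_def]
  by (intro lip_Pair lip_const Fp_lip R1_lip R2_lip Fy_lip Ft_lip
      bounded_linear_compose[OF bounded_linear_fst]
      bounded_linear_compose[OF bounded_linear_snd] bounded_linear_fst bounded_linear_snd)

definition LG :: real where "LG = (SOME L. L-lipschitz_on UNIV G)"

sublocale ev: skew_evolution B G LG
proof (rule skew_evolution.intro)
  show "bounded_linear B" unfolding B_def[abs_def]
    by (intro bounded_linear_Pair bounded_linear_compose[OF cp.Bc_bounded_linear]
        bounded_linear_compose[OF cy.Bc_bounded_linear] bounded_linear_compose[OF ct.Bc_bounded_linear]
        bounded_linear_compose[OF bounded_linear_fst]
        bounded_linear_compose[OF bounded_linear_snd] bounded_linear_fst bounded_linear_snd)
  show "B X \<bullet> Y = - (X \<bullet> B Y)" for X Y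
  proof -
    obtain X1 X2 X3 X4 where X: "X = ((X1, X2), (X3, X4))" by (metis prod.collapse)
    obtain Y1 Y2 Y3 Y4 where Y: "Y = ((Y1, Y2), (Y3, Y4))" by (metis prod.collapse)
    show ?thesis
      unfolding X Y B_def fst_conv snd_conv inner_Pair
      using cp.Bc_skew[of X1 Y1] cp.Bc_skew[of X2 Y2] cy.Bc_skew[of X3 Y3] ct.Bc_skew[of X4 Y4] by linarith
  qed
  show "LG-lipschitz_on UNIV G" using G_lip unfolding LG_def lip_def by (rule someI_ex)
qed

lemma B_mild:
  "((\<lambda>t. B (X t)) has_vector_derivative X t + B (G (X t))) (at t within Z) \<longleftrightarrow>
    (((\<lambda>t. cp.S (fst (fst (fst (X t))))) has_vector_derivative snd (fst (fst (X t)))) (at t within Z) \<and>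
     ((\<lambda>t. cp.S' (snd (fst (fst (X t))))) has_vector_derivative
        cp.S' (Fp (fst (fst (fst (X t)))) (R1 (X t))) - fst (fst (fst (X t)))) (at t within Z)) \<and>
    (((\<lambda>t. cp.S (fst (snd (fst (X t))))) has_vector_derivative snd (snd (fst (X t)))) (at t within Z) \<and>
     ((\<lambda>t. cp.S' (snd (snd (fst (X t))))) has_vector_derivative
        cp.S' (Fp (fst (snd (fst (X t)))) (R2 (X t))) - fst (snd (fst (X t)))) (at t within Z)) \<and>
    (((\<lambda>t. cy.S (fst (fst (snd (X t))))) has_vector_derivative snd (fst (snd (X t)))) (at t within Z) \<and>
     ((\<lambda>t. cy.S' (snd (fst (snd (X t))))) has_vector_derivative
        cy.S' (Fy (R1 (X t)) (R2 (X t))) - fst (fst (snd (X t)))) (at t within Z)) \<and>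
    (((\<lambda>t. ct.S (fst (snd (snd (X t))))) has_vector_derivative snd (snd (snd (X t)))) (at t within Z) \<and>
     ((\<lambda>t. ct.S' (snd (snd (snd (X t))))) has_vector_derivative
        ct.S' (Ft (R1 (X t)) (R2 (X t))) - fst (snd (snd (X t)))) (at t within Z))"
proof -
  note c = cp.Bc_mild[of "\<lambda>t. fst (fst (X t))" t "Fp (fst (fst (fst (X t)))) (R1 (X t))" Z, symmetric]
    cp.Bc_mild[of "\<lambda>t. snd (fst (X t))" t "Fp (fst (snd (fst (X t)))) (R2 (X t))" Z, symmetric]
    cy.Bc_mild[of "\<lambda>t. fst (snd (X t))" t "Fy (R1 (X t)) (R2 (X t))" Z, symmetric]
    ct.Bc_mild[of "\<lambda>t. snd (snd (X t))" t "Ft (R1 (X t)) (R2 (X t))" Z, symmetric]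
  show ?thesis
    unfolding c
    apply (subst has_vector_derivative_prod_iff[of "\<lambda>t. B (X t)"])
    apply (subst has_vector_derivative_prod_iff[of "\<lambda>t. fst (B (X t))"])
    apply (subst has_vector_derivative_prod_iff[of "\<lambda>t. snd (B (X t))"])
    by (simp only: B_def G_def fst_add snd_add fst_conv snd_conv conj_assoc)
qed

definition X0 :: "(real \<Rightarrow> real) \<Rightarrow> (real \<Rightarrow> real) \<Rightarrow> (real \<Rightarrow> real) \<Rightarrow> (real \<Rightarrow> real)
    \<Rightarrow> (real \<Rightarrow> real) \<Rightarrow> (real \<Rightarrow> real) \<Rightarrow> (real \<Rightarrow> real) \<Rightarrow> (real \<Rightarrow> real) \<Rightarrow> state" where
  "X0 y0 th0 p10 p20 y1 th1 p11 p21 =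
    (((Mul cp.rs (H10.D p10), Mul cp.rr (cls p11)), (Mul cp.rs (H10.D p20), Mul cp.rr (cls p21))),
     ((Mul cy.rs (H2.D y0), Mul cy.rr (cls y1)), (Mul ct.rs (H10.D th0), Mul ct.rr (cls th1))))"

lemma cls_position:
  assumes "H2 u" "H10 v" "H10 w"
  shows "L2 (\<lambda>x. u x + l * v x - w x)" "L2 (\<lambda>x. u x - l * v x - w x)"
    "cls (\<lambda>x. u x + l * v x - w x) = cy.posl (Mul cy.rs (H2.D u)) + l *\<^sub>R ct.posl (Mul ct.rs (H10.D v)) - cp.posl (Mul cp.rs (H10.D w))"
    "cls (\<lambda>x. u x - l * v x - w x) = cy.posl (Mul cy.rs (H2.D u)) - l *\<^sub>R ct.posl (Mul ct.rs (H10.D v)) - cp.posl (Mul cp.rs (H10.D w))"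
proof -
  note L = H2.P_L2[OF assms(1)] H10.P_L2[OF assms(2)] H10.P_L2[OF assms(3)]
  note L' = L2_add[OF L(1) L2_scale[OF L(2), of l]] L2_diff[OF L(1) L2_scale[OF L(2), of l]]
  note pd = cy.posl_D[OF assms(1)] ct.posl_D[OF assms(2)] cp.posl_D[OF assms(3)]
  show "L2 (\<lambda>x. u x + l * v x - w x)" "L2 (\<lambda>x. u x - l * v x - w x)"
    by (intro L2_diff L' L(3))+
  show "cls (\<lambda>x. u x + l * v x - w x) = cy.posl (Mul cy.rs (H2.D u)) + l *\<^sub>R ct.posl (Mul ct.rs (H10.D v)) - cp.posl (Mul cp.rs (H10.D w))"
    "cls (\<lambda>x. u x - l * v x - w x) = cy.posl (Mul cy.rs (H2.D u)) - l *\<^sub>R ct.posl (Mul ct.rs (H10.D v)) - cp.posl (Mul cp.rs (H10.D w))"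
    by (simp_all only: pd cls_diff[OF L'(1) L(3)] cls_diff[OF L'(2) L(3)] cls_add[OF L(1) L2_scale[OF L(2)]]
        cls_diff[OF L(1) L2_scale[OF L(2)]] cls_scale[OF L(2)])
qed

section \<open>Weak solutions as solutions of the state equation\<close>

text \<open>The last conclusion recovers the four functions pointwise from the strains, so equality
  of states yields equality at every point and not only almost everywhere.\<close>

lemma weak_imp_state:
  assumes ws: "weak_sol m M g H0 EI GK l A E s1 s2 \<kappa> y0 th0 p10 p20 y1 th1 p11 p21 T p1 p2 y th" and T: "T > 0"
    and init: "H2 y0" "H10 th0" "H10 p10" "H10 p20" "L2 y1" "L2 th1" "L2 p11" "L2 p21"
  obtains X where "continuous_on {0..T} X" "X 0 = X0 y0 th0 p10 p20 y1 th1 p11 p21"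
    "\<And>t. 0 < t \<Longrightarrow> t < T \<Longrightarrow> ((\<lambda>t. B (X t)) has_vector_derivative X t + B (G (X t))) (at t)"
    "\<And>t x. t \<in> {0..T} \<Longrightarrow> x \<in> {0..pi} \<Longrightarrow> p1 t x = cp.pos (fst (fst (fst (X t)))) x
      \<and> p2 t x = cp.pos (fst (snd (fst (X t)))) x \<and> y t x = cy.pos (fst (fst (snd (X t)))) x
      \<and> th t x = ct.pos (fst (snd (snd (X t)))) x"
proof -
  define r1 where "r1 t x = y t x + l * th t x - p1 t x" for t x
  define r2 where "r2 t x = y t x - l * th t x - p2 t x" for t x
  from ws[unfolded weak_sol_def Let_def reg1_greg reg2_greg, folded aa_def r1_def r2_def]
  obtain V1 W1 V2 W2 Vy Wy Vth Wth where
    reg: "greg H10 d1 T p1 V1 W1" "greg H10 d1 T p2 V2 W2" "greg H2 d2 T y Vy Wy" "greg H10 d1 T th Vth Wth"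
    and e1: "\<And>t v. t \<in> {0<..<T} \<Longrightarrow> H10 v \<Longrightarrow> m * W1 t (\<lambda>x. \<xi> x * v x)
            + integral {0..pi} (\<lambda>x. H0 / (\<xi> x)\<^sup>2 * d1 (p1 t) x * d1 v x)
          = aa * integral {0..pi} (\<lambda>x. s1 x * d1 (p1 t) x / \<xi> x) * ip2 \<gamma> v + ip2 (\<lambda>x. \<Phi> x (r1 t x)) v"
    and e2: "\<And>t v. t \<in> {0<..<T} \<Longrightarrow> H10 v \<Longrightarrow> m * W2 t (\<lambda>x. \<xi> x * v x)
            + integral {0..pi} (\<lambda>x. H0 / (\<xi> x)\<^sup>2 * d1 (p2 t) x * d1 v x)
          = aa * integral {0..pi} (\<lambda>x. s1 x * d1 (p2 t) x / \<xi> x) * ip2 \<gamma> v + ip2 (\<lambda>x. \<Phi> x (r2 t x)) v"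
    and e3: "\<And>t w. t \<in> {0<..<T} \<Longrightarrow> H2 w \<Longrightarrow> M * Wy t w + EI * ip2 (d2 (y t)) (d2 w)
          = - ip2 (\<lambda>x. \<Phi> x (r1 t x) + \<Phi> x (r2 t x)) w"
    and e4: "\<And>t v. t \<in> {0<..<T} \<Longrightarrow> H10 v \<Longrightarrow> M / 3 * l\<^sup>2 * Wth t v + GK * ip2 (d1 (th t)) (d1 v)
          = ip2 (\<lambda>x. l * \<Phi> x (r2 t x) - l * \<Phi> x (r1 t x)) v"
    and i0: "\<And>x. x \<in> {0..pi} \<Longrightarrow> y 0 x = y0 x \<and> th 0 x = th0 x \<and> p1 0 x = p10 x \<and> p2 0 x = p20 x"
    and i1: "norm2 (\<lambda>x. Vy 0 x - y1 x) = 0" "norm2 (\<lambda>x. Vth 0 x - th1 x) = 0"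
      "norm2 (\<lambda>x. V1 0 x - p11 x) = 0" "norm2 (\<lambda>x. V2 0 x - p21 x) = 0"
    by (elim exE conjE) (rule that, assumption, assumption, assumption, assumption, blast+)
  have H: "H10 (p1 t)" "H10 (p2 t)" "H2 (y t)" "H10 (th t)" "L2 (V1 t)" "L2 (V2 t)" "L2 (Vy t)" "L2 (Vth t)"
    if "t \<in> {0..T}" for t
    using greg_D[OF reg(1) that] greg_D[OF reg(2) that] greg_D[OF reg(3) that] greg_D[OF reg(4) that] by blast+
  have io: "t \<in> {0..T}" if "t \<in> {0<..<T}" for t using that by auto
  have Lr: "L2 (r1 t)" "L2 (r2 t)" if "t \<in> {0..T}" for t
    unfolding r1_def[abs_def] r2_def[abs_def] by (intro cls_position H that)+
  have w1: "W1 t (\<lambda>x. \<xi> x * w x) + ip2 (\<lambda>x. \<sigma>p x * d1 (p1 t) x) (d1 w) = ip2 (fp (p1 t) (r1 t)) w"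
    if "t \<in> {0<..<T}" "H10 w" for t w
    using e1[OF that] by (simp only: equation_p[OF H(1)[OF io[OF that(1)]] that(2) Lr(1)[OF io[OF that(1)]]])
  have w2: "W2 t (\<lambda>x. \<xi> x * w x) + ip2 (\<lambda>x. \<sigma>p x * d1 (p2 t) x) (d1 w) = ip2 (fp (p2 t) (r2 t)) w"
    if "t \<in> {0<..<T}" "H10 w" for t w
    using e2[OF that] by (simp only: equation_p[OF H(2)[OF io[OF that(1)]] that(2) Lr(2)[OF io[OF that(1)]]])
  \<comment> \<open>The factor 1 is the density of the deck, written out to match the form of the
    test function \<open>\<rho> x * w x\<close> in \<open>weak_imp_mild\<close>.\<close>
  have w3: "Wy t (\<lambda>x. 1 * w x) + ip2 (\<lambda>x. \<sigma>y x * d2 (y t) x) (d2 w) = ip2 (fy (r1 t) (r2 t)) w"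
    if "t \<in> {0<..<T}" "H2 w" for t w
    using e3[OF that] by (simp only: mult_1 equation_y[OF H(3)[OF io[OF that(1)]] that(2) Lr[OF io[OF that(1)]]])
  have w4: "Wth t (\<lambda>x. 1 * w x) + ip2 (\<lambda>x. \<sigma>t x * d1 (th t) x) (d1 w) = ip2 (ft (r1 t) (r2 t)) w"
    if "t \<in> {0<..<T}" "H10 w" for t w
    using e4[OF that] by (simp only: mult_1 equation_t[OF H(4)[OF io[OF that(1)]] that(2) Lr[OF io[OF that(1)]]])
  have f1: "\<forall>t\<in>{0<..<T}. L2 (fp (p1 t) (r1 t))"
    by (rule ballI) (rule fp_cls(1)[OF H(1)[OF io] Lr(1)[OF io]])
  have w1': "\<forall>t\<in>{0<..<T}. \<forall>w. H10 w \<longrightarrow> W1 t (\<lambda>x. \<xi> x * w x) + ip2 (\<lambda>x. \<sigma>p x * d1 (p1 t) x) (d1 w) = ip2 (fp (p1 t) (r1 t)) w" using w1 by blast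
  note m1 = cp.weak_imp_mild[OF reg(1) f1 w1']
  have f2: "\<forall>t\<in>{0<..<T}. L2 (fp (p2 t) (r2 t))"
    by (rule ballI) (rule fp_cls(1)[OF H(2)[OF io] Lr(2)[OF io]])
  have w2': "\<forall>t\<in>{0<..<T}. \<forall>w. H10 w \<longrightarrow> W2 t (\<lambda>x. \<xi> x * w x) + ip2 (\<lambda>x. \<sigma>p x * d1 (p2 t) x) (d1 w) = ip2 (fp (p2 t) (r2 t)) w" using w2 by blast
  note m2 = cp.weak_imp_mild[OF reg(2) f2 w2']
  have f3: "\<forall>t\<in>{0<..<T}. L2 (fy (r1 t) (r2 t))"
    by (rule ballI) (rule fy_cls(1)[OF Lr(1)[OF io] Lr(2)[OF io]])
  have w3': "\<forall>t\<in>{0<..<T}. \<forall>w. H2 w \<longrightarrow> Wy t (\<lambda>x. 1 * w x) + ip2 (\<lambda>x. \<sigma>y x * d2 (y t) x) (d2 w) = ip2 (fy (r1 t) (r2 t)) w" using w3 by blast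
  note m3 = cy.weak_imp_mild[OF reg(3) f3 w3']
  have f4: "\<forall>t\<in>{0<..<T}. L2 (ft (r1 t) (r2 t))"
    by (rule ballI) (rule ft_cls(1)[OF Lr(1)[OF io] Lr(2)[OF io]])
  have w4': "\<forall>t\<in>{0<..<T}. \<forall>w. H10 w \<longrightarrow> Wth t (\<lambda>x. 1 * w x) + ip2 (\<lambda>x. \<sigma>t x * d1 (th t) x) (d1 w) = ip2 (ft (r1 t) (r2 t)) w" using w4 by blast
  note m4 = ct.weak_imp_mild[OF reg(4) f4 w4']
  define X where "X t = (((Mul cp.rs (H10.D (p1 t)), Mul cp.rr (cls (V1 t))), (Mul cp.rs (H10.D (p2 t)), Mul cp.rr (cls (V2 t)))),
     ((Mul cy.rs (H2.D (y t)), Mul cy.rr (cls (Vy t))), (Mul ct.rs (H10.D (th t)), Mul ct.rr (cls (Vth t)))))" for t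
  have R: "R1 (X t) = cls (r1 t)" "R2 (X t) = cls (r2 t)" if "t \<in> {0..T}" for t
    unfolding R1_def R2_def X_def fst_conv snd_conv r1_def[abs_def] r2_def[abs_def]
    by (simp_all only: cls_position H that)
  show thesis
  proof (rule that)
    show "continuous_on {0..T} X" unfolding X_def[abs_def]
      by (intro continuous_on_Pair m1(1,2) m2(1,2) m3(1,2) m4(1,2))
    have z: "0 \<in> {0..T}" using T by simp
    have v0: "cls u = cls w" if "L2 u" "L2 w" "norm2 (\<lambda>x. u x - w x) = 0" for u w
      using norm_cls[OF L2_diff[OF that(1,2)]] that by (simp add: cls_diff)
    have "H10.D (p1 0) = H10.D p10" "H10.D (p2 0) = H10.D p20" "H2.D (y 0) = H2.D y0" "H10.D (th 0) = H10.D th0"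
      using i0 H10.P_cong(2)[OF init(3), of "p1 0"] H10.P_cong(2)[OF init(4), of "p2 0"]
        H2.P_cong(2)[OF init(1), of "y 0"] H10.P_cong(2)[OF init(2), of "th 0"] by auto
    then show "X 0 = X0 y0 th0 p10 p20 y1 th1 p11 p21"
      unfolding X_def X0_def
      by (simp only: v0[OF H(5)[OF z] init(7) i1(3)] v0[OF H(6)[OF z] init(8) i1(4)]
          v0[OF H(7)[OF z] init(5) i1(1)] v0[OF H(8)[OF z] init(6) i1(2)])
    show "((\<lambda>t. B (X t)) has_vector_derivative X t + B (G (X t))) (at t)" if "0 < t" "t < T" for t
    proof -
      have t: "t \<in> {0<..<T}" "t \<in> {0..T}" using that by auto
      have a: "at t within {0..T} = at t" using that by (intro at_within_interior) auto
      show ?thesis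
        unfolding B_mild R[OF t(2)]
        unfolding X_def fst_conv snd_conv fp_cls(3)[OF H(1)[OF t(2)] Lr(1)[OF t(2)]]
          fp_cls(3)[OF H(2)[OF t(2)] Lr(2)[OF t(2)]] fy_cls(3)[OF Lr[OF t(2)]] ft_cls(3)[OF Lr[OF t(2)]]
        using m1(3)[OF t(2)] m1(4)[OF t(1)] m2(3)[OF t(2)] m2(4)[OF t(1)]
          m3(3)[OF t(2)] m3(4)[OF t(1)] m4(3)[OF t(2)] m4(4)[OF t(1)] unfolding a
        by (intro conjI)
    qed
    show "p1 t x = cp.pos (fst (fst (fst (X t)))) x \<and> p2 t x = cp.pos (fst (snd (fst (X t)))) x
        \<and> y t x = cy.pos (fst (fst (snd (X t)))) x \<and> th t x = ct.pos (fst (snd (snd (X t)))) x"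
      if "t \<in> {0..T}" "x \<in> {0..pi}" for t x
      unfolding X_def fst_conv snd_conv
      using H[OF that(1)] that(2) by (simp only: cp.pos_D cy.pos_D ct.pos_D)
  qed
qed

lemma state_imp_weak:
  assumes X: "X 0 = X0 y0 th0 p10 p20 y1 th1 p11 p21" "continuous_on {0..} X"
    and dX: "\<And>t. t \<ge> 0 \<Longrightarrow> ((\<lambda>t. B (X t)) has_vector_derivative X t + B (G (X t))) (at t within {0..})"
    and init: "H2 y0" "H10 th0" "H10 p10" "H10 p20" "L2 y1" "L2 th1" "L2 p11" "L2 p21" and T: "T > 0"
  shows "weak_sol m M g H0 EI GK l A E s1 s2 \<kappa> y0 th0 p10 p20 y1 th1 p11 p21 T
    (\<lambda>t. cp.pos (fst (fst (fst (X t))))) (\<lambda>t. cp.pos (fst (snd (fst (X t)))))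
    (\<lambda>t. cy.pos (fst (fst (snd (X t))))) (\<lambda>t. ct.pos (fst (snd (snd (X t)))))"
proof -
  let ?q1 = "\<lambda>t. fst (fst (fst (X t)))" and ?q2 = "\<lambda>t. fst (snd (fst (X t)))"
  let ?q3 = "\<lambda>t. fst (fst (snd (X t)))" and ?q4 = "\<lambda>t. fst (snd (snd (X t)))"
  let ?p1 = "\<lambda>t. cp.pos (?q1 t)" and ?p2 = "\<lambda>t. cp.pos (?q2 t)"
  let ?y = "\<lambda>t. cy.pos (?q3 t)" and ?th = "\<lambda>t. ct.pos (?q4 t)"
  \<comment> \<open>At positive times the constraint on the strains follows from the equation by
    pairing with the kernel, which uses a two-sided derivative. At time 0 it is read off from the
    initial data.\<close>
  have K: "?q1 t \<in> cp.KK \<and> ?q2 t \<in> cp.KK \<and> ?q3 t \<in> cy.KK \<and> ?q4 t \<in> ct.KK" if "t \<ge> 0" for t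
  proof (cases "t = 0")
    case True
    then show ?thesis using X(1) init by (simp only: X0_def fst_conv snd_conv cp.KK_D cy.KK_D ct.KK_D)
  next
    case False
    then have "((\<lambda>t. B (X t)) has_vector_derivative X t + B (G (X t))) (at t)"
      using that by (intro interior_derivative dX) auto
    then show ?thesis
      unfolding B_mild by (elim conjE) (intro conjI; rule cp.mild_KK cy.mild_KK ct.mild_KK; assumption)
  qed
  define r1 where "r1 t x = ?y t x + l * ?th t x - ?p1 t x" for t x
  define r2 where "r2 t x = ?y t x - l * ?th t x - ?p2 t x" for t x
  have Kc: "?q1 t \<in> cp.KK" "?q2 t \<in> cp.KK" "?q3 t \<in> cy.KK" "?q4 t \<in> ct.KK" if "t \<in> {0..T}" for t
    using K[of t] that by auto
  have H: "H10 (?p1 t)" "H10 (?p2 t)" "H2 (?y t)" "H10 (?th t)" if "t \<in> {0..T}" for t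
    by (rule cp.pos(1)[OF Kc(1)[OF that]] cp.pos(1)[OF Kc(2)[OF that]] cy.pos(1)[OF Kc(3)[OF that]] ct.pos(1)[OF Kc(4)[OF that]])+
  have q: "?q1 t = Mul cp.rs (H10.D (?p1 t))" "?q2 t = Mul cp.rs (H10.D (?p2 t))"
    "?q3 t = Mul cy.rs (H2.D (?y t))" "?q4 t = Mul ct.rs (H10.D (?th t))" if "t \<in> {0..T}" for t
    by (simp_all only: cp.pos(3)[OF Kc(1)[OF that]] cp.pos(3)[OF Kc(2)[OF that]] cy.pos(3)[OF Kc(3)[OF that]] ct.pos(3)[OF Kc(4)[OF that]])
  have Lr: "L2 (r1 t)" "L2 (r2 t)" if "t \<in> {0..T}" for t
    unfolding r1_def[abs_def] r2_def[abs_def] by (intro cls_position H that)+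
  have R: "R1 (X t) = cls (r1 t)" "R2 (X t) = cls (r2 t)" if "t \<in> {0..T}" for t
    unfolding R1_def R2_def r1_def[abs_def] r2_def[abs_def]
    by (simp_all only: cls_position H that q(1)[OF that, symmetric] q(2)[OF that, symmetric]
        q(3)[OF that, symmetric] q(4)[OF that, symmetric])
  have Xc: "continuous_on {0..T} X" by (rule continuous_on_subset[OF X(2)]) auto
  have lc: "continuous_on UNIV h" if "lip h" for h :: "state \<Rightarrow> l2"
    using that lipschitz_on_continuous_on unfolding lip_def by blast
  have F1c: "continuous_on {0..T} (\<lambda>t. Fp (?q1 t) (R1 (X t)))"
    by (rule continuous_on_compose2[OF lc[OF Fp_lip[OF _ R1_lip]] Xc, of "\<lambda>X. fst (fst (fst X))"])
       (auto intro!: bounded_linear_compose[OF bounded_linear_fst] bounded_linear_fst)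
  have F2c: "continuous_on {0..T} (\<lambda>t. Fp (?q2 t) (R2 (X t)))"
    by (rule continuous_on_compose2[OF lc[OF Fp_lip[OF _ R2_lip]] Xc, of "\<lambda>X. fst (snd (fst X))"])
       (auto intro!: bounded_linear_compose[OF bounded_linear_fst] bounded_linear_compose[OF bounded_linear_snd] bounded_linear_fst)
  have F3c: "continuous_on {0..T} (\<lambda>t. Fy (R1 (X t)) (R2 (X t)))"
    by (rule continuous_on_compose2[OF lc[OF Fy_lip] Xc]) auto
  have F4c: "continuous_on {0..T} (\<lambda>t. Ft (R1 (X t)) (R2 (X t)))"
    by (rule continuous_on_compose2[OF lc[OF Ft_lip] Xc]) auto
  have D: "((\<lambda>t. B (X t)) has_vector_derivative X t + B (G (X t))) (at t within {0..T})" if "t \<in> {0..T}" for t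
    using that by (intro has_vector_derivative_within_subset[OF dX]) auto
  note D' = D[unfolded B_mild]
  obtain W1 where W1: "greg H10 d1 T ?p1 (\<lambda>t. rep (Mul cp.irr (snd (fst (fst (X t)))))) W1"
    "\<And>t w. t \<in> {0..T} \<Longrightarrow> H10 w \<Longrightarrow> W1 t (\<lambda>x. \<xi> x * w x) + ip2 (\<lambda>x. \<sigma>p x * d1 (?p1 t) x) (d1 w) = Mul cp.rr (Fp (?q1 t) (R1 (X t))) \<bullet> cls w"
    by (rule cp.mild_imp_weak[of T ?q1 "\<lambda>t. snd (fst (fst (X t)))" "\<lambda>t. Fp (?q1 t) (R1 (X t))"])
       (use Kc D' F1c in \<open>auto intro!: continuous_intros Xc\<close>)
  obtain W2 where W2: "greg H10 d1 T ?p2 (\<lambda>t. rep (Mul cp.irr (snd (snd (fst (X t)))))) W2"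
    "\<And>t w. t \<in> {0..T} \<Longrightarrow> H10 w \<Longrightarrow> W2 t (\<lambda>x. \<xi> x * w x) + ip2 (\<lambda>x. \<sigma>p x * d1 (?p2 t) x) (d1 w) = Mul cp.rr (Fp (?q2 t) (R2 (X t))) \<bullet> cls w"
    by (rule cp.mild_imp_weak[of T ?q2 "\<lambda>t. snd (snd (fst (X t)))" "\<lambda>t. Fp (?q2 t) (R2 (X t))"])
       (use Kc D' F2c in \<open>auto intro!: continuous_intros Xc\<close>)
  obtain W3 where W3: "greg H2 d2 T ?y (\<lambda>t. rep (Mul cy.irr (snd (fst (snd (X t)))))) W3"
    "\<And>t w. t \<in> {0..T} \<Longrightarrow> H2 w \<Longrightarrow> W3 t (\<lambda>x. 1 * w x) + ip2 (\<lambda>x. \<sigma>y x * d2 (?y t) x) (d2 w) = Mul cy.rr (Fy (R1 (X t)) (R2 (X t))) \<bullet> cls w"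
    by (rule cy.mild_imp_weak[of T ?q3 "\<lambda>t. snd (fst (snd (X t)))" "\<lambda>t. Fy (R1 (X t)) (R2 (X t))"])
       (use Kc D' F3c in \<open>auto intro!: continuous_intros Xc\<close>)
  obtain W4 where W4: "greg H10 d1 T ?th (\<lambda>t. rep (Mul ct.irr (snd (snd (snd (X t)))))) W4"
    "\<And>t w. t \<in> {0..T} \<Longrightarrow> H10 w \<Longrightarrow> W4 t (\<lambda>x. 1 * w x) + ip2 (\<lambda>x. \<sigma>t x * d1 (?th t) x) (d1 w) = Mul ct.rr (Ft (R1 (X t)) (R2 (X t))) \<bullet> cls w"
    by (rule ct.mild_imp_weak[of T ?q4 "\<lambda>t. snd (snd (snd (X t)))" "\<lambda>t. Ft (R1 (X t)) (R2 (X t))"])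
       (use Kc D' F4c in \<open>auto intro!: continuous_intros Xc\<close>)
  have io: "t \<in> {0..T}" if "t \<in> {0<..<T}" for t using that by auto
  have fp1: "Mul cp.rr (Fp (?q1 t) (R1 (X t))) \<bullet> cls w = ip2 (fp (?p1 t) (r1 t)) w" if t: "t \<in> {0..T}" and w: "H10 w" for t w
    unfolding R[OF t] by (subst q(1)[OF t])
      (simp only: fp_cls(3)[OF H(1)[OF t] Lr(1)[OF t]] cp.Mul_cancel inner_cls[OF fp_cls(1)[OF H(1)[OF t] Lr(1)[OF t]] H10.P_L2[OF w]])
  have fp2: "Mul cp.rr (Fp (?q2 t) (R2 (X t))) \<bullet> cls w = ip2 (fp (?p2 t) (r2 t)) w" if t: "t \<in> {0..T}" and w: "H10 w" for t w
    unfolding R[OF t] by (subst q(2)[OF t])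
      (simp only: fp_cls(3)[OF H(2)[OF t] Lr(2)[OF t]] cp.Mul_cancel inner_cls[OF fp_cls(1)[OF H(2)[OF t] Lr(2)[OF t]] H10.P_L2[OF w]])
  have fy: "Mul cy.rr (Fy (R1 (X t)) (R2 (X t))) \<bullet> cls w = ip2 (fy (r1 t) (r2 t)) w" if t: "t \<in> {0..T}" and w: "H2 w" for t w
    unfolding R[OF t] fy_cls(3)[OF Lr[OF t]] cy.Mul_cancel by (rule inner_cls[OF fy_cls(1)[OF Lr[OF t]] H2.P_L2[OF w]])
  have ft: "Mul ct.rr (Ft (R1 (X t)) (R2 (X t))) \<bullet> cls w = ip2 (ft (r1 t) (r2 t)) w" if t: "t \<in> {0..T}" and w: "H10 w" for t w
    unfolding R[OF t] ft_cls(3)[OF Lr[OF t]] ct.Mul_cancel by (rule inner_cls[OF ft_cls(1)[OF Lr[OF t]] H10.P_L2[OF w]])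
  have e1: "m * W1 t (\<lambda>x. \<xi> x * w x) + integral {0..pi} (\<lambda>x. H0 / (\<xi> x)\<^sup>2 * d1 (?p1 t) x * d1 w x)
          = aa * integral {0..pi} (\<lambda>x. s1 x * d1 (?p1 t) x / \<xi> x) * ip2 \<gamma> w + ip2 (\<lambda>x. \<Phi> x (r1 t x)) w"
    if "t \<in> {0<..<T}" and w: "H10 w" for t w
    unfolding equation_p[OF H(1)[OF io[OF that(1)]] w Lr(1)[OF io[OF that(1)]]]
    using W1(2)[OF io[OF that(1)] w] fp1[OF io[OF that(1)] w] by (simp only:)
  have e2: "m * W2 t (\<lambda>x. \<xi> x * w x) + integral {0..pi} (\<lambda>x. H0 / (\<xi> x)\<^sup>2 * d1 (?p2 t) x * d1 w x)
          = aa * integral {0..pi} (\<lambda>x. s1 x * d1 (?p2 t) x / \<xi> x) * ip2 \<gamma> w + ip2 (\<lambda>x. \<Phi> x (r2 t x)) w"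
    if "t \<in> {0<..<T}" and w: "H10 w" for t w
    unfolding equation_p[OF H(2)[OF io[OF that(1)]] w Lr(2)[OF io[OF that(1)]]]
    using W2(2)[OF io[OF that(1)] w] fp2[OF io[OF that(1)] w] by (simp only:)
  have e3: "M * W3 t w + EI * ip2 (d2 (?y t)) (d2 w) = - ip2 (\<lambda>x. \<Phi> x (r1 t x) + \<Phi> x (r2 t x)) w"
    if "t \<in> {0<..<T}" and w: "H2 w" for t w
    unfolding equation_y[OF H(3)[OF io[OF that(1)]] w Lr[OF io[OF that(1)]]]
    using W3(2)[OF io[OF that(1)] w] fy[OF io[OF that(1)] w] by (simp only: mult_1)
  have e4: "M / 3 * l\<^sup>2 * W4 t w + GK * ip2 (d1 (?th t)) (d1 w) = ip2 (\<lambda>x. l * \<Phi> x (r2 t x) - l * \<Phi> x (r1 t x)) w"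
    if "t \<in> {0<..<T}" and w: "H10 w" for t w
    unfolding equation_t[OF H(4)[OF io[OF that(1)]] w Lr[OF io[OF that(1)]]]
    using W4(2)[OF io[OF that(1)] w] ft[OF io[OF that(1)] w] by (simp only: mult_1)
  have i0: "?y 0 x = y0 x \<and> ?th 0 x = th0 x \<and> ?p1 0 x = p10 x \<and> ?p2 0 x = p20 x" if "x \<in> {0..pi}" for x
    unfolding X(1) X0_def fst_conv snd_conv using init that by (simp only: cp.pos_D cy.pos_D ct.pos_D)
  have v0: "norm2 (\<lambda>x. rep q x - w x) = 0" if "L2 w" "q = cls w" for q w
    using norm_cls[OF L2_diff[OF L2_rep that(1)], of q] that by (simp add: cls_diff)
  have i1: "norm2 (\<lambda>x. rep (Mul cy.irr (snd (fst (snd (X 0))))) x - y1 x) = 0"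
    "norm2 (\<lambda>x. rep (Mul ct.irr (snd (snd (snd (X 0))))) x - th1 x) = 0"
    "norm2 (\<lambda>x. rep (Mul cp.irr (snd (fst (fst (X 0))))) x - p11 x) = 0"
    "norm2 (\<lambda>x. rep (Mul cp.irr (snd (snd (fst (X 0))))) x - p21 x) = 0"
    unfolding X(1) X0_def fst_conv snd_conv cp.Mul_cancel cy.Mul_cancel ct.Mul_cancel
    by (rule v0, (rule init, rule refl))+
  show ?thesis
    unfolding weak_sol_def Let_def reg1_greg reg2_greg aa_def[symmetric] r1_def[symmetric] r2_def[symmetric]
    by (rule exI[of _ "\<lambda>t. rep (Mul cp.irr (snd (fst (fst (X t)))))"], rule exI[of _ W1],
        rule exI[of _ "\<lambda>t. rep (Mul cp.irr (snd (snd (fst (X t)))))"], rule exI[of _ W2],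
        rule exI[of _ "\<lambda>t. rep (Mul cy.irr (snd (fst (snd (X t)))))"], rule exI[of _ W3],
        rule exI[of _ "\<lambda>t. rep (Mul ct.irr (snd (snd (snd (X t)))))"], rule exI[of _ W4])
       (intro conjI ballI allI impI W1(1) W2(1) W3(1) W4(1) e1 e2 e3 e4 i1, use i0 in \<open>simp_all only:\<close>)
qed

text \<open>Every initial datum of the theorem is admissible for the abstract existence result:
  kernel elements have no velocity component, and the strains of the data are orthogonal to the
  kernels of the reconstruction operators.\<close>

lemma X0_closure:
  assumes init: "H2 y0" "H10 th0" "H10 p10" "H10 p20"
  shows "X0 y0 th0 p10 p20 y1 th1 p11 p21 \<in> closure (range B)"
proof (rule ev.orthogonal_kernel_closure)
  fix k assume k: "B k = 0"
  obtain k1 k2 k3 k4 where ks: "k = ((k1, k2), (k3, k4))" by (metis prod.collapse)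
  have "cp.Bc k1 = 0" "cp.Bc k2 = 0" "cy.Bc k3 = 0" "ct.Bc k4 = 0"
    using k unfolding ks B_def fst_conv snd_conv zero_prod_def[where 'a="(l2 \<times> l2) \<times> (l2 \<times> l2)"]
      zero_prod_def[where 'a="l2 \<times> l2"] prod.inject by blast+
  note z = cp.Bc_kernel[OF this(1), of "(Mul cp.rs (H10.D p10), Mul cp.rr (cls p11))"]
    cp.Bc_kernel[OF this(2), of "(Mul cp.rs (H10.D p20), Mul cp.rr (cls p21))"]
    cy.Bc_kernel[OF this(3), of "(Mul cy.rs (H2.D y0), Mul cy.rr (cls y1))"]
    ct.Bc_kernel[OF this(4), of "(Mul ct.rs (H10.D th0), Mul ct.rr (cls th1))"]
  show "X0 y0 th0 p10 p20 y1 th1 p11 p21 \<bullet> k = 0"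
    unfolding ks X0_def inner_Pair[of "(_, _)" "(_, _)" "(k1, k2)"] inner_Pair[of _ _ k1] inner_Pair[of _ _ k3]
      z(1)[unfolded fst_conv, OF cp.KK_D[OF init(3)]] z(2)[unfolded fst_conv, OF cp.KK_D[OF init(4)]]
      z(3)[unfolded fst_conv, OF cy.KK_D[OF init(1)]] z(4)[unfolded fst_conv, OF ct.KK_D[OF init(2)]]
    by simp
qed

end

theorem theorem2:
  fixes m M g H0 EI GK l A E s0 :: real
    and s s1 s2 \<kappa> :: "real \<Rightarrow> real"
    and y0 th0 p10 p20 y1 th1 p11 p21 :: "real \<Rightarrow> real"
  assumes "m > 0" "M > 0" "g > 0" "H0 > 0" "EI > 0" "GK > 0" "l > 0" "A > 0" "E > 0"
    and "\<forall>x\<in>{0..pi}. (s has_real_derivative s1 x) (at x within {0..pi})"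
    and "\<forall>x\<in>{0..pi}. (s1 has_real_derivative s2 x) (at x within {0..pi})"
    and "continuous_on {0..pi} s2"
    and "\<forall>x\<in>{0<..<pi}. H0 * s2 x = (M / 2 + m * sqrt (1 + (s1 x)\<^sup>2)) * g"
    and "s 0 = s0" "s pi = s0"
    and "continuous_on {0..pi} \<kappa>" "\<forall>x\<in>{0..pi}. \<kappa> x > 0"
    and "H2 y0" "H10 th0" "H10 p10" "H10 p20"
    and "L2 y1" "L2 th1" "L2 p11" "L2 p21"
  shows "\<exists>p1 p2 y th.
           (\<forall>T>0. weak_sol m M g H0 EI GK l A E s1 s2 \<kappa> y0 th0 p10 p20 y1 th1 p11 p21 T p1 p2 y th) \<and>
           (\<forall>T>0. \<forall>q1 q2 z ph.
              weak_sol m M g H0 EI GK l A E s1 s2 \<kappa> y0 th0 p10 p20 y1 th1 p11 p21 T q1 q2 z ph \<longrightarrow>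
              (\<forall>t\<in>{0..T}. \<forall>x\<in>{0..pi}.
                 q1 t x = p1 t x \<and> q2 t x = p2 t x \<and> z t x = y t x \<and> ph t x = th t x))"
proof -
  interpret bridge m M g H0 EI GK l A E s1 s2 \<kappa>
    using assms by unfold_locales auto
  note init = \<open>H2 y0\<close> \<open>H10 th0\<close> \<open>H10 p10\<close> \<open>H10 p20\<close> \<open>L2 y1\<close> \<open>L2 th1\<close> \<open>L2 p11\<close> \<open>L2 p21\<close>
  obtain X where X: "X 0 = X0 y0 th0 p10 p20 y1 th1 p11 p21" "continuous_on {0..} X"
    and dX: "\<And>t. t \<ge> 0 \<Longrightarrow> ((\<lambda>t. B (X t)) has_vector_derivative X t + B (G (X t))) (at t within {0..})"
    using ev.exists_solution[OF X0_closure[OF init(1-4)]] by blast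
  let ?p1 = "\<lambda>t. cp.pos (fst (fst (fst (X t))))" and ?p2 = "\<lambda>t. cp.pos (fst (snd (fst (X t))))"
  let ?y = "\<lambda>t. cy.pos (fst (fst (snd (X t))))" and ?th = "\<lambda>t. ct.pos (fst (snd (snd (X t))))"
  have ex: "weak_sol m M g H0 EI GK l A E s1 s2 \<kappa> y0 th0 p10 p20 y1 th1 p11 p21 T ?p1 ?p2 ?y ?th" if "T > 0" for T
    by (rule state_imp_weak[OF X dX init that])
  have uniq: "q1 t x = ?p1 t x \<and> q2 t x = ?p2 t x \<and> z t x = ?y t x \<and> ph t x = ?th t x"
    if T: "T > 0" and ws: "weak_sol m M g H0 EI GK l A E s1 s2 \<kappa> y0 th0 p10 p20 y1 th1 p11 p21 T q1 q2 z ph"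
      and t: "t \<in> {0..T}" and x: "x \<in> {0..pi}" for T q1 q2 z ph t x
  proof -
    obtain Z where Z: "continuous_on {0..T} Z" "Z 0 = X0 y0 th0 p10 p20 y1 th1 p11 p21"
      "\<And>t. 0 < t \<Longrightarrow> t < T \<Longrightarrow> ((\<lambda>t. B (Z t)) has_vector_derivative Z t + B (G (Z t))) (at t)"
      and ZZ: "\<And>t x. t \<in> {0..T} \<Longrightarrow> x \<in> {0..pi} \<Longrightarrow> q1 t x = cp.pos (fst (fst (fst (Z t)))) x
        \<and> q2 t x = cp.pos (fst (snd (fst (Z t)))) x \<and> z t x = cy.pos (fst (fst (snd (Z t)))) x
        \<and> ph t x = ct.pos (fst (snd (snd (Z t)))) x"
      using weak_imp_state[OF ws T init] by blast
    \<comment> \<open>The comparison takes place on \<open>{0..T}\<close> with the restriction of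
      the global \<open>X\<close>, so a single solution serves every \<open>T\<close>.\<close>
    have "Z t = X t"
    proof (rule ev.unique_solution[OF T Z(1) _ _ Z(3) _ t])
      show "continuous_on {0..T} X" by (rule continuous_on_subset[OF X(2)]) auto
      show "Z 0 = X 0" by (simp only: X(1) Z(2))
      show "((\<lambda>t. B (X t)) has_vector_derivative X t + B (G (X t))) (at t)" if "0 < t" for t
        using that by (intro interior_derivative dX) auto
    qed
    then show ?thesis using ZZ[OF t x] by (simp only:)
  qed
  show ?thesis
    by (rule exI[of _ ?p1], rule exI[of _ ?p2], rule exI[of _ ?y], rule exI[of _ ?th])
       (intro conjI[OF allI[OF impI[OF ex]]] allI impI ballI uniq)
qed

end
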